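(* Let $G$ be a locally compact group acting continuously on a tree $X=(X^0,X^1)$ of bounded degree, and let $\gamma\in KK_G(\mathbf{C},\mathbf{C})$ be the class of the Fredholm module $(\pi_0,\pi_1,F)$ associated to this action. Then $\gamma=1$ in the Kasparov group $KK_G(\mathbf{C},\mathbf{C})$.
   Context: A tree $X=(X^0,X^1)$ is given by a set of vertices $X^0$ and a set of edges $X^1\subset X^0\times X^0$ stable under $(x,y)\mapsto(y,x)$, such that for any $x,y\in X^0$ there is a unique path joining $x$ to $y$. Each vertex $x$ has $q_x+1$ neighbours, and $q_x$ is assumed bounded. The group $G$ acts on $X^0$ preserving $X^1$; continuity of the action means that $X^0$ is discrete and vertex stabilizers are open. $\pi_0$ is the unitary representation of $G$ on $\ell^2(X^0)$ (canonical Hilbert basis $(\delta_x)_{x\in X^0}$) given by $\pi_0(g)\delta_x=\delta_{gx}$. $\ell^2(X^1)^-$ is the quotient of $\ell^2(X^1)$ by the closed subspace generated by the vectors $\delta_{(x,y)}+\delta_{(y,x)}$, $(x,y)\in X^1$; the image of $\delta_{(x,y)}$ is still denoted $\delta_{(x,y)}$, so $\delta_{(y,x)}=-\delta_{(x,y)}$, and the norm is normalized so that the $\delta_{(x,y)}$ are unit vectors (thus choosing one orientation of each edge gives an orthonormal basis). $\pi_1$ is the unitary representation of $G$ on $\ell^2(X^1)^-$ given by $\pi_1(g)\delta_{(x,y)}=\delta_{(gx,gy)}$. Fix an origin $x_0\in X^0$. For $x\neq x_0$ let $x'$ be the unique neighbour of $x$ lying on the path between $x_0$ and $x$. The Julg-Valette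 map is the bounded operator $F:\ell^2(X^0)\to\ell^2(X^1)^-$ with $F\delta_{x_0}=0$ and $F\delta_x=\delta_{(x,x')}$ for $x\ne x_0$. The class $\gamma$ is the class in $KK_G(\mathbf{C},\mathbf{C})$ of the Kasparov cycle consisting of the $\mathbf{Z}/2$-graded Hilbert space with even part $\ell^2(X^0)$ (with $G$ acting by $\pi_0$) and odd part $\ell^2(X^1)^-$ (with $G$ acting by $\pi_1$), $\mathbf{C}$ acting by scalars, and the operator $\begin{pmatrix} 0 & F^* \\ F & 0 \end{pmatrix}$. The element $1$ is the unit of the ring $KK_G(\mathbf{C},\mathbf{C})$, i.e. the class of the trivial one-dimensional representation of $G$ in even degree with zero operator. *)

theory Defs
  imports "HOL-Analysis.Analysis" "HOL-Library.Function_Algebras"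
begin

text \<open>
  Groups are written additively through the class \<open>topological_group_add\<close>, which does not
  presuppose commutativity.
\<close>

section \<open>Hilbert modules over C(T)\<close>

text \<open>
  Throughout, \<open>T\<close> is a nonempty compact set of reals and \<open>C(T)\<close> is the trivially graded
  C*-algebra of continuous functions on it, with trivial group action. Only two cases matter:
  \<open>T = {0}\<close>, where \<open>C(T)\<close> is the field of complex numbers and a Hilbert module is a complex Hilbert
  space, and \<open>T = {0..1}\<close>, which carries homotopies. Elements of \<open>C(T)\<close> are represented by functions
  on the reals, of which only the restriction to \<open>T\<close> is relevant; complex scalars are the
  constant functions. Addition is that of the ambient type; the remaining structure is explicit.
\<close>

record 'e hmod =
  carr :: "'e set"
  smul :: "(real \<Rightarrow> complex) \<Rightarrow> 'e \<Rightarrow> 'e"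
  inn :: "'e \<Rightarrow> 'e \<Rightarrow> real \<Rightarrow> complex"

definition hnorm :: "real set \<Rightarrow> ('e, 'm) hmod_scheme \<Rightarrow> 'e \<Rightarrow> real" where
  "hnorm T M x = (SUP t\<in>T. sqrt (Re (inn M x x t)))"

locale hilbert_module =
  fixes T :: "real set" and M :: "('e::ab_group_add, 'm) hmod_scheme"
  assumes base: "compact T" "T \<noteq> {}"
    and zero_closed: "0 \<in> carr M"
    and add_closed: "\<lbrakk>x \<in> carr M; y \<in> carr M\<rbrakk> \<Longrightarrow> x + y \<in> carr M"
    and minus_closed: "x \<in> carr M \<Longrightarrow> - x \<in> carr M"
    and smul_closed: "\<lbrakk>continuous_on T f; x \<in> carr M\<rbrakk> \<Longrightarrow> smul M f x \<in> carr M"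
    and smul_cong: "\<lbrakk>continuous_on T f; x \<in> carr M; \<And>t. t \<in> T \<Longrightarrow> f t = g t\<rbrakk>
      \<Longrightarrow> smul M f x = smul M g x"
    and smul_add_right: "\<lbrakk>continuous_on T f; x \<in> carr M; y \<in> carr M\<rbrakk>
      \<Longrightarrow> smul M f (x + y) = smul M f x + smul M f y"
    and smul_add_left: "\<lbrakk>continuous_on T f; continuous_on T g; x \<in> carr M\<rbrakk>
      \<Longrightarrow> smul M (\<lambda>t. f t + g t) x = smul M f x + smul M g x"
    and smul_mult: "\<lbrakk>continuous_on T f; continuous_on T g; x \<in> carr M\<rbrakk>
      \<Longrightarrow> smul M (\<lambda>t. f t * g t) x = smul M f (smul M g x)"
    and smul_one: "x \<in> carr M \<Longrightarrow> smul M (\<lambda>t. 1) x = x"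
    and inn_continuous: "\<lbrakk>x \<in> carr M; y \<in> carr M\<rbrakk> \<Longrightarrow> continuous_on T (inn M x y)"
    and inn_add: "\<lbrakk>x \<in> carr M; y \<in> carr M; z \<in> carr M; t \<in> T\<rbrakk>
      \<Longrightarrow> inn M x (y + z) t = inn M x y t + inn M x z t"
    and inn_smul: "\<lbrakk>continuous_on T f; x \<in> carr M; y \<in> carr M; t \<in> T\<rbrakk>
      \<Longrightarrow> inn M x (smul M f y) t = f t * inn M x y t"
    and inn_cnj: "\<lbrakk>x \<in> carr M; y \<in> carr M; t \<in> T\<rbrakk> \<Longrightarrow> inn M y x t = cnj (inn M x y t)"
    and inn_nonneg: "\<lbrakk>x \<in> carr M; t \<in> T\<rbrakk> \<Longrightarrow> 0 \<le> Re (inn M x x t)"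
    and inn_definite: "\<lbrakk>x \<in> carr M; \<And>t. t \<in> T \<Longrightarrow> inn M x x t = 0\<rbrakk> \<Longrightarrow> x = 0"
    and complete: "\<lbrakk>\<And>n. s n \<in> carr M;
        \<And>e. 0 < e \<Longrightarrow> \<exists>N. \<forall>m\<ge>N. \<forall>n\<ge>N. hnorm T M (s m - s n) < e\<rbrakk>
      \<Longrightarrow> \<exists>x\<in>carr M. (\<lambda>n. hnorm T M (s n - x)) \<longlonglongrightarrow> 0"

definition countably_generated :: "real set \<Rightarrow> ('e::ab_group_add, 'm) hmod_scheme \<Rightarrow> bool" where
  "countably_generated T M \<longleftrightarrow>
    (\<exists>s :: nat \<Rightarrow> 'e. range s \<subseteq> carr M \<and>
      (\<forall>x\<in>carr M. \<forall>e>0. \<exists>n f. (\<forall>i<n. continuous_on T (f i)) \<and>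
        hnorm T M (x - (\<Sum>i<n. smul M (f i) (s i))) < e))"

text \<open>Operators matter only on the carrier. Adjointable ones are automatically \<open>C(T)\<close>-linear and
  bounded.\<close>

definition is_adjoint :: "real set \<Rightarrow> ('e, 'm) hmod_scheme \<Rightarrow> ('e \<Rightarrow> 'e) \<Rightarrow> ('e \<Rightarrow> 'e) \<Rightarrow> bool" where
  "is_adjoint T M A B \<longleftrightarrow> A \<in> carr M \<rightarrow> carr M \<and> B \<in> carr M \<rightarrow> carr M \<and>
    (\<forall>x\<in>carr M. \<forall>y\<in>carr M. \<forall>t\<in>T. inn M (A x) y t = inn M x (B y) t)"

definition adjointable :: "real set \<Rightarrow> ('e, 'm) hmod_scheme \<Rightarrow> ('e \<Rightarrow> 'e) \<Rightarrow> bool" where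
  "adjointable T M A \<longleftrightarrow> (\<exists>B. is_adjoint T M A B)"

text \<open>The operator norm of \<open>A - B\<close> is at most \<open>e\<close>.\<close>

definition op_close ::
    "real set \<Rightarrow> ('e::ab_group_add, 'm) hmod_scheme \<Rightarrow> ('e \<Rightarrow> 'e) \<Rightarrow> ('e \<Rightarrow> 'e) \<Rightarrow> real \<Rightarrow> bool" where
  "op_close T M A B e \<longleftrightarrow> (\<forall>x\<in>carr M. hnorm T M (A x - B x) \<le> e * hnorm T M x)"

definition rank_one :: "('e, 'm) hmod_scheme \<Rightarrow> 'e \<Rightarrow> 'e \<Rightarrow> 'e \<Rightarrow> 'e" where
  "rank_one M x y z = smul M (inn M y z) x"

text \<open>The compact operators in the sense of Hilbert modules: the norm closure of the span of the
  rank-one operators.\<close>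

definition compact_op :: "real set \<Rightarrow> ('e::ab_group_add, 'm) hmod_scheme \<Rightarrow> ('e \<Rightarrow> 'e) \<Rightarrow> bool" where
  "compact_op T M A \<longleftrightarrow> adjointable T M A \<and>
    (\<forall>e>0. \<exists>(n::nat) x y. (\<forall>i<n. x i \<in> carr M \<and> y i \<in> carr M) \<and>
      op_close T M A (\<lambda>z. \<Sum>i<n. rank_one M (x i) (y i) z) e)"

definition norm_continuous ::
    "real set \<Rightarrow> ('e::ab_group_add, 'm) hmod_scheme \<Rightarrow> ('g::topological_space \<Rightarrow> 'e \<Rightarrow> 'e) \<Rightarrow> bool" where
  "norm_continuous T M A \<longleftrightarrow> (\<forall>g. \<forall>e>0. \<forall>\<^sub>F h in nhds g. op_close T M (A h) (A g) e)"


section \<open>Kasparov cycles for the pair (C, C(T))\<close>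

text \<open>The \<open>Z/2\<close>-grading is encoded by its grading automorphism: the identity on the even part and
  minus the identity on the odd part.\<close>

record ('g, 'e) kcycle = "'e hmod" +
  grad :: "'e \<Rightarrow> 'e"
  rep :: "'g \<Rightarrow> 'e \<Rightarrow> 'e"
  phi :: "complex \<Rightarrow> 'e \<Rightarrow> 'e"
  oper :: "'e \<Rightarrow> 'e"

locale kasparov_cycle = hilbert_module T c
  for T and c :: "('g::topological_group_add, 'e::ab_group_add) kcycle" +
  assumes countably_generated: "countably_generated T c"
    \<comment> \<open>grading\<close>
    and grad_adjoint: "is_adjoint T c (grad c) (grad c)"
    and grad_involution: "x \<in> carr c \<Longrightarrow> grad c (grad c x) = x"
    \<comment> \<open>continuous unitary action of the group, of degree 0\<close>
    and rep_adjoint: "is_adjoint T c (rep c g) (rep c (- g))"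
    and rep_zero: "x \<in> carr c \<Longrightarrow> rep c 0 x = x"
    and rep_add: "x \<in> carr c \<Longrightarrow> rep c (g + h) x = rep c g (rep c h x)"
    and rep_grad: "x \<in> carr c \<Longrightarrow> rep c g (grad c x) = grad c (rep c g x)"
    and rep_continuous: "x \<in> carr c \<Longrightarrow> ((\<lambda>h. hnorm T c (rep c h x - rep c g x)) \<longlongrightarrow> 0) (at g)"
    \<comment> \<open>equivariant *-homomorphism from the complex numbers, of degree 0\<close>
    and phi_adjoint: "is_adjoint T c (phi c a) (phi c (cnj a))"
    and phi_add: "x \<in> carr c \<Longrightarrow> phi c (a + b) x = phi c a x + phi c b x"
    and phi_mult: "x \<in> carr c \<Longrightarrow> phi c (a * b) x = phi c a (phi c b x)"
    and phi_scale: "x \<in> carr c \<Longrightarrow> phi c (a * b) x = smul c (\<lambda>t. a) (phi c b x)"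
    and phi_grad: "x \<in> carr c \<Longrightarrow> phi c a (grad c x) = grad c (phi c a x)"
    and phi_rep: "x \<in> carr c \<Longrightarrow> rep c g (phi c a x) = phi c a (rep c g x)"
    \<comment> \<open>the operator, of degree 1\<close>
    and oper_adjointable: "adjointable T c (oper c)"
    and oper_odd: "x \<in> carr c \<Longrightarrow> oper c (grad c x) = - grad c (oper c x)"
    and oper_commutator: "compact_op T c (\<lambda>x. phi c a (oper c x) - oper c (phi c a x))"
    and oper_square: "compact_op T c (\<lambda>x. oper c (oper c (phi c a x)) - phi c a x)"
    and oper_selfadjoint:
      "is_adjoint T c (oper c) B \<Longrightarrow> compact_op T c (\<lambda>x. oper c (phi c a x) - B (phi c a x))"
    and oper_equivariant:
      "compact_op T c (\<lambda>x. rep c g (oper c (rep c (- g) (phi c a x))) - oper c (phi c a x))"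
    and oper_continuous_left:
      "norm_continuous T c (\<lambda>g x. rep c g (phi c a (oper c (rep c (- g) x))))"
    and oper_continuous_right:
      "norm_continuous T c (\<lambda>g x. rep c g (oper c (phi c a (rep c (- g) x))))"

text \<open>
  \<open>specializes t c d v\<close>: the map \<open>v\<close> implements an isomorphism of the cycle \<open>d\<close> over the complex
  numbers with the push-forward of \<open>c\<close> along evaluation at \<open>t\<close>. The Hilbert space of the push-forward is
  the completion of \<open>carr c\<close> for the scalar product \<open>inn c x y t\<close> (modulo null vectors), so an
  isomorphism from it is the same as an isometric map with dense range.
\<close>

definition specializes ::
    "real \<Rightarrow> ('g, 'e::ab_group_add) kcycle \<Rightarrow> ('g, 'f::ab_group_add) kcycle \<Rightarrow> ('e \<Rightarrow> 'f) \<Rightarrow> bool" where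
  "specializes t c d v \<longleftrightarrow> v \<in> carr c \<rightarrow> carr d \<and>
    (\<forall>x\<in>carr c. \<forall>y\<in>carr c. v (x + y) = v x + v y) \<and>
    (\<forall>x\<in>carr c. \<forall>a. v (smul c (\<lambda>s. a) x) = smul d (\<lambda>s. a) (v x)) \<and>
    (\<forall>x\<in>carr c. \<forall>y\<in>carr c. inn d (v x) (v y) 0 = inn c x y t) \<and>
    (\<forall>y\<in>carr d. \<forall>e>0. \<exists>x\<in>carr c. hnorm {0} d (y - v x) < e) \<and>
    (\<forall>x\<in>carr c. v (grad c x) = grad d (v x)) \<and>
    (\<forall>x\<in>carr c. \<forall>g. v (rep c g x) = rep d g (v x)) \<and>
    (\<forall>x\<in>carr c. \<forall>a. v (phi c a x) = phi d a (v x)) \<and>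
    (\<forall>x\<in>carr c. v (oper c x) = oper d (v x))"


section \<open>The Kasparov group KK_G(C,C)\<close>

text \<open>
  Cycles representing the elements of the group have their vectors in a fixed type. This is no restriction
  up to isomorphism: if \<open>s 0, s 1, ...\<close> generate a Hilbert \<open>C(T)\<close>-module \<open>M\<close>, then
  \<open>\<lambda>x n t. if t \<in> T then inn M (s n) x t else 0\<close> is an injective linear map of \<open>M\<close> into this type.
\<close>

type_synonym univ = "nat \<Rightarrow> real \<Rightarrow> complex"

abbreviation cycle_CC :: "('g::topological_group_add, 'e::ab_group_add) kcycle \<Rightarrow> bool" where
  "cycle_CC \<equiv> kasparov_cycle {0}"

definition isomorphic_CC ::
    "('g::topological_group_add, 'e::ab_group_add) kcycle \<Rightarrow> ('g, 'f::ab_group_add) kcycle \<Rightarrow> bool" where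
  "isomorphic_CC c d \<longleftrightarrow> cycle_CC c \<and> cycle_CC d \<and> (\<exists>v. specializes 0 c d v)"

definition homotopic_CC ::
    "('g::topological_group_add, univ) kcycle \<Rightarrow> ('g, univ) kcycle \<Rightarrow> bool" where
  "homotopic_CC c d \<longleftrightarrow> cycle_CC c \<and> cycle_CC d \<and>
    (\<exists>h :: ('g, univ) kcycle. kasparov_cycle {0..1} h \<and>
      (\<exists>v. specializes 0 h c v) \<and> (\<exists>w. specializes 1 h d w))"

text \<open>The equivalence relation generated by homotopy (which is homotopy itself).\<close>

definition KK_rel :: "(('g::topological_group_add, univ) kcycle \<times> ('g, univ) kcycle) set" where
  "KK_rel = {(c, d). cycle_CC c \<and> cycle_CC d \<and> equivclp homotopic_CC c d}"

definition KK_CC :: "('g::topological_group_add, univ) kcycle set set" where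
  "KK_CC = {c. cycle_CC c} // KK_rel"

definition KK_class ::
    "('g::topological_group_add, 'e::ab_group_add) kcycle \<Rightarrow> ('g, univ) kcycle set" where
  "KK_class c = KK_rel `` {d. isomorphic_CC c d}"

definition trivial_cycle :: "('g, complex) kcycle" where
  "trivial_cycle = \<lparr>
    carr = UNIV,
    smul = (\<lambda>f x. f 0 * x),
    inn = (\<lambda>x y t. cnj x * y),
    grad = (\<lambda>x. x),
    rep = (\<lambda>g x. x),
    phi = (\<lambda>a x. a * x),
    oper = (\<lambda>x. 0)\<rparr>"

definition KK_one :: "('g::topological_group_add, univ) kcycle set" where
  "KK_one = KK_class trivial_cycle"


section \<open>Group actions on trees\<close>

definition path_between :: "'v set \<Rightarrow> ('v \<times> 'v) set \<Rightarrow> 'v \<Rightarrow> 'v list \<Rightarrow> 'v \<Rightarrow> bool" where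
  "path_between X0 X1 x p y \<longleftrightarrow> p \<noteq> [] \<and> hd p = x \<and> last p = y \<and> set p \<subseteq> X0 \<and> distinct p \<and>
    successively (\<lambda>u v. (u, v) \<in> X1) p"

text \<open>As paths do not repeat vertices, loops must be excluded separately.\<close>

definition tree :: "'v set \<Rightarrow> ('v \<times> 'v) set \<Rightarrow> bool" where
  "tree X0 X1 \<longleftrightarrow> X1 \<subseteq> X0 \<times> X0 \<and> sym X1 \<and> irrefl X1 \<and>
    (\<forall>x\<in>X0. \<forall>y\<in>X0. \<exists>!p. path_between X0 X1 x p y)"

definition bounded_degree :: "'v set \<Rightarrow> ('v \<times> 'v) set \<Rightarrow> bool" where
  "bounded_degree X0 X1 \<longleftrightarrow>
    (\<exists>k. \<forall>x\<in>X0. finite {y. (x, y) \<in> X1} \<and> card {y. (x, y) \<in> X1} \<le> k)"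

definition continuous_action ::
    "'v set \<Rightarrow> ('v \<times> 'v) set \<Rightarrow> ('g::topological_group_add \<Rightarrow> 'v \<Rightarrow> 'v) \<Rightarrow> bool" where
  "continuous_action X0 X1 act \<longleftrightarrow>
    (\<forall>g. \<forall>x\<in>X0. act g x \<in> X0) \<and>
    (\<forall>x\<in>X0. act 0 x = x) \<and>
    (\<forall>g h. \<forall>x\<in>X0. act (g + h) x = act g (act h x)) \<and>
    (\<forall>g x y. (x, y) \<in> X1 \<longrightarrow> (act g x, act g y) \<in> X1) \<and>
    (\<forall>x\<in>X0. open {g. act g x = x})"

definition toward :: "'v set \<Rightarrow> ('v \<times> 'v) set \<Rightarrow> 'v \<Rightarrow> 'v \<Rightarrow> 'v" where
  "toward X0 X1 x0 x = (THE y. (x, y) \<in> X1 \<and> (\<exists>p. path_between X0 X1 x0 p x \<and> y \<in> set p))"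


section \<open>The Julg-Valette cycle\<close>

definition l2_vertices :: "'v set \<Rightarrow> ('v \<Rightarrow> complex) set" where
  "l2_vertices X0 = {f. (\<forall>x. x \<notin> X0 \<longrightarrow> f x = 0) \<and> (\<lambda>x. (cmod (f x))\<^sup>2) summable_on X0}"

definition inner_vertices :: "'v set \<Rightarrow> ('v \<Rightarrow> complex) \<Rightarrow> ('v \<Rightarrow> complex) \<Rightarrow> complex" where
  "inner_vertices X0 f g = (\<Sum>\<^sub>\<infinity>x\<in>X0. cnj (f x) * g x)"

definition delta_vertex :: "'v \<Rightarrow> 'v \<Rightarrow> complex" where
  "delta_vertex x = (\<lambda>y. if y = x then 1 else 0)"

text \<open>
  The quotient of \<open>l2(X1)\<close> by the closed span of the \<open>\<delta>(x,y) + \<delta>(y,x)\<close> is realized as the space of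
  square-summable antisymmetric functions, the quotient map being \<open>f \<mapsto> (\<lambda>(x, y). f (x, y) - f (y, x))\<close>: it is onto,
  and its kernel, the space of symmetric functions, is that closed span. The factor \<open>1/2\<close> in the
  scalar product makes \<open>delta_edge x y\<close>, the image of \<open>\<delta>(x,y)\<close>, a unit vector.
\<close>

definition l2_edges :: "('v \<times> 'v) set \<Rightarrow> ('v \<times> 'v \<Rightarrow> complex) set" where
  "l2_edges X1 = {f. (\<forall>e. e \<notin> X1 \<longrightarrow> f e = 0) \<and> (\<forall>x y. f (y, x) = - f (x, y)) \<and>
    (\<lambda>e. (cmod (f e))\<^sup>2) summable_on X1}"

definition inner_edges :: "('v \<times> 'v) set \<Rightarrow> ('v \<times> 'v \<Rightarrow> complex) \<Rightarrow> ('v \<times> 'v \<Rightarrow> complex) \<Rightarrow> complex" where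
  "inner_edges X1 f g = (\<Sum>\<^sub>\<infinity>e\<in>X1. cnj (f e) * g e) / 2"

definition delta_edge :: "'v \<Rightarrow> 'v \<Rightarrow> 'v \<times> 'v \<Rightarrow> complex" where
  "delta_edge x y = (\<lambda>e. (if e = (x, y) then 1 else 0) - (if e = (y, x) then 1 else 0))"

definition pi0 :: "'v set \<Rightarrow> ('g::group_add \<Rightarrow> 'v \<Rightarrow> 'v) \<Rightarrow> 'g \<Rightarrow> ('v \<Rightarrow> complex) \<Rightarrow> 'v \<Rightarrow> complex" where
  "pi0 X0 act g f = (\<lambda>x. if x \<in> X0 then f (act (- g) x) else 0)"

definition pi1 ::
    "('v \<times> 'v) set \<Rightarrow> ('g::group_add \<Rightarrow> 'v \<Rightarrow> 'v) \<Rightarrow> 'g \<Rightarrow> ('v \<times> 'v \<Rightarrow> complex) \<Rightarrow> 'v \<times> 'v \<Rightarrow> complex" where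
  "pi1 X1 act g f = (\<lambda>(x, y). if (x, y) \<in> X1 then f (act (- g) x, act (- g) y) else 0)"

text \<open>The linear and continuous extension of \<open>\<delta> x0 \<mapsto> 0\<close> and \<open>\<delta> x \<mapsto> delta_edge x x'\<close>. For fixed \<open>e\<close>
  the sum has at most two nonzero terms.\<close>

definition JV :: "'v set \<Rightarrow> ('v \<times> 'v) set \<Rightarrow> 'v \<Rightarrow> ('v \<Rightarrow> complex) \<Rightarrow> 'v \<times> 'v \<Rightarrow> complex" where
  "JV X0 X1 x0 f = (\<lambda>e. \<Sum>\<^sub>\<infinity>x\<in>X0 - {x0}. f x * delta_edge x (toward X0 X1 x0 x) e)"

text \<open>The adjoint: the coefficient of \<open>F* f\<close> at \<open>x\<close> is the scalar product of \<open>F (\<delta> x)\<close> with \<open>f\<close>.\<close>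

definition JV_adj :: "'v set \<Rightarrow> ('v \<times> 'v) set \<Rightarrow> 'v \<Rightarrow> ('v \<times> 'v \<Rightarrow> complex) \<Rightarrow> 'v \<Rightarrow> complex" where
  "JV_adj X0 X1 x0 f =
    (\<lambda>x. if x \<in> X0 then inner_edges X1 (JV X0 X1 x0 (delta_vertex x)) f else 0)"

definition JV_cycle ::
    "'v set \<Rightarrow> ('v \<times> 'v) set \<Rightarrow> ('g::group_add \<Rightarrow> 'v \<Rightarrow> 'v) \<Rightarrow> 'v
      \<Rightarrow> ('g, ('v \<Rightarrow> complex) \<times> ('v \<times> 'v \<Rightarrow> complex)) kcycle" where
  "JV_cycle X0 X1 act x0 = \<lparr>
    carr = l2_vertices X0 \<times> l2_edges X1,
    smul = (\<lambda>a (f, k). (\<lambda>x. a 0 * f x, \<lambda>e. a 0 * k e)),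
    inn = (\<lambda>(f, k) (f', k') t. inner_vertices X0 f f' + inner_edges X1 k k'),
    grad = (\<lambda>(f, k). (f, - k)),
    rep = (\<lambda>g (f, k). (pi0 X0 act g f, pi1 X1 act g k)),
    phi = (\<lambda>a (f, k). (\<lambda>x. a * f x, \<lambda>e. a * k e)),
    oper = (\<lambda>(f, k). (JV_adj X0 X1 x0 k, JV X0 X1 x0 f))\<rparr>"

definition gamma ::
    "'v set \<Rightarrow> ('v \<times> 'v) set \<Rightarrow> ('g::topological_group_add \<Rightarrow> 'v \<Rightarrow> 'v) \<Rightarrow> 'v \<Rightarrow> ('g, univ) kcycle set" where
  "gamma X0 X1 act x0 = KK_class (JV_cycle X0 X1 act x0)"

end

theory Submission
  imports Defs
begin

text \<open>
  Following Julg and Valette, one deforms the representation on the vertices through the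
  representations \<open>\<pi>\<^sub>r\<close> attached to the positive definite kernels \<open>r ^ d(x, y)\<close>, with \<open>0 \<le> r \<le> 1\<close>. For \<open>r < 1\<close>, with
  \<open>x'\<close> the neighbour of \<open>x\<close> towards \<open>x0\<close>, the vectors \<open>(e x - r e x') / sqrt (1 - r\<^sup>2)\<close> together with \<open>e x0\<close>
  form an orthonormal basis of the Hilbert space of the kernel, so \<open>\<pi>\<^sub>r\<close> acts on \<open>l2(X0)\<close>, and it extends
  norm continuously to \<open>r = 1\<close>: \<open>\<pi>\<^sub>r(g)\<close> is the permutation of the vertices by \<open>g\<close> followed by a product of plane rotations along
  the path from \<open>x0\<close> to \<open>g x0\<close>. At \<open>r = 0\<close> this is \<open>\<pi>\<^sub>0\<close>; at \<open>r = 1\<close> it is the sum of the trivial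
  representation on \<open>\<delta> x0\<close> and a copy of \<open>\<pi>\<^sub>1\<close> that the operator \<open>F\<close> intertwines with \<open>\<pi>\<^sub>1\<close> exactly. The cycle at
  \<open>r = 1\<close> is therefore the unit plus a degenerate cycle, and the latter is removed within the same
  homotopy by letting the fibre at the end point be just the line of \<open>\<delta> x0\<close>.
\<close>

section \<open>Hilbert modules\<close>

text \<open>An antisymmetric function on the edges is determined by its values on the edges directed
  towards \<open>x0\<close>. In these coordinates both halves of the cycle are functions on the
  vertices, the odd half lacking \<open>x0\<close>, and the operator is the identity off
  \<open>x0\<close>; so the operator stays fixed and only the even representation moves. The formula
  through rotations is chosen because the kernel degenerates at \<open>r = 1\<close> while the
  rotations stay continuous there, and because they differ from a permutation only along a finite
  path, which makes the commutators of finite rank uniformly in the parameter. The group law rests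
  on the absence of cycles: a product of rotations along a walk depends on its ends alone. Shrinking
  the last fibre has a price: constant sections at vertices other than \<open>x0\<close> leave the
  module, so both countable generation and compactness need a substitute, sections multiplied by a
  cutoff. The cutoff drops below 1 only where \<open>r = 1\<close>; there the commutators vanish,
  and no coefficient has to be divided by the cutoff.\<close>

lemma is_adjoint_compose:
  assumes "is_adjoint T M A B" "is_adjoint T M A' B'"
  shows "is_adjoint T M (\<lambda>x. A (A' x)) (\<lambda>x. B' (B x))"
  using assms unfolding is_adjoint_def by (auto simp: Pi_iff)

lemma is_adjoint_cong:
  assumes "is_adjoint T M A B" "\<And>x. x \<in> carr M \<Longrightarrow> A x = A' x" "\<And>x. x \<in> carr M \<Longrightarrow> B x = B' x"
  shows "is_adjoint T M A' B'"
  using assms unfolding is_adjoint_def by (auto simp: Pi_iff)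

text \<open>Compactness bounds the set under the supremum. The lemma stands outside the locale
  because completeness of a concrete module uses it before that module is known to be a Hilbert
  module.\<close>

lemma sqrt_inn_le_hnorm_if_continuous:
  assumes "compact T" "continuous_on T (inn M x x)" "t \<in> T"
  shows "sqrt (Re (inn M x x t)) \<le> hnorm T M x"
  unfolding hnorm_def
proof (rule cSUP_upper)
  have "continuous_on T (\<lambda>t. sqrt (Re (inn M x x t)))"
    using assms(2) by (intro continuous_intros)
  then show "bdd_above ((\<lambda>t. sqrt (Re (inn M x x t))) ` T)"
    using assms(1) by (intro bounded_imp_bdd_above compact_imp_bounded compact_continuous_image)
qed (fact assms(3))

context hilbert_module
begin

lemma diff_closed: "x \<in> carr M \<Longrightarrow> y \<in> carr M \<Longrightarrow> x - y \<in> carr M"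
  using add_closed[of x "- y"] minus_closed[of y] by simp

lemma sum_closed: "(\<And>i. i \<in> I \<Longrightarrow> f i \<in> carr M) \<Longrightarrow> (\<Sum>i\<in>I. f i) \<in> carr M"
  by (induction I rule: infinite_finite_induct) (auto simp: zero_closed add_closed)

lemma inn_zero_right: "x \<in> carr M \<Longrightarrow> t \<in> T \<Longrightarrow> inn M x 0 t = 0"
  using inn_add[of x 0 0 t] zero_closed by simp

lemma inn_minus_right: "x \<in> carr M \<Longrightarrow> y \<in> carr M \<Longrightarrow> t \<in> T \<Longrightarrow> inn M x (- y) t = - inn M x y t"
  using inn_add[of x y "- y" t] inn_zero_right[of x t] minus_closed[of y]
  by (simp add: eq_neg_iff_add_eq_0 add.commute)

lemma inn_diff_right:
  "x \<in> carr M \<Longrightarrow> y \<in> carr M \<Longrightarrow> z \<in> carr M \<Longrightarrow> t \<in> T \<Longrightarrow> inn M x (y - z) t = inn M x y t - inn M x z t"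
  using inn_add[of x y "- z" t] inn_minus_right[of x z t] minus_closed[of z] by simp

lemma inn_add_left:
  "x \<in> carr M \<Longrightarrow> y \<in> carr M \<Longrightarrow> z \<in> carr M \<Longrightarrow> t \<in> T \<Longrightarrow> inn M (x + y) z t = inn M x z t + inn M y z t"
  using inn_cnj[of z "x + y" t] inn_cnj[of z x t] inn_cnj[of z y t] inn_add[of z x y t] add_closed[of x y]
  by simp

lemma inn_minus_left: "x \<in> carr M \<Longrightarrow> y \<in> carr M \<Longrightarrow> t \<in> T \<Longrightarrow> inn M (- x) y t = - inn M x y t"
  using inn_cnj[of y "- x" t] inn_cnj[of y x t] inn_minus_right[of y x t] minus_closed[of x] by simp

lemma inn_diff_left:
  "x \<in> carr M \<Longrightarrow> y \<in> carr M \<Longrightarrow> z \<in> carr M \<Longrightarrow> t \<in> T \<Longrightarrow> inn M (x - y) z t = inn M x z t - inn M y z t"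
  using inn_add_left[of x "- y" z t] inn_minus_left[of y z t] minus_closed[of y] by simp

lemma inn_smul_left:
  "continuous_on T f \<Longrightarrow> x \<in> carr M \<Longrightarrow> y \<in> carr M \<Longrightarrow> t \<in> T \<Longrightarrow> inn M (smul M f x) y t = cnj (f t) * inn M x y t"
  using inn_cnj[of y "smul M f x" t] inn_cnj[of y x t] inn_smul[of f y x t] smul_closed[of f x] by simp

lemma eq_if_inn_eq:
  assumes "x \<in> carr M" "y \<in> carr M" "\<And>z t. z \<in> carr M \<Longrightarrow> t \<in> T \<Longrightarrow> inn M z x t = inn M z y t"
  shows "x = y"
proof -
  have "x - y = 0"
    using assms diff_closed[of x y] by (intro inn_definite) (auto simp: inn_diff_right)
  then show ?thesis by simp
qed

text \<open>Cauchy-Schwarz at one point of the base, from the discriminant of the non-negative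
  quadratic \<open><y + l x, y + l x>\<close> in a real variable \<open>l\<close>; real
  \<open>l\<close> suffices for a bound on the real part.\<close>

lemma Re_inn_le:
  assumes x: "x \<in> carr M" and y: "y \<in> carr M" and t: "t \<in> T"
  shows "Re (inn M x y t) \<le> sqrt (Re (inn M x x t)) * sqrt (Re (inn M y y t))"
proof -
  define a where "a = Re (inn M x x t)"
  define b where "b = Re (inn M y y t)"
  define c where "c = Re (inn M x y t)"
  have pos: "0 \<le> b + 2 * l * c + l\<^sup>2 * a" for l :: real
  proof -
    define z where "z = smul M (\<lambda>_. of_real l) x"
    have z: "z \<in> carr M" unfolding z_def using x by (intro smul_closed) auto
    have 1: "inn M z z t = of_real (l\<^sup>2) * inn M x x t"
      unfolding z_def using x t by (subst inn_smul_left) (auto simp: inn_smul smul_closed power2_eq_square)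
    have 2: "inn M y z t = of_real l * cnj (inn M x y t)"
      unfolding z_def using x y t inn_cnj[of x y t] by (subst inn_smul) auto
    have 3: "inn M z y t = of_real l * inn M x y t"
      unfolding z_def using x y t by (subst inn_smul_left) auto
    have "inn M (y + z) (y + z) t = inn M y y t + inn M z y t + inn M y z t + inn M z z t"
      using y z t add_closed[of y z] by (simp add: inn_add inn_add_left)
    then have "Re (inn M (y + z) (y + z) t) = b + 2 * l * c + l\<^sup>2 * a"
      unfolding 1 2 3 a_def b_def c_def by (simp flip: of_real_power)
    then show ?thesis using inn_nonneg[of "y + z" t] add_closed[OF y z] t by simp
  qed
  have a: "0 \<le> a" and b: "0 \<le> b" unfolding a_def b_def using inn_nonneg x y t by auto
  have "c\<^sup>2 \<le> a * b"
  proof (cases "a = 0")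
    case True
    have "c = 0"
    proof (rule ccontr)
      assume "c \<noteq> 0"
      \<comment> \<open>With \<open>a = 0\<close> the quadratic is affine in \<open>l\<close>, and
        this \<open>l\<close> gives it the value -1.\<close>
      then show False using pos[of "- (b + 1) / (2 * c)"] True by (simp add: field_simps)
    qed
    then show ?thesis using a b by simp
  next
    case False
    then have "a > 0" using a by simp
    \<comment> \<open>The minimizer of the quadratic.\<close>
    then show ?thesis using pos[of "- c / a"] by (simp add: field_simps power2_eq_square)
  qed
  then have "c \<le> sqrt (a * b)" by (rule real_le_rsqrt)
  then show ?thesis by (simp add: a_def b_def c_def real_sqrt_mult)
qed

lemma sqrt_inn_triangle:
  assumes x: "x \<in> carr M" and y: "y \<in> carr M" and t: "t \<in> T"
  shows "sqrt (Re (inn M (x + y) (x + y) t)) \<le> sqrt (Re (inn M x x t)) + sqrt (Re (inn M y y t))"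
proof (rule real_le_lsqrt)
  have "Re (inn M (x + y) (x + y) t) = Re (inn M x x t) + 2 * Re (inn M x y t) + Re (inn M y y t)"
    using x y t add_closed[of x y] inn_cnj[of x y t] by (simp add: inn_add inn_add_left)
  also have "\<dots> \<le> (sqrt (Re (inn M x x t)) + sqrt (Re (inn M y y t)))\<^sup>2"
    using Re_inn_le[OF x y t] inn_nonneg[OF x t] inn_nonneg[OF y t] by (simp add: power2_sum)
  finally show "Re (inn M (x + y) (x + y) t) \<le> (sqrt (Re (inn M x x t)) + sqrt (Re (inn M y y t)))\<^sup>2" .
qed (use inn_nonneg x y t add_closed[of x y] in auto)

lemma sqrt_inn_le_hnorm: "x \<in> carr M \<Longrightarrow> t \<in> T \<Longrightarrow> sqrt (Re (inn M x x t)) \<le> hnorm T M x"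
  by (rule sqrt_inn_le_hnorm_if_continuous[OF base(1) inn_continuous])

lemma hnorm_leI: "(\<And>t. t \<in> T \<Longrightarrow> sqrt (Re (inn M x x t)) \<le> b) \<Longrightarrow> hnorm T M x \<le> b"
  unfolding hnorm_def using base(2) by (intro cSUP_least) auto

lemma hnorm_nonneg: "x \<in> carr M \<Longrightarrow> 0 \<le> hnorm T M x"
  using sqrt_inn_le_hnorm[of x] inn_nonneg[of x] base(2)
  by (metis ex_in_conv order_trans real_sqrt_ge_zero)

lemma hnorm_zero: "hnorm T M 0 = 0"
proof -
  have "hnorm T M 0 \<le> 0"
    by (rule hnorm_leI) (simp add: inn_zero_right zero_closed)
  then show ?thesis using hnorm_nonneg[OF zero_closed] by simp
qed

lemma hnorm_triangle:
  assumes "x \<in> carr M" "y \<in> carr M"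
  shows "hnorm T M (x + y) \<le> hnorm T M x + hnorm T M y"
proof (rule hnorm_leI)
  fix t assume "t \<in> T"
  then show "sqrt (Re (inn M (x + y) (x + y) t)) \<le> hnorm T M x + hnorm T M y"
    using sqrt_inn_triangle[OF assms] sqrt_inn_le_hnorm[OF assms(1)] sqrt_inn_le_hnorm[OF assms(2)]
    by fastforce
qed

text \<open>The self-adjointness axiom of a cycle speaks of an arbitrary adjoint \<open>B\<close>;
  uniqueness lets a known adjoint stand for it.\<close>

lemma is_adjoint_unique:
  assumes "is_adjoint T M A B" "is_adjoint T M A B'" "x \<in> carr M"
  shows "B x = B' x"
  using assms unfolding is_adjoint_def by (intro eq_if_inn_eq) (auto simp: Pi_iff)

lemma is_adjoint_diff:
  assumes "is_adjoint T M A B" "is_adjoint T M A' B'"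
  shows "is_adjoint T M (\<lambda>x. A x - A' x) (\<lambda>x. B x - B' x)"
  using assms unfolding is_adjoint_def by (auto simp: Pi_iff inn_diff_left inn_diff_right diff_closed)

lemma is_adjoint_zero: "is_adjoint T M (\<lambda>x. 0) (\<lambda>x. 0)"
  using inn_minus_left[of 0] zero_closed
  unfolding is_adjoint_def by (auto simp: inn_zero_right)

text \<open>An operator of finite rank is its own approximant for every \<open>e\<close>. The index
  set is renumbered because the definition of compactness sums over initial segments of the
  naturals.\<close>

lemma compact_op_finite_rank:
  assumes "adjointable T M A" "finite I" "\<And>i. i \<in> I \<Longrightarrow> u i \<in> carr M \<and> w i \<in> carr M"
    and A: "\<And>z. z \<in> carr M \<Longrightarrow> A z = (\<Sum>i\<in>I. rank_one M (u i) (w i) z)"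
  shows "compact_op T M A"
  unfolding compact_op_def
proof (intro conjI allI impI)
  fix e :: real assume "e > 0"
  obtain h where h: "bij_betw h {..<card I} I"
    using ex_bij_betw_nat_finite[OF assms(2)] unfolding atLeast0LessThan by blast
  have "A z = (\<Sum>i<card I. rank_one M (u (h i)) (w (h i)) z)" if "z \<in> carr M" for z
    unfolding A[OF that] by (rule sum.reindex_bij_betw[OF h, symmetric])
  then have "op_close T M A (\<lambda>z. \<Sum>i<card I. rank_one M (u (h i)) (w (h i)) z) e"
    using \<open>e > 0\<close> by (auto simp: op_close_def hnorm_zero hnorm_nonneg)
  moreover have "u (h i) \<in> carr M \<and> w (h i) \<in> carr M" if "i < card I" for i
    using bij_betwE[OF h] assms(3) that by blast
  ultimately show "\<exists>(n::nat) x y. (\<forall>i<n. x i \<in> carr M \<and> y i \<in> carr M) \<and>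
      op_close T M A (\<lambda>z. \<Sum>i<n. rank_one M (x i) (y i) z) e"
    by (intro exI[of _ "card I"] exI[of _ "u \<circ> h"] exI[of _ "w \<circ> h"]) simp
qed (fact assms(1))

lemma compact_op_vanishing:
  assumes "\<And>x. x \<in> carr M \<Longrightarrow> A x = 0"
  shows "compact_op T M A"
proof (rule compact_op_finite_rank[of _ "{}"])
  show "adjointable T M A"
    using is_adjoint_cong[OF is_adjoint_zero] assms by (auto simp: adjointable_def)
qed (use assms in auto)

end


section \<open>Isomorphisms of cycles\<close>

text \<open>Stronger than \<open>specializes\<close>: a bijection over one common base that respects
  all continuous scalars, so that each axiom of a cycle passes from \<open>c\<close> to
  \<open>d\<close>.\<close>

definition cycle_iso ::
    "real set \<Rightarrow> ('g, 'e::ab_group_add) kcycle \<Rightarrow> ('g, 'f::ab_group_add) kcycle \<Rightarrow> ('e \<Rightarrow> 'f) \<Rightarrow> bool" where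
  "cycle_iso T c d v \<longleftrightarrow> bij_betw v (carr c) (carr d) \<and>
    (\<forall>x\<in>carr c. \<forall>y\<in>carr c. v (x + y) = v x + v y) \<and>
    (\<forall>f. continuous_on T f \<longrightarrow> (\<forall>x\<in>carr c. v (smul c f x) = smul d f (v x))) \<and>
    (\<forall>x\<in>carr c. \<forall>y\<in>carr c. \<forall>t\<in>T. inn d (v x) (v y) t = inn c x y t) \<and>
    (\<forall>x\<in>carr c. v (grad c x) = grad d (v x)) \<and>
    (\<forall>x\<in>carr c. \<forall>g. v (rep c g x) = rep d g (v x)) \<and>
    (\<forall>x\<in>carr c. \<forall>a. v (phi c a x) = phi d a (v x)) \<and>
    (\<forall>x\<in>carr c. v (oper c x) = oper d (v x))"

context
  fixes T :: "real set" and c :: "('g::topological_group_add, 'e::ab_group_add) kcycle"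
    and d :: "('g, 'f::ab_group_add) kcycle" and v
  assumes cyc: "kasparov_cycle T c" and iso: "cycle_iso T c d v"
begin

interpretation c: kasparov_cycle T c by (fact cyc)

private definition "u = inv_into (carr c) v"

private lemma bij: "bij_betw v (carr c) (carr d)" using iso by (simp add: cycle_iso_def)
private lemma v_in: "x \<in> carr c \<Longrightarrow> v x \<in> carr d" using bij by (auto simp: bij_betw_def)
private lemma u_in: "y \<in> carr d \<Longrightarrow> u y \<in> carr c"
  using bij inv_into_into[of y v "carr c"] unfolding u_def by (auto simp: bij_betw_def)
private lemma vu [simp]: "y \<in> carr d \<Longrightarrow> v (u y) = y"
  using bij unfolding u_def by (auto simp: bij_betw_def f_inv_into_f)
private lemma uv [simp]: "x \<in> carr c \<Longrightarrow> u (v x) = x"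
  using bij unfolding u_def by (auto simp: bij_betw_def)
text \<open>Serves as a destruction rule: vectors of \<open>d\<close> become images under
  \<open>v\<close>, and the rules below, all oriented so that \<open>v\<close> moves outwards, then
  reduce claims about \<open>d\<close> to claims about \<open>c\<close>.\<close>

private lemma ex: "y \<in> carr d \<Longrightarrow> \<exists>x\<in>carr c. y = v x" using u_in vu by metis

private lemma v_add: "x \<in> carr c \<Longrightarrow> y \<in> carr c \<Longrightarrow> v x + v y = v (x + y)"
  using iso by (simp add: cycle_iso_def)
private lemma v_zero: "v 0 = 0" using v_add[of 0 0] c.zero_closed by simp
private lemma v_minus: "x \<in> carr c \<Longrightarrow> - v x = v (- x)"
  using v_add[of x "- x"] c.minus_closed[of x] v_zero by (simp add: minus_unique)
private lemma v_diff: "x \<in> carr c \<Longrightarrow> y \<in> carr c \<Longrightarrow> v x - v y = v (x - y)"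
  using v_add[of x "- y"] c.minus_closed[of y] by (simp flip: v_minus)
private lemma v_sum: "(\<And>i. i \<in> I \<Longrightarrow> f i \<in> carr c) \<Longrightarrow> (\<Sum>i\<in>I. v (f i)) = v (\<Sum>i\<in>I. f i)"
  by (induction I rule: infinite_finite_induct) (auto simp: v_zero v_add c.sum_closed)
private lemma v_smul: "continuous_on T f \<Longrightarrow> x \<in> carr c \<Longrightarrow> smul d f (v x) = v (smul c f x)"
  using iso by (simp add: cycle_iso_def)
private lemma v_inn: "x \<in> carr c \<Longrightarrow> y \<in> carr c \<Longrightarrow> t \<in> T \<Longrightarrow> inn d (v x) (v y) t = inn c x y t"
  using iso by (simp add: cycle_iso_def)
private lemma v_ops: "x \<in> carr c \<Longrightarrow> grad d (v x) = v (grad c x)"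
    "x \<in> carr c \<Longrightarrow> rep d g (v x) = v (rep c g x)"
    "x \<in> carr c \<Longrightarrow> phi d a (v x) = v (phi c a x)"
    "x \<in> carr c \<Longrightarrow> oper d (v x) = v (oper c x)"
  using iso by (simp_all add: cycle_iso_def)
private lemma ops_in: "x \<in> carr c \<Longrightarrow> grad c x \<in> carr c" "x \<in> carr c \<Longrightarrow> rep c g x \<in> carr c"
    "x \<in> carr c \<Longrightarrow> phi c a x \<in> carr c" "x \<in> carr c \<Longrightarrow> oper c x \<in> carr c"
  using c.grad_adjoint c.rep_adjoint[of g] c.phi_adjoint[of a] c.oper_adjointable
  by (auto simp: is_adjoint_def adjointable_def)
private lemma v_hnorm: "x \<in> carr c \<Longrightarrow> hnorm T d (v x) = hnorm T c x"
  unfolding hnorm_def by (intro SUP_cong refl) (simp add: v_inn)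

private lemma v_adjoint:
  assumes "is_adjoint T c A B" "\<And>x. x \<in> carr c \<Longrightarrow> A' (v x) = v (A x)" "\<And>x. x \<in> carr c \<Longrightarrow> B' (v x) = v (B x)"
  shows "is_adjoint T d A' B'"
  using assms unfolding is_adjoint_def
  by (auto simp: Pi_iff v_inn v_in dest!: ex)

private lemma v_adjointable:
  assumes "adjointable T c A" "\<And>x. x \<in> carr c \<Longrightarrow> A' (v x) = v (A x)"
  shows "adjointable T d A'"
proof -
  obtain B where "is_adjoint T c A B" using assms(1) by (auto simp: adjointable_def)
  then have "is_adjoint T d A' (\<lambda>y. v (B (u y)))"
    by (rule v_adjoint) (use assms(2) in auto)
  then show ?thesis by (auto simp: adjointable_def)
qed

private lemma v_op_close:
  assumes "op_close T c A B e" "\<And>x. x \<in> carr c \<Longrightarrow> A' (v x) = v (A x)" "\<And>x. x \<in> carr c \<Longrightarrow> B' (v x) = v (B x)"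
    and "\<And>x. x \<in> carr c \<Longrightarrow> A x \<in> carr c" "\<And>x. x \<in> carr c \<Longrightarrow> B x \<in> carr c"
  shows "op_close T d A' B' e"
  using assms unfolding op_close_def
  by (auto simp: v_diff v_hnorm c.diff_closed dest!: ex)

private lemma v_compact:
  assumes "compact_op T c A" "\<And>x. x \<in> carr c \<Longrightarrow> A' (v x) = v (A x)"
  shows "compact_op T d A'"
  unfolding compact_op_def
proof (intro conjI allI impI)
  show "adjointable T d A'" using assms v_adjointable by (auto simp: compact_op_def)
  fix e :: real assume "e > 0"
  with assms(1) have "\<exists>(n::nat) x y. (\<forall>i<n. x i \<in> carr c \<and> y i \<in> carr c) \<and>
      op_close T c A (\<lambda>z. \<Sum>i<n. rank_one c (x i) (y i) z) e"
    by (simp only: compact_op_def)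
  then obtain n :: nat and x y where "(\<forall>i<n. x i \<in> carr c \<and> y i \<in> carr c) \<and>
      op_close T c A (\<lambda>z. \<Sum>i<n. rank_one c (x i) (y i) z) e"
    by (elim exE)
  then have xy: "\<And>i. i < n \<Longrightarrow> x i \<in> carr c \<and> y i \<in> carr c"
    and close: "op_close T c A (\<lambda>z. \<Sum>i<n. rank_one c (x i) (y i) z) e"
    by auto
  have A: "\<And>x. x \<in> carr c \<Longrightarrow> A x \<in> carr c"
    using assms(1) by (auto simp: compact_op_def adjointable_def is_adjoint_def)
  have r: "rank_one c (x i) (y i) z \<in> carr c" if "i < n" "z \<in> carr c" for i z
    unfolding rank_one_def using xy that by (auto intro!: c.smul_closed c.inn_continuous)
  have rd: "rank_one d (v (x i)) (v (y i)) (v z) = v (rank_one c (x i) (y i) z)"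
    if "i < n" "z \<in> carr c" for i z
  proof -
    have "smul d (inn d (v (y i)) (v z)) (v (x i)) = v (smul c (inn d (v (y i)) (v z)) (x i))"
      using xy[OF that(1)] that(2) c.inn_continuous[of "y i" z]
      by (intro v_smul) (auto cong: continuous_on_cong simp: v_inn)
    \<comment> \<open>The two scalar functions agree on \<open>T\<close> only, which is exactly what
      \<open>smul_cong\<close> tolerates.\<close>
    also have "smul c (inn d (v (y i)) (v z)) (x i) = smul c (inn c (y i) z) (x i)"
      using xy[OF that(1)] that(2) c.inn_continuous[of "y i" z]
      by (intro c.smul_cong) (auto cong: continuous_on_cong simp: v_inn)
    finally show ?thesis by (simp add: rank_one_def)
  qed
  have "op_close T d A' (\<lambda>z. \<Sum>i<n. rank_one d (v (x i)) (v (y i)) z) e"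
  proof (rule v_op_close[OF close assms(2)])
    fix z assume z: "z \<in> carr c"
    show "(\<Sum>i<n. rank_one d (v (x i)) (v (y i)) (v z)) = v (\<Sum>i<n. rank_one c (x i) (y i) z)"
      using r z by (subst v_sum[symmetric]) (auto simp: rd)
  qed (use A r in \<open>auto intro!: c.sum_closed\<close>)
  then show "\<exists>(n::nat) x y. (\<forall>i<n. x i \<in> carr d \<and> y i \<in> carr d) \<and>
      op_close T d A' (\<lambda>z. \<Sum>i<n. rank_one d (x i) (y i) z) e"
    using xy v_in by (intro exI[of _ n] exI[of _ "v \<circ> x"] exI[of _ "v \<circ> y"]) auto
qed

private lemma v_norm_continuous:
  assumes "norm_continuous T c A" "\<And>g x. x \<in> carr c \<Longrightarrow> A' g (v x) = v (A g x)"
    and "\<And>g x. x \<in> carr c \<Longrightarrow> A g x \<in> carr c"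
  shows "norm_continuous T d A'"
  unfolding norm_continuous_def
proof (intro allI impI)
  fix g and e :: real assume "e > 0"
  then have "\<forall>\<^sub>F h in nhds g. op_close T c (A h) (A g) e"
    using assms(1) by (simp add: norm_continuous_def)
  then show "\<forall>\<^sub>F h in nhds g. op_close T d (A' h) (A' g) e"
    by (rule eventually_mono) (erule v_op_close; simp add: assms(2,3))
qed

lemma cycle_iso_hilbert_module: "hilbert_module T d"
proof
  show "compact T" "T \<noteq> {}" using c.base by auto
  show "0 \<in> carr d" using v_in[OF c.zero_closed] v_zero by simp
  fix x y assume "x \<in> carr d" "y \<in> carr d"
  then show "x + y \<in> carr d" by (auto simp: v_add c.add_closed v_in dest!: ex)
next
  fix x assume "x \<in> carr d"
  then show "- x \<in> carr d" by (auto simp: v_minus c.minus_closed v_in dest!: ex)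
next
  fix f :: "real \<Rightarrow> complex" and x assume "continuous_on T f" "x \<in> carr d"
  then show "smul d f x \<in> carr d" by (auto simp: v_smul c.smul_closed v_in dest!: ex)
next
  fix f g :: "real \<Rightarrow> complex" and x
  assume f: "continuous_on T f" and x: "x \<in> carr d" and fg: "\<And>t. t \<in> T \<Longrightarrow> f t = g t"
  have "continuous_on T g" using f fg by (simp cong: continuous_on_cong)
  moreover have "smul c f (u x) = smul c g (u x)" using c.smul_cong[OF f u_in[OF x]] fg by blast
  ultimately show "smul d f x = smul d g x"
    using v_smul[of f "u x"] v_smul[of g "u x"] f u_in[OF x] x by simp
next
  fix f :: "real \<Rightarrow> complex" and x y assume "continuous_on T f" "x \<in> carr d" "y \<in> carr d"
  then show "smul d f (x + y) = smul d f x + smul d f y"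
    by (auto simp: v_add v_smul c.add_closed c.smul_closed c.smul_add_right dest!: ex)
next
  fix f g :: "real \<Rightarrow> complex" and x assume "continuous_on T f" "continuous_on T g" "x \<in> carr d"
  then show "smul d (\<lambda>t. f t + g t) x = smul d f x + smul d g x"
    by (auto simp: v_add v_smul c.smul_closed c.smul_add_left continuous_on_add dest!: ex)
next
  fix f g :: "real \<Rightarrow> complex" and x assume "continuous_on T f" "continuous_on T g" "x \<in> carr d"
  then show "smul d (\<lambda>t. f t * g t) x = smul d f (smul d g x)"
    by (auto simp: v_smul c.smul_closed c.smul_mult continuous_on_mult dest!: ex)
next
  fix x assume "x \<in> carr d"
  then show "smul d (\<lambda>t. 1) x = x" by (auto simp: v_smul c.smul_one dest!: ex)
next
  fix x y assume "x \<in> carr d" "y \<in> carr d"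
  then show "continuous_on T (inn d x y)"
    using c.inn_continuous by (auto simp: v_inn cong: continuous_on_cong dest!: ex)
next
  fix x y z t assume "x \<in> carr d" "y \<in> carr d" "z \<in> carr d" "t \<in> T"
  then show "inn d x (y + z) t = inn d x y t + inn d x z t"
    by (auto simp: v_add v_inn c.add_closed c.inn_add dest!: ex)
next
  fix f :: "real \<Rightarrow> complex" and x y t assume "continuous_on T f" "x \<in> carr d" "y \<in> carr d" "t \<in> T"
  then show "inn d x (smul d f y) t = f t * inn d x y t"
    by (auto simp: v_smul v_inn c.smul_closed c.inn_smul dest!: ex)
next
  fix x y t assume "x \<in> carr d" "y \<in> carr d" "t \<in> T"
  then show "inn d y x t = cnj (inn d x y t)"
    using c.inn_cnj[of "u x" "u y" t] v_inn[of "u x" "u y" t] v_inn[of "u y" "u x" t] by (simp add: u_in)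
next
  fix x t assume "x \<in> carr d" "t \<in> T"
  then show "0 \<le> Re (inn d x x t)" using c.inn_nonneg by (auto simp: v_inn dest!: ex)
next
  fix x assume x: "x \<in> carr d" and 0: "\<And>t. t \<in> T \<Longrightarrow> inn d x x t = 0"
  then have "u x = 0"
    using v_inn[of "u x" "u x"] by (intro c.inn_definite) (auto simp: u_in)
  then show "x = 0" using vu[OF x] v_zero by simp
next
  fix s :: "nat \<Rightarrow> 'f"
  assume s: "\<And>n. s n \<in> carr d"
    and Cauchy: "\<And>e. 0 < e \<Longrightarrow> \<exists>N. \<forall>m\<ge>N. \<forall>n\<ge>N. hnorm T d (s m - s n) < e"
  have eq: "hnorm T d (s m - v x) = hnorm T c (u (s m) - x)" if "x \<in> carr c" for m x
    using v_diff[of "u (s m)" x] v_hnorm[of "u (s m) - x"] c.diff_closed[of "u (s m)" x] that s u_in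
    by simp
  have eq': "hnorm T d (s m - s n) = hnorm T c (u (s m) - u (s n))" for m n
    using eq[OF u_in[OF s], of m n] vu[OF s] by simp
  obtain x where x: "x \<in> carr c" and lim: "(\<lambda>n. hnorm T c (u (s n) - x)) \<longlonglongrightarrow> 0"
    using c.complete[of "\<lambda>n. u (s n)"] Cauchy u_in[OF s] unfolding eq' by blast
  show "\<exists>x\<in>carr d. (\<lambda>n. hnorm T d (s n - x)) \<longlonglongrightarrow> 0"
    using v_in[OF x] lim by (intro bexI[of _ "v x"]) (simp_all only: eq[OF x])
qed

interpretation d: hilbert_module T d by (fact cycle_iso_hilbert_module)

lemma cycle_iso_kasparov_cycle: "kasparov_cycle T d"
proof
  show "countably_generated T d"
  proof -
    obtain s :: "nat \<Rightarrow> 'e" where s: "range s \<subseteq> carr c"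
      and "\<forall>x\<in>carr c. \<forall>e>0. \<exists>n f. (\<forall>i<n. continuous_on T (f i)) \<and>
        hnorm T c (x - (\<Sum>i<n. smul c (f i) (s i))) < e"
      using c.countably_generated unfolding countably_generated_def by (elim exE conjE)
    note gen = this(2)[rule_format]
    have s': "s i \<in> carr c" for i using s by auto
    show ?thesis unfolding countably_generated_def
    proof (intro exI[of _ "v \<circ> s"] conjI ballI allI impI)
      fix x and e :: real assume "x \<in> carr d" "e > 0"
      then obtain n f where f: "\<And>i. i < n \<Longrightarrow> continuous_on T (f i)"
        and le: "hnorm T c (u x - (\<Sum>i<n. smul c (f i) (s i))) < e"
        using gen[OF u_in[OF \<open>x \<in> carr d\<close>] \<open>e > 0\<close>] by blast
      have x: "v (u x) = x" "u x \<in> carr c" using u_in vu \<open>x \<in> carr d\<close> by auto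
      have "(\<Sum>i<n. smul d (f i) ((v \<circ> s) i)) = v (\<Sum>i<n. smul c (f i) (s i))"
        using f s' by (subst v_sum[symmetric]) (auto simp: v_smul c.smul_closed)
      then have "x - (\<Sum>i<n. smul d (f i) ((v \<circ> s) i)) = v (u x - (\<Sum>i<n. smul c (f i) (s i)))"
        using v_diff[OF x(2), of "\<Sum>i<n. smul c (f i) (s i)"] x(1) f s'
          c.sum_closed[of "{..<n}" "\<lambda>i. smul c (f i) (s i)"]
        by (simp add: c.smul_closed)
      then have "hnorm T d (x - (\<Sum>i<n. smul d (f i) ((v \<circ> s) i))) < e"
        using le v_hnorm[of "u x - (\<Sum>i<n. smul c (f i) (s i))"] x(2) f s'
          c.sum_closed[of "{..<n}" "\<lambda>i. smul c (f i) (s i)"]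
        by (simp add: c.smul_closed c.diff_closed)
      then show "\<exists>n f. (\<forall>i<n. continuous_on T (f i)) \<and>
          hnorm T d (x - (\<Sum>i<n. smul d (f i) ((v \<circ> s) i))) < e"
        using f by blast
    qed (use s' v_in in auto)
  qed
  show "is_adjoint T d (grad d) (grad d)" "is_adjoint T d (rep d g) (rep d (- g))"
    "is_adjoint T d (phi d a) (phi d (cnj a))" for g a
    by (rule v_adjoint[OF c.grad_adjoint] v_adjoint[OF c.rep_adjoint[of g]] v_adjoint[OF c.phi_adjoint[of a]];
      simp add: v_ops)+
  show "adjointable T d (oper d)" using c.oper_adjointable by (auto elim!: v_adjointable simp: v_ops)
  fix x assume x: "x \<in> carr d"
  show "grad d (grad d x) = x" using x by (auto simp: v_ops ops_in c.grad_involution dest!: ex)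
  show "rep d 0 x = x" using x by (auto simp: v_ops c.rep_zero dest!: ex)
  show "rep d (g + h) x = rep d g (rep d h x)" for g h
    using x by (auto simp: v_ops ops_in c.rep_add dest!: ex)
  show "rep d g (grad d x) = grad d (rep d g x)" for g
    using x by (auto simp: v_ops ops_in c.rep_grad dest!: ex)
  show "((\<lambda>h. hnorm T d (rep d h x - rep d g x)) \<longlongrightarrow> 0) (at g)" for g
    using x c.rep_continuous by (auto simp: v_ops ops_in v_diff v_hnorm c.diff_closed dest!: ex)
  show "phi d (a + b) x = phi d a x + phi d b x" for a b
    using x by (auto simp: v_ops ops_in c.phi_add v_add dest!: ex)
  show "phi d (a * b) x = phi d a (phi d b x)" for a b
    using x by (auto simp: v_ops ops_in c.phi_mult dest!: ex)
  show "phi d (a * b) x = smul d (\<lambda>t. a) (phi d b x)" for a b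
    using x by (auto simp: v_ops ops_in c.phi_scale v_smul dest!: ex)
  show "phi d a (grad d x) = grad d (phi d a x)" for a
    using x by (auto simp: v_ops ops_in c.phi_grad dest!: ex)
  show "rep d g (phi d a x) = phi d a (rep d g x)" for g a
    using x by (auto simp: v_ops ops_in c.phi_rep dest!: ex)
  show "oper d (grad d x) = - grad d (oper d x)"
    using x by (auto simp: v_ops ops_in c.oper_odd v_minus dest!: ex)
next
  fix a
  show "compact_op T d (\<lambda>x. phi d a (oper d x) - oper d (phi d a x))"
    by (rule v_compact[OF c.oper_commutator[of a]]) (simp add: v_ops ops_in v_diff)
  show "compact_op T d (\<lambda>x. oper d (oper d (phi d a x)) - phi d a x)"
    by (rule v_compact[OF c.oper_square[of a]]) (simp add: v_ops ops_in v_diff)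
  show "compact_op T d (\<lambda>x. rep d g (oper d (rep d (- g) (phi d a x))) - oper d (phi d a x))" for g
    by (rule v_compact[OF c.oper_equivariant[of g a]]) (simp add: v_ops ops_in v_diff)
  show "norm_continuous T d (\<lambda>g x. rep d g (phi d a (oper d (rep d (- g) x))))"
    by (rule v_norm_continuous[OF c.oper_continuous_left[of a]]) (simp_all add: v_ops ops_in)
  show "norm_continuous T d (\<lambda>g x. rep d g (oper d (phi d a (rep d (- g) x))))"
    by (rule v_norm_continuous[OF c.oper_continuous_right[of a]]) (simp_all add: v_ops ops_in)
  fix B assume B: "is_adjoint T d (oper d) B"
  have Bin: "B (v x) \<in> carr d" if "x \<in> carr c" for x
    using B v_in[OF that] by (auto simp: is_adjoint_def)
  \<comment> \<open>\<open>B\<close> is an arbitrary adjoint over \<open>d\<close>; conjugating it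
    by \<open>v\<close> produces an adjoint over \<open>c\<close>, to which the axiom for
    \<open>c\<close> applies.\<close>
  have "is_adjoint T c (oper c) (\<lambda>x. u (B (v x)))"
    unfolding is_adjoint_def
  proof (intro conjI ballI)
    fix x y t assume xy: "x \<in> carr c" "y \<in> carr c" "t \<in> T"
    have "inn d (oper d (v x)) (v y) t = inn d (v x) (B (v y)) t"
      using B xy v_in by (simp add: is_adjoint_def)
    then show "inn c (oper c x) y t = inn c x (u (B (v y))) t"
      using xy v_inn[of x "u (B (v y))" t] v_inn[of "oper c x" y t] Bin[of y] by (simp add: v_ops ops_in u_in)
  qed (use ops_in u_in Bin in auto)
  then show "compact_op T d (\<lambda>x. oper d (phi d a x) - B (phi d a x))"
    by (intro v_compact[OF c.oper_selfadjoint[of _ a]]) (auto simp: v_ops ops_in u_in Bin simp flip: v_diff)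
qed

lemma cycle_iso_inverse: "cycle_iso T d c (inv_into (carr c) v)"
  unfolding cycle_iso_def u_def[symmetric]
proof (intro conjI ballI allI impI)
  show "bij_betw u (carr d) (carr c)" unfolding u_def using bij by (rule bij_betw_inv_into)
  fix x assume x: "x \<in> carr d"
  show "u (x + y) = u x + u y" if "y \<in> carr d" for y
    using x that by (auto simp: v_add c.add_closed dest!: ex)
  show "u (smul d f x) = smul c f (u x)" if "continuous_on T f" for f
    using x that by (auto simp: v_smul c.smul_closed dest!: ex)
  show "inn c (u x) (u y) t = inn d x y t" if "y \<in> carr d" "t \<in> T" for y t
    using x that by (auto simp: v_inn dest!: ex)
  show "u (grad d x) = grad c (u x)" "u (rep d g x) = rep c g (u x)"
    "u (phi d a x) = phi c a (u x)" "u (oper d x) = oper c (u x)" for g a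
    using x by (auto simp: v_ops ops_in dest!: ex)
qed

lemma cycle_iso_specializes:
  assumes "specializes t d e w" "t \<in> T"
  shows "specializes t c e (\<lambda>x. w (v x))"
  unfolding specializes_def
proof (intro conjI ballI allI impI)
  show "(\<lambda>x. w (v x)) \<in> carr c \<rightarrow> carr e" using assms v_in by (auto simp: specializes_def)
  fix y and \<epsilon> :: real assume "y \<in> carr e" "\<epsilon> > 0"
  then obtain x where "x \<in> carr d" "hnorm {0} e (y - w x) < \<epsilon>"
    using assms unfolding specializes_def by blast
  then show "\<exists>x\<in>carr c. hnorm {0} e (y - w (v x)) < \<epsilon>" using u_in vu by metis
qed (use assms in \<open>auto simp: specializes_def v_in ops_in simp flip: v_add v_inn v_smul v_ops\<close>)

lemma cycle_iso_isomorphic: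
  assumes "T = {0}"
  shows "isomorphic_CC c d"
proof -
  have "specializes 0 c d v"
    unfolding specializes_def
  proof (intro conjI ballI allI impI)
    fix y and \<epsilon> :: real assume "y \<in> carr d" "\<epsilon> > 0"
    then show "\<exists>x\<in>carr c. hnorm {0} d (y - v x) < \<epsilon>"
      using u_in[of y] d.hnorm_zero assms by (intro bexI[of _ "u y"]) auto
  qed (use assms in \<open>auto simp: v_in v_add v_inn v_smul v_ops\<close>)
  then show ?thesis
    using cyc cycle_iso_kasparov_cycle assms by (auto simp: isomorphic_CC_def)
qed

end

section \<open>Isomorphic copies and classes in the Kasparov group\<close>

text \<open>Density of the range survives composition because \<open>w\<close> preserves norms:
  approximate by \<open>w x\<close> within half the error, then \<open>x\<close> by
  \<open>v z\<close> within the other half.\<close>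

lemma specializes_isomorphic:
  assumes "specializes t h c v" and "isomorphic_CC c d"
  shows "\<exists>w. specializes t h d w"
proof -
  obtain w where w: "specializes 0 c d w" and "cycle_CC c" "cycle_CC d"
    using assms(2) by (auto simp: isomorphic_CC_def)
  interpret c: kasparov_cycle "{0}" c by fact
  interpret d: kasparov_cycle "{0}" d by fact
  have w_in: "w x \<in> carr d" if "x \<in> carr c" for x using w that by (auto simp: specializes_def)
  have v_in: "v x \<in> carr c" if "x \<in> carr h" for x using assms(1) that by (auto simp: specializes_def)
  have w_add: "w (x + y) = w x + w y" if "x \<in> carr c" "y \<in> carr c" for x y
    using w that by (simp add: specializes_def)
  have w_inn: "inn d (w x) (w y) 0 = inn c x y 0" if "x \<in> carr c" "y \<in> carr c" for x y
    using w that by (simp add: specializes_def)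
  have "specializes t h d (\<lambda>x. w (v x))"
    unfolding specializes_def
  proof (intro conjI ballI allI impI)
    show "(\<lambda>x. w (v x)) \<in> carr h \<rightarrow> carr d" using w_in v_in by blast
    fix y and \<epsilon> :: real assume y: "y \<in> carr d" "\<epsilon> > 0"
    then obtain x where x: "x \<in> carr c" "hnorm {0} d (y - w x) < \<epsilon> / 2"
      using w unfolding specializes_def by (meson half_gt_zero)
    obtain z where z: "z \<in> carr h" "hnorm {0} c (x - v z) < \<epsilon> / 2"
      using assms(1) x(1) y(2) unfolding specializes_def by (meson half_gt_zero)
    have in_c: "x - v z \<in> carr c" using x z v_in c.diff_closed by blast
    have "w x = w (x - v z) + w (v z)" using w_add[OF in_c v_in[OF z(1)]] by simp
    then have eq: "y - w (v z) = (y - w x) + w (x - v z)" by simp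
    have "hnorm {0} d (w (x - v z)) = hnorm {0} c (x - v z)"
      using w_inn[OF in_c in_c] by (simp add: hnorm_def)
    then have "hnorm {0} d (y - w (v z)) < \<epsilon>"
      unfolding eq using d.hnorm_triangle[of "y - w x" "w (x - v z)"] y x z w_in in_c d.diff_closed
      by fastforce
    then show "\<exists>x\<in>carr h. hnorm {0} d (y - w (v x)) < \<epsilon>" using z(1) by blast
  qed (use assms(1) w in \<open>auto simp: specializes_def Pi_iff\<close>)
  then show ?thesis by blast
qed

text \<open>Transport of structure along an injective additive map, used to move a cycle into the
  fixed type \<open>univ\<close> in which representatives and homotopies must live.\<close>

definition push_cycle :: "('e \<Rightarrow> 'f) \<Rightarrow> ('g, 'e) kcycle \<Rightarrow> ('g, 'f) kcycle" where
  "push_cycle v c = (let u = inv_into (carr c) v in \<lparr>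
    carr = v ` carr c,
    smul = (\<lambda>f x. v (smul c f (u x))),
    inn = (\<lambda>x y. inn c (u x) (u y)),
    grad = (\<lambda>x. v (grad c (u x))),
    rep = (\<lambda>g x. v (rep c g (u x))),
    phi = (\<lambda>a x. v (phi c a (u x))),
    oper = (\<lambda>x. v (oper c (u x)))\<rparr>)"

lemma cycle_iso_push_cycle:
  assumes "inj_on v (carr c)" "\<And>x y. x \<in> carr c \<Longrightarrow> y \<in> carr c \<Longrightarrow> v (x + y) = v x + v y"
  shows "cycle_iso T c (push_cycle v c) v"
  using assms by (auto simp: cycle_iso_def push_cycle_def Let_def bij_betw_def)

text \<open>\<open>KK_class\<close> is a union over all copies of a cycle in \<open>univ\<close>.
  The copies \<open>c0\<close> and \<open>d0\<close> make both unions non-empty, and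
  \<open>hom\<close>, asked for every pair of copies, makes all their members one single
  class.\<close>

lemma KK_class_eqI:
  fixes c :: "('g::topological_group_add, 'e::ab_group_add) kcycle"
    and d :: "('g, 'f::ab_group_add) kcycle"
  assumes c: "isomorphic_CC c (c0 :: ('g, univ) kcycle)" and d: "isomorphic_CC d (d0 :: ('g, univ) kcycle)"
    and hom: "\<And>c' d'. isomorphic_CC c c' \<Longrightarrow> isomorphic_CC d d' \<Longrightarrow> homotopic_CC c' d'"
  shows "KK_class c \<in> KK_CC \<and> KK_class c = KK_class d"
proof -
  let ?R = "KK_rel :: (('g, univ) kcycle \<times> ('g, univ) kcycle) set"
  have equiv: "equiv {x. cycle_CC x} ?R"
  proof (rule equivI)
    show "refl_on {x. cycle_CC x} ?R" by (auto simp: KK_rel_def refl_on_def)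
    show "sym ?R" by (auto simp: KK_rel_def sym_def intro: equivclp_sym)
    show "trans ?R" by (auto simp: KK_rel_def trans_def intro: equivclp_trans)
  qed (auto simp: KK_rel_def)
  have rel: "(c', d') \<in> ?R" if "isomorphic_CC c c'" "isomorphic_CC d d'" for c' d'
    using hom[OF that] that by (auto simp: KK_rel_def isomorphic_CC_def intro: r_into_equivclp)
  have class_c: "?R `` {c'} = ?R `` {d0}" if "isomorphic_CC c c'" for c'
    by (rule equiv_class_eq[OF equiv rel[OF that d]])
  have class_d: "?R `` {d'} = ?R `` {d0}" if "isomorphic_CC d d'" for d'
    using equiv_class_eq[OF equiv rel[OF c that]] class_c[OF c] by simp
  have image: "?R `` A = Z" if "a \<in> A" "\<And>x. x \<in> A \<Longrightarrow> ?R `` {x} = Z" for A a Z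
  proof -
    have "?R `` A = (\<Union>x\<in>A. ?R `` {x})" by blast
    also have "\<dots> = (\<Union>x\<in>A. Z)" using that(2) by (rule SUP_cong[OF refl])
    finally show ?thesis using that(1) by auto
  qed
  have "KK_class c = ?R `` {d0}"
    unfolding KK_class_def by (rule image[of c0]) (use c class_c in blast)+
  moreover have "KK_class d = ?R `` {d0}"
    unfolding KK_class_def by (rule image[of d0]) (use d class_d in blast)+
  moreover have "cycle_CC d0" using d by (simp add: isomorphic_CC_def)
  ultimately show ?thesis by (auto simp: KK_CC_def quotient_def)
qed


section \<open>Square-summable functions\<close>

definition ell2 :: "('i \<Rightarrow> complex) \<Rightarrow> bool" where
  "ell2 f \<longleftrightarrow> (\<lambda>i. (cmod (f i))\<^sup>2) summable_on UNIV"

definition ip :: "('i \<Rightarrow> complex) \<Rightarrow> ('i \<Rightarrow> complex) \<Rightarrow> complex" where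
  "ip f g = (\<Sum>\<^sub>\<infinity>i. cnj (f i) * g i)"

lemma ell2_if_bounded_sums:
  assumes "\<And>F. finite F \<Longrightarrow> (\<Sum>i\<in>F. (cmod (f i))\<^sup>2) \<le> b"
  shows "ell2 f"
  unfolding ell2_def using assms
  by (intro nonneg_bdd_above_summable_on) (auto intro!: bdd_aboveI2)

lemma ell2_abs_summable_ip:
  assumes "ell2 f" "ell2 g"
  shows "(\<lambda>i. cmod (cnj (f i) * g i)) summable_on A"
proof -
  have "(\<lambda>i. cmod (cnj (f i)) * cmod (g i)) summable_on UNIV"
  proof (rule summable_on_comparison_test)
    show "(\<lambda>i. (cmod (f i))\<^sup>2 + (cmod (g i))\<^sup>2) summable_on UNIV"
      using assms unfolding ell2_def by (rule summable_on_add)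
    show "cmod (cnj (f i)) * cmod (g i) \<le> (cmod (f i))\<^sup>2 + (cmod (g i))\<^sup>2" for i
      using sum_squares_bound[of "cmod (f i)" "cmod (g i)"] mult_nonneg_nonneg[of "cmod (f i)" "cmod (g i)"]
      unfolding complex_mod_cnj mult.assoc by (smt (verit) norm_ge_zero)
  qed simp
  then show ?thesis unfolding norm_mult by (rule summable_on_subset_banach) simp
qed

lemma ell2_summable_ip: "ell2 f \<Longrightarrow> ell2 g \<Longrightarrow> (\<lambda>i. cnj (f i) * g i) summable_on A"
  by (rule Infinite_Sum.abs_summable_summable[OF ell2_abs_summable_ip])

text \<open>If the sum of squares diverges, both sides take the default value 0 of an infinite
  sum.\<close>

lemma ip_self: "ip f f = of_real (\<Sum>\<^sub>\<infinity>i. (cmod (f i))\<^sup>2)"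
proof -
  have eq: "cnj (f i) * f i = of_real ((cmod (f i))\<^sup>2)" for i
    by (metis complex_norm_square mult.commute)
  show ?thesis
  proof (cases "ell2 f")
    case True
    then have "((\<lambda>i. (cmod (f i))\<^sup>2) has_sum (\<Sum>\<^sub>\<infinity>i. (cmod (f i))\<^sup>2)) UNIV" by (simp add: ell2_def)
    then show ?thesis unfolding ip_def eq by (intro infsumI has_sum_of_real)
  next
    case False
    then have "\<not> (\<lambda>i. complex_of_real ((cmod (f i))\<^sup>2)) summable_on UNIV"
      unfolding ell2_def summable_on_iff_abs_summable_on_complex by (simp add: norm_power)
    then show ?thesis
      using False unfolding ip_def eq ell2_def by (simp add: infsum_not_exists)
  qed
qed

lemma ip_split_finite:
  assumes "ell2 f" "ell2 g" "finite S"
  shows "ip f g = (\<Sum>i\<in>S. cnj (f i) * g i) + (\<Sum>\<^sub>\<infinity>i\<in>-S. cnj (f i) * g i)"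
proof -
  have "ip f g = (\<Sum>\<^sub>\<infinity>i\<in>S \<union> - S. cnj (f i) * g i)" by (simp add: ip_def)
  also have "\<dots> = (\<Sum>\<^sub>\<infinity>i\<in>S. cnj (f i) * g i) + (\<Sum>\<^sub>\<infinity>i\<in>-S. cnj (f i) * g i)"
    using assms by (intro infsum_Un_disjoint ell2_summable_ip) auto
  finally show ?thesis using assms(3) by simp
qed

text \<open>The inequality \<open>2ab \<le> a^2 + b^2\<close> on every finite partial sum, followed
  by passage to the limit.\<close>

lemma ip_tail_le:
  assumes "ell2 f" "ell2 g"
    and "\<And>F. finite F \<Longrightarrow> F \<inter> S = {} \<Longrightarrow> (\<Sum>i\<in>F. (cmod (f i))\<^sup>2) \<le> e"
    and "\<And>F. finite F \<Longrightarrow> F \<inter> S = {} \<Longrightarrow> (\<Sum>i\<in>F. (cmod (g i))\<^sup>2) \<le> e"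
  shows "cmod (\<Sum>\<^sub>\<infinity>i\<in>-S. cnj (f i) * g i) \<le> e"
proof -
  have "cmod (\<Sum>\<^sub>\<infinity>i\<in>-S. cnj (f i) * g i) \<le> (\<Sum>\<^sub>\<infinity>i\<in>-S. cmod (cnj (f i) * g i))"
    using assms by (intro norm_infsum_bound ell2_abs_summable_ip)
  also have "\<dots> \<le> e"
  proof (rule infsum_le_finite_sums)
    show "(\<lambda>i. cmod (cnj (f i) * g i)) summable_on - S" using assms by (intro ell2_abs_summable_ip)
    fix F assume F: "finite F" "F \<subseteq> - S"
    have "(\<Sum>i\<in>F. cmod (cnj (f i) * g i)) \<le> (\<Sum>i\<in>F. ((cmod (f i))\<^sup>2 + (cmod (g i))\<^sup>2) / 2)"
      using sum_squares_bound[of "cmod (f _)" "cmod (g _)"]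
      by (intro sum_mono) (simp add: norm_mult field_simps)
    also have "\<dots> = ((\<Sum>i\<in>F. (cmod (f i))\<^sup>2) + (\<Sum>i\<in>F. (cmod (g i))\<^sup>2)) / 2"
      by (simp add: sum_divide_distrib[symmetric] sum.distrib)
    also have "\<dots> \<le> e" using assms(3,4)[of F] F by (simp add: disjoint_eq_subset_Compl)
    finally show "(\<Sum>i\<in>F. cmod (cnj (f i) * g i)) \<le> e" .
  qed
  finally show ?thesis .
qed

lemma cmod_add_power2_le: "(cmod (a + b))\<^sup>2 \<le> 2 * (cmod a)\<^sup>2 + 2 * (cmod b)\<^sup>2"
proof -
  have "(cmod (a + b))\<^sup>2 \<le> (cmod a + cmod b)\<^sup>2"
    by (intro power_mono norm_triangle_ineq) simp
  also have "\<dots> \<le> 2 * (cmod a)\<^sup>2 + 2 * (cmod b)\<^sup>2"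
    using sum_squares_bound[of "cmod a" "cmod b"] by (simp add: power2_sum)
  finally show ?thesis .
qed

text \<open>On a compact base, vanishing at infinity uniformly in the parameter is what makes a
  coordinatewise continuous family of square-summable functions norm continuous.\<close>

definition small_tails :: "real set \<Rightarrow> (real \<Rightarrow> 'i \<Rightarrow> complex) \<Rightarrow> bool" where
  "small_tails T \<xi> \<longleftrightarrow> (\<forall>e>0. \<exists>S. finite S \<and>
    (\<forall>t\<in>T. \<forall>F. finite F \<longrightarrow> F \<inter> S = {} \<longrightarrow> (\<Sum>i\<in>F. (cmod (\<xi> t i))\<^sup>2) \<le> e))"

lemma small_tailsE:
  assumes "small_tails T \<xi>" "e > 0"
  obtains S where "finite S"
    "\<And>t F. t \<in> T \<Longrightarrow> finite F \<Longrightarrow> F \<inter> S = {} \<Longrightarrow> (\<Sum>i\<in>F. (cmod (\<xi> t i))\<^sup>2) \<le> e"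
  using assms unfolding small_tails_def by meson

text \<open>Small tails pass to uniform limits. Both errors are taken to be \<open>e / 4\<close>
  because the square of a sum costs a factor 2 on each term.\<close>

lemma small_tails_approx:
  assumes "\<And>e. e > 0 \<Longrightarrow> \<exists>\<zeta>. small_tails T \<zeta> \<and>
    (\<forall>t\<in>T. \<forall>F. finite F \<longrightarrow> (\<Sum>i\<in>F. (cmod (\<xi> t i - \<zeta> t i))\<^sup>2) \<le> e)"
  shows "small_tails T \<xi>"
  unfolding small_tails_def
proof (intro allI impI)
  fix e :: real assume "e > 0"
  then obtain \<zeta> where \<zeta>: "small_tails T \<zeta>"
    and close: "\<And>t F. t \<in> T \<Longrightarrow> finite F \<Longrightarrow> (\<Sum>i\<in>F. (cmod (\<xi> t i - \<zeta> t i))\<^sup>2) \<le> e / 4"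
    using assms[of "e / 4"] by auto
  obtain S where S: "finite S"
    "\<And>t F. t \<in> T \<Longrightarrow> finite F \<Longrightarrow> F \<inter> S = {} \<Longrightarrow> (\<Sum>i\<in>F. (cmod (\<zeta> t i))\<^sup>2) \<le> e / 4"
    using small_tailsE[OF \<zeta>, of "e / 4"] \<open>e > 0\<close> by auto
  have "(\<Sum>i\<in>F. (cmod (\<xi> t i))\<^sup>2) \<le> e" if "t \<in> T" "finite F" "F \<inter> S = {}" for t F
  proof -
    have "(\<Sum>i\<in>F. (cmod (\<xi> t i))\<^sup>2) \<le> (\<Sum>i\<in>F. 2 * (cmod (\<xi> t i - \<zeta> t i))\<^sup>2 + 2 * (cmod (\<zeta> t i))\<^sup>2)"
    proof (rule sum_mono)
      fix i show "(cmod (\<xi> t i))\<^sup>2 \<le> 2 * (cmod (\<xi> t i - \<zeta> t i))\<^sup>2 + 2 * (cmod (\<zeta> t i))\<^sup>2"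
        using cmod_add_power2_le[of "\<xi> t i - \<zeta> t i" "\<zeta> t i"] by simp
    qed
    also have "\<dots> = 2 * (\<Sum>i\<in>F. (cmod (\<xi> t i - \<zeta> t i))\<^sup>2) + 2 * (\<Sum>i\<in>F. (cmod (\<zeta> t i))\<^sup>2)"
      by (simp add: sum.distrib sum_distrib_left)
    finally show ?thesis using close[of t F] S(2)[of t F] that by simp
  qed
  then show "\<exists>S. finite S \<and> (\<forall>t\<in>T. \<forall>F. finite F \<longrightarrow> F \<inter> S = {} \<longrightarrow> (\<Sum>i\<in>F. (cmod (\<xi> t i))\<^sup>2) \<le> e)"
    using S(1) by blast
qed

lemma small_tails_add:
  assumes "small_tails T \<xi>" "small_tails T \<zeta>"
  shows "small_tails T (\<lambda>t i. \<xi> t i + \<zeta> t i)"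
  unfolding small_tails_def
proof (intro allI impI)
  fix e :: real assume "e > 0"
  obtain S where S: "finite S"
    "\<And>t F. t \<in> T \<Longrightarrow> finite F \<Longrightarrow> F \<inter> S = {} \<Longrightarrow> (\<Sum>i\<in>F. (cmod (\<xi> t i))\<^sup>2) \<le> e / 4"
    using small_tailsE[OF assms(1), of "e / 4"] \<open>e > 0\<close> by auto
  obtain S' where S': "finite S'"
    "\<And>t F. t \<in> T \<Longrightarrow> finite F \<Longrightarrow> F \<inter> S' = {} \<Longrightarrow> (\<Sum>i\<in>F. (cmod (\<zeta> t i))\<^sup>2) \<le> e / 4"
    using small_tailsE[OF assms(2), of "e / 4"] \<open>e > 0\<close> by auto
  have "(\<Sum>i\<in>F. (cmod (\<xi> t i + \<zeta> t i))\<^sup>2) \<le> e" if "t \<in> T" "finite F" "F \<inter> (S \<union> S') = {}" for t F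
  proof -
    have "(\<Sum>i\<in>F. (cmod (\<xi> t i + \<zeta> t i))\<^sup>2) \<le> (\<Sum>i\<in>F. 2 * (cmod (\<xi> t i))\<^sup>2 + 2 * (cmod (\<zeta> t i))\<^sup>2)"
      by (intro sum_mono cmod_add_power2_le)
    also have "\<dots> = 2 * (\<Sum>i\<in>F. (cmod (\<xi> t i))\<^sup>2) + 2 * (\<Sum>i\<in>F. (cmod (\<zeta> t i))\<^sup>2)"
      by (simp add: sum.distrib sum_distrib_left)
    finally show ?thesis using S(2)[of t F] S'(2)[of t F] that by (simp add: Int_Un_distrib)
  qed
  then show "\<exists>S. finite S \<and>
      (\<forall>t\<in>T. \<forall>F. finite F \<longrightarrow> F \<inter> S = {} \<longrightarrow> (\<Sum>i\<in>F. (cmod (\<xi> t i + \<zeta> t i))\<^sup>2) \<le> e)"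
    using S(1) S'(1) by (intro exI[of _ "S \<union> S'"]) auto
qed

text \<open>The form suited to group actions: \<open>\<sigma>\<close> relabels the indices and the
  finite set \<open>S\<close> collects coordinates over which there is no control.\<close>

lemma small_tails_dominated:
  assumes \<xi>: "small_tails T \<xi>" and S: "finite S" and inj: "inj_on \<sigma> J"
    and dom: "\<And>t i. t \<in> T \<Longrightarrow> i \<notin> S \<Longrightarrow> \<eta> t i \<noteq> 0 \<Longrightarrow> i \<in> J \<and> cmod (\<eta> t i) \<le> K * cmod (\<xi> t (\<sigma> i))"
  shows "small_tails T \<eta>"
  unfolding small_tails_def
proof (intro allI impI)
  fix e :: real assume "e > 0"
  \<comment> \<open>The added 1 keeps the divisor positive when \<open>K = 0\<close>.\<close>
  have K: "K\<^sup>2 + 1 > 0" using zero_le_power2[of K] by linarith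
  obtain S0 where S0: "finite S0"
    "\<And>t F. t \<in> T \<Longrightarrow> finite F \<Longrightarrow> F \<inter> S0 = {} \<Longrightarrow> (\<Sum>i\<in>F. (cmod (\<xi> t i))\<^sup>2) \<le> e / (K\<^sup>2 + 1)"
    using small_tailsE[OF \<xi>, of "e / (K\<^sup>2 + 1)"] \<open>e > 0\<close> K by auto
  \<comment> \<open>Injectivity of \<open>\<sigma>\<close> makes the preimage of the finite set
    \<open>S0\<close> finite.\<close>
  define S1 where "S1 = S \<union> (\<sigma> -` S0 \<inter> J)"
  have "finite S1" unfolding S1_def using S S0(1) inj by (simp add: finite_vimage_IntI)
  moreover have "(\<Sum>i\<in>F. (cmod (\<eta> t i))\<^sup>2) \<le> e" if t: "t \<in> T" and F: "finite F" "F \<inter> S1 = {}" for t F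
  proof -
    \<comment> \<open>The domination says something only where \<open>\<eta>\<close> is non-zero;
      the other indices add nothing to the sum.\<close>
    define F' where "F' = {i\<in>F. \<eta> t i \<noteq> 0}"
    have F': "F' \<subseteq> J" "finite F'" "\<sigma> ` F' \<inter> S0 = {}"
      "\<And>i. i \<in> F' \<Longrightarrow> cmod (\<eta> t i) \<le> K * cmod (\<xi> t (\<sigma> i))"
      using F dom[OF t] unfolding F'_def S1_def by auto
    have "(\<Sum>i\<in>F. (cmod (\<eta> t i))\<^sup>2) = (\<Sum>i\<in>F'. (cmod (\<eta> t i))\<^sup>2)"
      unfolding F'_def using F(1) by (intro sum.mono_neutral_right) auto
    also have "\<dots> \<le> (\<Sum>i\<in>F'. K\<^sup>2 * (cmod (\<xi> t (\<sigma> i)))\<^sup>2)"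
      using F'(4) by (intro sum_mono) (simp add: power_mono flip: power_mult_distrib)
    also have "\<dots> = K\<^sup>2 * (\<Sum>i\<in>\<sigma> ` F'. (cmod (\<xi> t i))\<^sup>2)"
      using inj_on_subset[OF inj F'(1)] by (simp add: sum.reindex sum_distrib_left)
    also have "\<dots> \<le> K\<^sup>2 * (e / (K\<^sup>2 + 1))"
      using S0(2)[OF t _ F'(3)] F'(2) by (intro mult_left_mono) auto
    also have "\<dots> \<le> e" using \<open>e > 0\<close> K by (simp add: field_simps)
    finally show ?thesis .
  qed
  ultimately show "\<exists>S. finite S \<and> (\<forall>t\<in>T. \<forall>F. finite F \<longrightarrow> F \<inter> S = {} \<longrightarrow> (\<Sum>i\<in>F. (cmod (\<eta> t i))\<^sup>2) \<le> e)"
    by blast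
qed

lemma small_tails_le:
  assumes "small_tails T \<xi>" "\<And>t i. t \<in> T \<Longrightarrow> cmod (\<eta> t i) \<le> K * cmod (\<xi> t i)"
  shows "small_tails T \<eta>"
  by (rule small_tails_dominated[OF assms(1), of "{}" "\<lambda>i. i" UNIV _ K]) (use assms in auto)

lemma small_tails_finite_support:
  assumes "finite S" "\<And>t i. t \<in> T \<Longrightarrow> i \<notin> S \<Longrightarrow> \<eta> t i = 0"
  shows "small_tails T \<eta>"
proof (rule small_tails_dominated[of T "\<lambda>_ _. 0" S "\<lambda>i. i" UNIV _ 0])
  show "small_tails T (\<lambda>_ _. 0)" by (auto simp: small_tails_def)
qed (use assms in auto)

lemma ell2_if_small_tails:
  assumes "small_tails T \<xi>" "t \<in> T"
  shows "ell2 (\<xi> t)"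
proof -
  obtain S where S: "finite S"
    "\<And>t F. t \<in> T \<Longrightarrow> finite F \<Longrightarrow> F \<inter> S = {} \<Longrightarrow> (\<Sum>i\<in>F. (cmod (\<xi> t i))\<^sup>2) \<le> 1"
    using small_tailsE[OF assms(1), of 1] by auto
  show ?thesis
  proof (rule ell2_if_bounded_sums)
    fix F :: "'a set" assume F: "finite F"
    have "(\<Sum>i\<in>F. (cmod (\<xi> t i))\<^sup>2) = (\<Sum>i\<in>F \<inter> S. (cmod (\<xi> t i))\<^sup>2) + (\<Sum>i\<in>F - S. (cmod (\<xi> t i))\<^sup>2)"
      using F by (rule sum.Int_Diff)
    also have "\<dots> \<le> (\<Sum>i\<in>S. (cmod (\<xi> t i))\<^sup>2) + 1"
      using F S(1) S(2)[OF assms(2), of "F - S"] by (intro add_mono sum_mono2) auto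
    finally show "(\<Sum>i\<in>F. (cmod (\<xi> t i))\<^sup>2) \<le> (\<Sum>i\<in>S. (cmod (\<xi> t i))\<^sup>2) + 1" .
  qed
qed

text \<open>Over a one-point base there is no uniformity to ask for, and small tails reduce to
  summability.\<close>

lemma small_tails_singleton:
  assumes "ell2 f"
  shows "small_tails {t} (\<lambda>_. f)"
  unfolding small_tails_def
proof (intro allI impI)
  fix e :: real assume "e > 0"
  define g where "g = (\<lambda>i. (cmod (f i))\<^sup>2)"
  have g: "g summable_on UNIV" using assms by (simp add: ell2_def g_def)
  obtain S where S: "finite S" "dist (sum g S) (infsum g UNIV) \<le> e"
    using infsum_finite_approximation[OF g \<open>e > 0\<close>] by auto
  have "sum g F \<le> e" if "finite F" "F \<inter> S = {}" for F
  proof -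
    have "sum g F + sum g S = sum g (F \<union> S)" using that S by (simp add: sum.union_disjoint)
    also have "\<dots> \<le> infsum g UNIV" using that S g by (intro finite_sum_le_infsum) (auto simp: g_def)
    finally show ?thesis using S(2) by (simp add: dist_real_def)
  qed
  then show "\<exists>S. finite S \<and> (\<forall>t\<in>{t}. \<forall>F. finite F \<longrightarrow> F \<inter> S = {} \<longrightarrow> (\<Sum>i\<in>F. (cmod (f i))\<^sup>2) \<le> e)"
    using S(1) unfolding g_def by blast
qed

text \<open>A finite partial sum is continuous in \<open>t\<close>, and small tails of both families
  make these sums converge uniformly on \<open>T\<close>.\<close>

lemma continuous_on_ip:
  assumes "small_tails T \<xi>" "small_tails T \<eta>"
    and "\<And>i. continuous_on T (\<lambda>t. \<xi> t i)" "\<And>i. continuous_on T (\<lambda>t. \<eta> t i)"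
  shows "continuous_on T (\<lambda>t. ip (\<xi> t) (\<eta> t))"
proof -
  have "\<exists>S. finite S \<and> (\<forall>t\<in>T. cmod (ip (\<xi> t) (\<eta> t) - (\<Sum>i\<in>S. cnj (\<xi> t i) * \<eta> t i)) \<le> inverse (real (Suc n)))" for n
  proof -
    define e where "e = inverse (real (Suc n))"
    have "e > 0" by (simp add: e_def)
    obtain S where S: "finite S"
      "\<And>t F. t \<in> T \<Longrightarrow> finite F \<Longrightarrow> F \<inter> S = {} \<Longrightarrow> (\<Sum>i\<in>F. (cmod (\<xi> t i))\<^sup>2) \<le> e"
      using small_tailsE[OF assms(1) \<open>e > 0\<close>] by auto
    obtain S' where S': "finite S'"
      "\<And>t F. t \<in> T \<Longrightarrow> finite F \<Longrightarrow> F \<inter> S' = {} \<Longrightarrow> (\<Sum>i\<in>F. (cmod (\<eta> t i))\<^sup>2) \<le> e"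
      using small_tailsE[OF assms(2) \<open>e > 0\<close>] by auto
    have "cmod (\<Sum>\<^sub>\<infinity>i\<in>-(S \<union> S'). cnj (\<xi> t i) * \<eta> t i) \<le> e" if "t \<in> T" for t
      using assms S(2)[OF that] S'(2)[OF that] that
      by (intro ip_tail_le ell2_if_small_tails) (auto simp: Int_Un_distrib)
    then have "\<forall>t\<in>T. cmod (ip (\<xi> t) (\<eta> t) - (\<Sum>i\<in>S \<union> S'. cnj (\<xi> t i) * \<eta> t i)) \<le> e"
      using assms S(1) S'(1) ip_split_finite[of "\<xi> _" "\<eta> _" "S \<union> S'"]
      by (auto simp: ell2_if_small_tails)
    then show ?thesis using S(1) S'(1) unfolding e_def by blast
  qed
  then obtain S where S: "\<And>n. finite (S n)"
    "\<And>n t. t \<in> T \<Longrightarrow> cmod (ip (\<xi> t) (\<eta> t) - (\<Sum>i\<in>S n. cnj (\<xi> t i) * \<eta> t i)) \<le> inverse (real (Suc n))"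
    by metis
  show ?thesis
  proof (rule uniform_limit_theorem[where F = sequentially])
    show "\<forall>\<^sub>F n in sequentially. continuous_on T (\<lambda>t. \<Sum>i\<in>S n. cnj (\<xi> t i) * \<eta> t i)"
      using assms by (intro always_eventually allI continuous_intros)
    show "uniform_limit T (\<lambda>n t. \<Sum>i\<in>S n. cnj (\<xi> t i) * \<eta> t i) (\<lambda>t. ip (\<xi> t) (\<eta> t)) sequentially"
    proof (rule uniform_limitI)
      fix e :: real assume "e > 0"
      then obtain N where N: "inverse (real (Suc N)) < e" using reals_Archimedean by blast
      have "\<forall>t\<in>T. dist (\<Sum>i\<in>S n. cnj (\<xi> t i) * \<eta> t i) (ip (\<xi> t) (\<eta> t)) < e" if "n \<ge> N" for n
      proof
        fix t assume "t \<in> T"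
        have "inverse (real (Suc n)) \<le> inverse (real (Suc N))" using that by (simp add: field_simps)
        then show "dist (\<Sum>i\<in>S n. cnj (\<xi> t i) * \<eta> t i) (ip (\<xi> t) (\<eta> t)) < e"
          using S(2)[OF \<open>t \<in> T\<close>, of n] N unfolding dist_norm norm_minus_commute[of "sum _ _"] by linarith
      qed
      then show "\<forall>\<^sub>F n in sequentially. \<forall>t\<in>T. dist (\<Sum>i\<in>S n. cnj (\<xi> t i) * \<eta> t i) (ip (\<xi> t) (\<eta> t)) < e"
        by (rule eventually_sequentiallyI)
    qed
  qed simp
qed


section \<open>Hilbert modules of square-summable functions\<close>

text \<open>\<open>D\<close> tells which coordinates may be non-zero in each fibre. It need not be a
  product, so fibres may shrink at some points of the base. Values off \<open>T\<close> are forced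
  to be 0, so that equality in the module is equality of functions.\<close>

locale l2_module =
  fixes T :: "real set" and D :: "(real \<times> 'i) set" and M :: "(real \<Rightarrow> 'i \<Rightarrow> complex, 'm) hmod_scheme"
  assumes compact_base: "compact T" and base_nonempty: "T \<noteq> {}" and support: "D \<subseteq> T \<times> UNIV"
    and carr_eq: "carr M = {\<xi>. (\<forall>t i. (t, i) \<notin> D \<longrightarrow> \<xi> t i = 0) \<and>
      (\<forall>i. continuous_on T (\<lambda>t. \<xi> t i)) \<and> small_tails T \<xi>}"
    and smul_eq: "smul M = (\<lambda>f \<xi> t i. f t * \<xi> t i)"
    and inn_eq: "inn M = (\<lambda>\<xi> \<eta> t. ip (\<xi> t) (\<eta> t))"
begin

lemma carrI:
  assumes "\<And>t i. (t, i) \<notin> D \<Longrightarrow> \<xi> t i = 0" "\<And>i. continuous_on T (\<lambda>t. \<xi> t i)" "small_tails T \<xi>"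
  shows "\<xi> \<in> carr M"
  using assms by (simp add: carr_eq)

lemma carrD:
  assumes "\<xi> \<in> carr M"
  shows "(t, i) \<notin> D \<Longrightarrow> \<xi> t i = 0" "continuous_on T (\<lambda>t. \<xi> t i)" "small_tails T \<xi>"
  using assms by (auto simp: carr_eq)

lemma carr_ell2: "\<xi> \<in> carr M \<Longrightarrow> t \<in> T \<Longrightarrow> ell2 (\<xi> t)"
  using carrD(3) ell2_if_small_tails by blast

lemma inn_carr_continuous: "\<xi> \<in> carr M \<Longrightarrow> \<eta> \<in> carr M \<Longrightarrow> continuous_on T (inn M \<xi> \<eta>)"
  unfolding inn_eq by (intro continuous_on_ip carrD)

lemma Re_inn_self: "Re (inn M \<xi> \<xi> t) = (\<Sum>\<^sub>\<infinity>i. (cmod (\<xi> t i))\<^sup>2)"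
  by (simp add: inn_eq ip_self)

lemma sum_le_inn_self:
  assumes "\<xi> \<in> carr M" "t \<in> T" "finite F"
  shows "(\<Sum>i\<in>F. (cmod (\<xi> t i))\<^sup>2) \<le> Re (inn M \<xi> \<xi> t)"
  unfolding Re_inn_self using carr_ell2[OF assms(1,2)] assms(3) unfolding ell2_def
  by (intro finite_sum_le_infsum) auto

lemma sum_le_hnorm:
  assumes "\<xi> \<in> carr M" "t \<in> T" "finite F"
  shows "(\<Sum>i\<in>F. (cmod (\<xi> t i))\<^sup>2) \<le> (hnorm T M \<xi>)\<^sup>2"
proof -
  have "(\<Sum>i\<in>F. (cmod (\<xi> t i))\<^sup>2) \<le> Re (inn M \<xi> \<xi> t)" using assms by (rule sum_le_inn_self)
  moreover have "sqrt (Re (inn M \<xi> \<xi> t)) \<le> hnorm T M \<xi>"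
    using assms(2) by (intro sqrt_inn_le_hnorm_if_continuous compact_base inn_carr_continuous assms)
  ultimately show ?thesis using sqrt_le_D by (meson order_trans)
qed

text \<open>Moves norm estimates to finite sums, which can be split and reindexed freely.\<close>

lemma hnorm_leI_sums:
  assumes "\<xi> \<in> carr M" "b \<ge> 0" "\<And>t F. t \<in> T \<Longrightarrow> finite F \<Longrightarrow> (\<Sum>i\<in>F. (cmod (\<xi> t i))\<^sup>2) \<le> b\<^sup>2"
  shows "hnorm T M \<xi> \<le> b"
  unfolding hnorm_def
proof (rule cSUP_least[OF base_nonempty])
  fix t assume t: "t \<in> T"
  have "Re (inn M \<xi> \<xi> t) \<le> b\<^sup>2"
    unfolding Re_inn_self using carr_ell2[OF assms(1) t] assms(3)[OF t] unfolding ell2_def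
    by (intro infsum_le_finite_sums) auto
  then show "sqrt (Re (inn M \<xi> \<xi> t)) \<le> b" using assms(2) by (simp add: real_le_lsqrt)
qed

lemma carr_zero: "0 \<in> carr M"
  by (rule carrI) (auto simp: small_tails_def)

lemma carr_add: "\<xi> \<in> carr M \<Longrightarrow> \<eta> \<in> carr M \<Longrightarrow> \<xi> + \<eta> \<in> carr M"
  unfolding plus_fun_def
  by (rule carrI) (auto intro!: continuous_intros small_tails_add simp: carrD)

lemma carr_minus: "\<xi> \<in> carr M \<Longrightarrow> - \<xi> \<in> carr M"
  unfolding fun_Compl_def
  by (rule carrI, simp add: carrD, intro continuous_intros, simp add: carrD,
      rule small_tails_le[of T \<xi> _ 1]) (simp_all add: carrD)

lemma carr_diff: "\<xi> \<in> carr M \<Longrightarrow> \<eta> \<in> carr M \<Longrightarrow> \<xi> - \<eta> \<in> carr M"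
  using carr_add[of \<xi> "- \<eta>"] carr_minus[of \<eta>] by simp

lemma carr_smul:
  assumes "continuous_on T f" "\<xi> \<in> carr M"
  shows "smul M f \<xi> \<in> carr M"
proof -
  obtain K where K: "\<And>t. t \<in> T \<Longrightarrow> cmod (f t) \<le> K"
    using compact_imp_bounded[OF compact_continuous_image[OF assms(1) compact_base]]
    unfolding bounded_iff by auto
  show ?thesis
    unfolding smul_eq using assms K
    by (intro carrI) (auto intro!: continuous_intros mult_right_mono small_tails_le[OF carrD(3)[OF assms(2)], of _ K]
        simp: carrD norm_mult)
qed

text \<open>The limit is taken coordinate by coordinate. Letting one index of the Cauchy estimate on
  finite sums tend to infinity makes the convergence uniform in \<open>t\<close>, which preserves
  continuity and small tails.\<close>

lemma carr_complete:
  assumes s: "\<And>n. s n \<in> carr M"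
    and Cauchy: "\<And>e. 0 < e \<Longrightarrow> \<exists>N. \<forall>m\<ge>N. \<forall>n\<ge>N. hnorm T M (s m - s n) < e"
  shows "\<exists>x\<in>carr M. (\<lambda>n. hnorm T M (s n - x)) \<longlonglongrightarrow> 0"
proof -
  have unif: "\<exists>N. \<forall>m\<ge>N. \<forall>n\<ge>N. \<forall>t\<in>T. \<forall>F. finite F \<longrightarrow> (\<Sum>i\<in>F. (cmod (s m t i - s n t i))\<^sup>2) \<le> e\<^sup>2"
    if "e > 0" for e :: real
  proof -
    obtain N where N: "\<And>m n. m \<ge> N \<Longrightarrow> n \<ge> N \<Longrightarrow> hnorm T M (s m - s n) < e"
      using Cauchy[OF \<open>e > 0\<close>] by blast
    have "(\<Sum>i\<in>F. (cmod (s m t i - s n t i))\<^sup>2) \<le> e\<^sup>2" if "m \<ge> N" "n \<ge> N" "t \<in> T" "finite F" for m n t F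
    proof -
      have *: "(\<Sum>i\<in>F. (cmod (s m t i - s n t i))\<^sup>2) \<le> (hnorm T M (s m - s n))\<^sup>2"
        using sum_le_hnorm[OF carr_diff[OF s s] that(3,4), of m n] by simp
      have "0 \<le> sqrt (Re (inn M (s m - s n) (s m - s n) t))"
        by (simp add: Re_inn_self infsum_nonneg)
      also have "\<dots> \<le> hnorm T M (s m - s n)"
        using that(3) by (intro sqrt_inn_le_hnorm_if_continuous compact_base inn_carr_continuous carr_diff s)
      finally have "(hnorm T M (s m - s n))\<^sup>2 \<le> e\<^sup>2"
        using N[OF that(1,2)] by (intro power_mono) auto
      then show ?thesis using * by simp
    qed
    then show ?thesis by blast
  qed
  define x where "x = (\<lambda>t i. lim (\<lambda>n. s n t i))"
  have lim: "(\<lambda>n. s n t i) \<longlonglongrightarrow> x t i" for t i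
  proof (cases "t \<in> T")
    case True
    have "Cauchy (\<lambda>n. s n t i)"
    proof (rule CauchyI)
      fix e :: real assume "e > 0"
      obtain N where "\<forall>m\<ge>N. \<forall>n\<ge>N. \<forall>t\<in>T. \<forall>F. finite F \<longrightarrow> (\<Sum>i\<in>F. (cmod (s m t i - s n t i))\<^sup>2) \<le> (e/2)\<^sup>2"
        using unif[OF half_gt_zero[OF \<open>e > 0\<close>]] by blast
      note N = this[rule_format, OF _ _ True]
      have "cmod (s m t i - s n t i) < e" if "m \<ge> N" "n \<ge> N" for m n
        using N[OF that, of "{i}"] \<open>e > 0\<close> power2_le_imp_le[of "cmod (s m t i - s n t i)" "e / 2"] by simp
      then show "\<exists>N. \<forall>m\<ge>N. \<forall>n\<ge>N. cmod (s m t i - s n t i) < e" by blast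
    qed
    then show ?thesis unfolding x_def by (simp add: Cauchy_convergent_iff convergent_LIMSEQ_iff)
  next
    case False
    \<comment> \<open>Off the base the sequence is constantly 0, so \<open>lim\<close> is meaningful
      there too.\<close>
    then have "s n t i = 0" for n using carrD(1)[OF s] support by blast
    then show ?thesis by (simp add: x_def)
  qed
  have close: "\<exists>N. \<forall>n\<ge>N. \<forall>t\<in>T. \<forall>F. finite F \<longrightarrow> (\<Sum>i\<in>F. (cmod (s n t i - x t i))\<^sup>2) \<le> e\<^sup>2" if "e > 0" for e :: real
  proof -
    obtain N where N: "\<And>m n t F. m \<ge> N \<Longrightarrow> n \<ge> N \<Longrightarrow> t \<in> T \<Longrightarrow> finite F \<Longrightarrow>
        (\<Sum>i\<in>F. (cmod (s m t i - s n t i))\<^sup>2) \<le> e\<^sup>2"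
      using unif[OF \<open>e > 0\<close>] by blast
    have "(\<Sum>i\<in>F. (cmod (s n t i - x t i))\<^sup>2) \<le> e\<^sup>2" if "n \<ge> N" "t \<in> T" "finite F" for n t F
    proof (rule LIMSEQ_le_const2)
      show "(\<lambda>m. \<Sum>i\<in>F. (cmod (s n t i - s m t i))\<^sup>2) \<longlonglongrightarrow> (\<Sum>i\<in>F. (cmod (s n t i - x t i))\<^sup>2)"
        by (intro tendsto_intros lim)
    qed (use N that in blast)
    then show ?thesis by blast
  qed
  have x: "x \<in> carr M"
  proof (rule carrI)
    fix t i assume "(t, i) \<notin> D"
    then have "s n t i = 0" for n using carrD(1)[OF s] by blast
    then show "x t i = 0" by (simp add: x_def)
  next
    fix i
    show "continuous_on T (\<lambda>t. x t i)"
    proof (rule uniform_limit_theorem[where F = sequentially])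
      show "\<forall>\<^sub>F n in sequentially. continuous_on T (\<lambda>t. s n t i)" using carrD(2)[OF s] by simp
      show "uniform_limit T (\<lambda>n t. s n t i) (\<lambda>t. x t i) sequentially"
      proof (rule uniform_limitI)
        fix e :: real assume "e > 0"
        obtain N where N: "\<And>n t F. n \<ge> N \<Longrightarrow> t \<in> T \<Longrightarrow> finite F \<Longrightarrow> (\<Sum>i\<in>F. (cmod (s n t i - x t i))\<^sup>2) \<le> (e/2)\<^sup>2"
          using close[of "e / 2"] \<open>e > 0\<close> by auto
        have "dist (s n t i) (x t i) < e" if "n \<ge> N" "t \<in> T" for n t
          using N[OF that, of "{i}"] \<open>e > 0\<close> power2_le_imp_le[of "cmod (s n t i - x t i)" "e / 2"]
          by (simp add: dist_norm)
        then show "\<forall>\<^sub>F n in sequentially. \<forall>t\<in>T. dist (s n t i) (x t i) < e"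
          by (intro eventually_sequentiallyI[of N]) auto
      qed
    qed simp
  next
    show "small_tails T x"
    proof (rule small_tails_approx)
      fix e :: real assume "e > 0"
      then obtain N where "\<And>t F. t \<in> T \<Longrightarrow> finite F \<Longrightarrow> (\<Sum>i\<in>F. (cmod (s N t i - x t i))\<^sup>2) \<le> e"
        using close[of "sqrt e"] by auto
      then show "\<exists>\<zeta>. small_tails T \<zeta> \<and> (\<forall>t\<in>T. \<forall>F. finite F \<longrightarrow> (\<Sum>i\<in>F. (cmod (x t i - \<zeta> t i))\<^sup>2) \<le> e)"
        using carrD(3)[OF s, of N] by (intro exI[of _ "s N"]) (simp add: norm_minus_commute)
    qed
  qed
  moreover have "(\<lambda>n. hnorm T M (s n - x)) \<longlonglongrightarrow> 0"
  proof (rule LIMSEQ_I)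
    fix e :: real assume "e > 0"
    obtain N where N: "\<And>n t F. n \<ge> N \<Longrightarrow> t \<in> T \<Longrightarrow> finite F \<Longrightarrow> (\<Sum>i\<in>F. (cmod (s n t i - x t i))\<^sup>2) \<le> (e/2)\<^sup>2"
      using close[of "e / 2"] \<open>e > 0\<close> by auto
    have "norm (hnorm T M (s n - x) - 0) < e" if "n \<ge> N" for n
    proof -
      have "hnorm T M (s n - x) \<le> e / 2"
        using N[OF that] \<open>e > 0\<close> by (intro hnorm_leI_sums carr_diff s x) auto
      moreover obtain t where "t \<in> T" using base_nonempty by auto
      then have "sqrt (Re (inn M (s n - x) (s n - x) t)) \<le> hnorm T M (s n - x)"
        by (intro sqrt_inn_le_hnorm_if_continuous compact_base inn_carr_continuous carr_diff s x)
      then have "0 \<le> hnorm T M (s n - x)"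
        by (rule order_trans[rotated]) (simp add: Re_inn_self infsum_nonneg)
      ultimately show ?thesis using \<open>e > 0\<close> by simp
    qed
    then show "\<exists>N. \<forall>n\<ge>N. norm (hnorm T M (s n - x) - 0) < e" by blast
  qed
  ultimately show ?thesis by blast
qed

sublocale hilbert_module T M
proof
  show "compact T" "T \<noteq> {}" "0 \<in> carr M" by (fact compact_base base_nonempty carr_zero)+
next
  fix f g :: "real \<Rightarrow> complex" and x
  assume x: "x \<in> carr M" and fg: "\<And>t. t \<in> T \<Longrightarrow> f t = g t"
  have "f t * x t i = g t * x t i" for t i
    using carrD(1)[OF x, of t i] support fg by (cases "t \<in> T") auto
  then show "smul M f x = smul M g x" unfolding smul_eq by blast
next
  fix x y z t assume xyz: "x \<in> carr M" "y \<in> carr M" "z \<in> carr M" "t \<in> T"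
  then show "inn M x (y + z) t = inn M x y t + inn M x z t"
    unfolding inn_eq ip_def by (simp add: distrib_left infsum_add ell2_summable_ip carr_ell2)
next
  fix f :: "real \<Rightarrow> complex" and x y t
  show "inn M x (smul M f y) t = f t * inn M x y t"
    unfolding inn_eq ip_def smul_eq
    by (simp add: infsum_cmult_right'[symmetric] mult.left_commute)
next
  fix x y t
  show "inn M y x t = cnj (inn M x y t)"
    unfolding inn_eq ip_def infsum_cnj[symmetric] by (simp add: mult.commute)
next
  fix x t show "0 \<le> Re (inn M x x t)" by (simp add: Re_inn_self infsum_nonneg)
next
  fix x assume x: "x \<in> carr M" and 0: "\<And>t. t \<in> T \<Longrightarrow> inn M x x t = 0"
  have "x t i = 0" for t i
  proof (cases "t \<in> T")
    case True
    then show ?thesis using sum_le_inn_self[OF x True, of "{i}"] 0[OF True] by simp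
  next
    case False
    then show ?thesis using carrD(1)[OF x, of t i] support by blast
  qed
  then show "x = 0" by (intro ext) simp
qed (simp_all add: carr_add carr_minus carr_smul inn_carr_continuous carr_complete,
  simp_all add: smul_eq distrib_left distrib_right mult.assoc fun_eq_iff)

end

section \<open>Countable generation of modules with varying fibres\<close>

text \<open>The quotient \<open>f / w\<close> may be unbounded near zeros of \<open>w\<close>, so it
  is regularized to \<open>f * cnj w / (|w|^2 + \<eta>)\<close>. The error is
  \<open>|f| * \<eta> / (|w|^2 + \<eta>)\<close>: at most \<open>|f|\<close> where \<open>f\<close>
  is small, and small where \<open>w\<close> is bounded away from 0. Since \<open>f\<close> vanishes
  with \<open>w\<close>, compactness puts every point of \<open>T\<close> in one of these two
  cases.\<close>

lemma continuous_divide_approx: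
  fixes f w :: "real \<Rightarrow> complex"
  assumes T: "compact T" and f: "continuous_on T f" and w: "continuous_on T w"
    and zero: "\<And>t. t \<in> T \<Longrightarrow> w t = 0 \<Longrightarrow> f t = 0" and "\<delta> > 0"
  obtains g where "continuous_on T g" "\<And>t. t \<in> T \<Longrightarrow> cmod (f t - g t * w t) \<le> \<delta>"
proof -
  define K where "K = {t \<in> T. cmod (f t) \<ge> \<delta>}"
  have "closedin (top_of_set T) (T \<inter> (\<lambda>t. cmod (f t)) -` {\<delta>..})"
    using f by (intro continuous_closedin_preimage continuous_intros) auto
  also have "T \<inter> (\<lambda>t. cmod (f t)) -` {\<delta>..} = K" by (auto simp: K_def)
  finally have "closedin (top_of_set T) K" .
  then have K: "compact K" using T closedin_compact by blast
  obtain m where m: "m > 0" "\<And>t. t \<in> K \<Longrightarrow> (cmod (w t))\<^sup>2 \<ge> m"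
  proof (cases "K = {}")
    case True
    then show ?thesis using that[of 1] by auto
  next
    case False
    have "continuous_on K (\<lambda>t. (cmod (w t))\<^sup>2)"
      by (intro continuous_intros continuous_on_subset[OF w]) (auto simp: K_def)
    then obtain t where t: "t \<in> K" "\<And>s. s \<in> K \<Longrightarrow> (cmod (w t))\<^sup>2 \<le> (cmod (w s))\<^sup>2"
      using continuous_attains_inf[OF K False] by blast
    then have "w t \<noteq> 0" using zero[of t] \<open>\<delta> > 0\<close> by (auto simp: K_def)
    then show ?thesis using that[of "(cmod (w t))\<^sup>2"] t by simp
  qed
  obtain B where B: "B > 0" "\<And>t. t \<in> T \<Longrightarrow> cmod (f t) \<le> B"
    using compact_imp_bounded[OF compact_continuous_image[OF f T]] unfolding bounded_pos by auto
  \<comment> \<open>On \<open>K\<close> the error is at most \<open>B * \<eta> / m\<close>, which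
    this choice makes equal to \<open>\<delta>\<close>.\<close>
  define \<eta> where "\<eta> = \<delta> * m / B"
  have \<eta>: "\<eta> > 0" unfolding \<eta>_def using \<open>\<delta> > 0\<close> m B by simp
  have pos: "(cmod (w t))\<^sup>2 + \<eta> > 0" for t using \<eta> by (simp add: add_nonneg_pos)
  define g where "g = (\<lambda>t. f t * cnj (w t) / of_real ((cmod (w t))\<^sup>2 + \<eta>))"
  have "continuous_on T g"
    unfolding g_def using pos
    by (intro continuous_intros f w) (metis less_irrefl of_real_eq_0_iff)
  moreover have "cmod (f t - g t * w t) \<le> \<delta>" if t: "t \<in> T" for t
  proof -
    have "g t * w t = f t * of_real ((cmod (w t))\<^sup>2) / of_real ((cmod (w t))\<^sup>2 + \<eta>)"
      unfolding g_def complex_norm_square by (simp add: mult.commute mult.left_commute)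
    then have "f t - g t * w t = f t * of_real \<eta> / of_real ((cmod (w t))\<^sup>2 + \<eta>)"
      using pos[of t] by (simp add: field_simps flip: of_real_add of_real_power) (simp add: algebra_simps)
    then have eq: "cmod (f t - g t * w t) = cmod (f t) * (\<eta> / ((cmod (w t))\<^sup>2 + \<eta>))"
      using pos[of t] \<eta> by (simp add: norm_mult norm_divide flip: of_real_add of_real_power)
    show ?thesis
    proof (cases "t \<in> K")
      case True
      have "cmod (f t) * (\<eta> / ((cmod (w t))\<^sup>2 + \<eta>)) \<le> B * (\<eta> / m)"
        using B(2)[OF t] m(2)[OF True] m(1) \<eta> B(1) by (intro mult_mono divide_left_mono) auto
      also have "\<dots> = \<delta>" using m B by (simp add: \<eta>_def)
      finally show ?thesis by (simp add: eq)
    next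
      case False
      have "cmod (f t) * (\<eta> / ((cmod (w t))\<^sup>2 + \<eta>)) \<le> cmod (f t) * 1"
        using \<eta> pos[of t] by (intro mult_left_mono) (auto simp: divide_le_eq)
      also have "\<dots> \<le> \<delta>" using False t by (auto simp: K_def)
      finally show ?thesis by (simp add: eq)
    qed
  qed
  ultimately show ?thesis by (rule that)
qed

context l2_module
begin

definition single :: "'i \<Rightarrow> (real \<Rightarrow> complex) \<Rightarrow> real \<Rightarrow> 'i \<Rightarrow> complex" where
  "single i f = (\<lambda>t j. if t \<in> T \<and> j = i then f t else 0)"

lemma single_closed:
  assumes "continuous_on T f" "\<And>t. t \<in> T \<Longrightarrow> f t \<noteq> 0 \<Longrightarrow> (t, i) \<in> D"
  shows "single i f \<in> carr M"
proof (rule carrI)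
  show "(t, j) \<notin> D \<Longrightarrow> single i f t j = 0" for t j using assms(2) by (auto simp: single_def)
  show "continuous_on T (\<lambda>t. single i f t j)" for j
    using assms(1) by (cases "j = i") (auto simp: single_def cong: continuous_on_cong)
  show "small_tails T (single i f)"
    by (rule small_tails_finite_support[of "{i}"]) (auto simp: single_def)
qed

lemma inn_single:
  assumes "t \<in> T"
  shows "inn M (single i f) \<xi> t = cnj (f t) * \<xi> t i"
proof -
  have "ip (single i f t) (\<xi> t) = (\<Sum>\<^sub>\<infinity>j\<in>{i}. cnj (f t) * \<xi> t i)"
    unfolding ip_def using assms by (intro infsum_cong_neutral) (auto simp: single_def)
  then show ?thesis by (simp add: inn_eq)
qed

lemma sum_smul_apply: "(\<Sum>k\<in>A. smul M (f k) (s k)) t i = (\<Sum>k\<in>A. f k t * s k t i)"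
  by (induction A rule: infinite_finite_induct) (auto simp: smul_eq)

text \<open>The weight \<open>w i\<close> vanishes exactly where coordinate \<open>i\<close> is
  forbidden, so the section \<open>w i\<close> at \<open>i\<close> lies in the module and its
  continuous multiples approximate any admissible coordinate.\<close>

lemma weights_countably_generated:
  fixes w :: "'i \<Rightarrow> real \<Rightarrow> complex"
  assumes w: "\<And>i. continuous_on T (w i)" and D: "\<And>t i. (t, i) \<in> D \<longleftrightarrow> t \<in> T \<and> w i t \<noteq> 0"
    and I: "countable I" "\<And>t i. (t, i) \<in> D \<Longrightarrow> i \<in> I"
  shows "countably_generated T M"
proof -
  define gen where "gen = (\<lambda>i. single i (w i))"
  have gen: "gen i \<in> carr M" for i
    unfolding gen_def by (rule single_closed[OF w]) (simp add: D)
  show ?thesis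
    unfolding countably_generated_def
  proof (intro exI[of _ "\<lambda>n. gen (from_nat_into I n)"] conjI ballI allI impI)
    fix x and e :: real assume x: "x \<in> carr M" and e: "e > 0"
    obtain S where S: "finite S"
      "\<And>t F. t \<in> T \<Longrightarrow> finite F \<Longrightarrow> F \<inter> S = {} \<Longrightarrow> (\<Sum>i\<in>F. (cmod (x t i))\<^sup>2) \<le> e\<^sup>2 / 8"
      using small_tailsE[OF carrD(3)[OF x], of "e\<^sup>2 / 8"] e by auto
    \<comment> \<open>The coordinates in \<open>S\<close> then contribute at most
      \<open>e^2 / 8\<close>, as do the tails; together they give \<open>(e / 2)^2\<close>. The
      added 1 covers an empty \<open>S\<close>.\<close>
    define \<delta> where "\<delta> = e / sqrt (8 * (real (card S) + 1))"
    have \<delta>: "\<delta> > 0" "real (card S) * \<delta>\<^sup>2 \<le> e\<^sup>2 / 8"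
      unfolding \<delta>_def using e by (auto simp: power_divide field_simps)
    have "\<exists>g. continuous_on T g \<and> (\<forall>t\<in>T. cmod (x t i - g t * w i t) \<le> \<delta>)" for i
    proof -
      have "x t i = 0" if "t \<in> T" "w i t = 0" for t using carrD(1)[OF x, of t i] D that by auto
      then show ?thesis
        using continuous_divide_approx[OF compact_base carrD(2)[OF x, of i] w[of i] _ \<delta>(1)] by metis
    qed
    then obtain g where g: "\<And>i. continuous_on T (g i)"
      "\<And>i t. t \<in> T \<Longrightarrow> cmod (x t i - g i t * w i t) \<le> \<delta>"
      by metis
    \<comment> \<open>Only indices in \<open>I\<close> are enumerated; at the others
      \<open>x\<close> vanishes.\<close>
    define S' where "S' = S \<inter> I"
    have S': "finite S'" "S' \<subseteq> I" using S(1) by (auto simp: S'_def)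
    define k where "k = to_nat_on I"
    have k: "inj_on k S'" "\<And>i. i \<in> S' \<Longrightarrow> from_nat_into I (k i) = i"
      using S'(2) inj_on_subset[OF inj_on_to_nat_on[OF I(1)]] I(1) by (auto simp: k_def)
    \<comment> \<open>\<open>from_nat_into\<close> may repeat an index. Coefficients sit only at the
      positions given by \<open>to_nat_on\<close>, so that no generator is counted twice.\<close>
    define f where "f = (\<lambda>j. if j \<in> k ` S' then g (from_nat_into I j) else (\<lambda>t. 0))"
    define n where "n = Suc (Max (insert 0 (k ` S')))"
    have n: "k ` S' \<subseteq> {..<n}" unfolding n_def using S'(1) by (auto simp: less_Suc_eq_le)
    define y where "y = (\<Sum>j<n. smul M (f j) (gen (from_nat_into I j)))"
    have f: "continuous_on T (f j)" for j using g(1) by (simp add: f_def)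
    have y: "y \<in> carr M" unfolding y_def by (intro sum_closed carr_smul f gen)
    have y_eq: "y t i = (if t \<in> T \<and> i \<in> S' then g i t * w i t else 0)" for t i
    proof -
      have "y t i = (\<Sum>j<n. f j t * gen (from_nat_into I j) t i)" unfolding y_def by (rule sum_smul_apply)
      also have "\<dots> = (\<Sum>j\<in>k ` S'. f j t * gen (from_nat_into I j) t i)"
        using n by (intro sum.mono_neutral_right) (auto simp: f_def)
      also have "\<dots> = (\<Sum>l\<in>S'. g l t * gen l t i)"
        using k by (simp add: sum.reindex f_def)
      also have "\<dots> = (\<Sum>l\<in>S'. if l = i then (if t \<in> T then g i t * w i t else 0) else 0)"
        by (intro sum.cong) (auto simp: gen_def single_def)
      also have "\<dots> = (if t \<in> T \<and> i \<in> S' then g i t * w i t else 0)" using S'(1) by simp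
      finally show ?thesis .
    qed
    have "hnorm T M (x - y) \<le> e / 2"
    proof (rule hnorm_leI_sums)
      fix t and F :: "'i set" assume t: "t \<in> T" and F: "finite F"
      have x0: "x t i = 0" if "i \<notin> I" for i using carrD(1)[OF x] I(2) that by blast
      have "(\<Sum>i\<in>F. (cmod ((x - y) t i))\<^sup>2) =
          (\<Sum>i\<in>F \<inter> S. (cmod ((x - y) t i))\<^sup>2) + (\<Sum>i\<in>F - S. (cmod ((x - y) t i))\<^sup>2)"
        using F by (rule sum.Int_Diff)
      also have "(\<Sum>i\<in>F - S. (cmod ((x - y) t i))\<^sup>2) = (\<Sum>i\<in>F - S. (cmod (x t i))\<^sup>2)"
        by (intro sum.cong) (auto simp: y_eq S'_def)
      also have "\<dots> \<le> e\<^sup>2 / 8" using S(2)[OF t] F by blast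
      also have "(\<Sum>i\<in>F \<inter> S. (cmod ((x - y) t i))\<^sup>2) \<le> (\<Sum>i\<in>F \<inter> S. \<delta>\<^sup>2)"
        using g(2)[OF t] \<delta>(1) t x0 by (intro sum_mono power_mono) (auto simp: y_eq S'_def)
      also have "\<dots> \<le> real (card S) * \<delta>\<^sup>2"
        using S(1) by (simp add: card_mono mult_right_mono)
      also note \<delta>(2)
      finally show "(\<Sum>i\<in>F. (cmod ((x - y) t i))\<^sup>2) \<le> (e / 2)\<^sup>2" by (simp add: power_divide)
    qed (use x y carr_diff e in auto)
    then show "\<exists>n f. (\<forall>i<n. continuous_on T (f i)) \<and>
        hnorm T M (x - (\<Sum>i<n. smul M (f i) (gen (from_nat_into I i)))) < e"
      using f e unfolding y_def by (intro exI[of _ n] exI[of _ f]) auto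
  qed (use gen in auto)
qed

end


section \<open>Rotations along paths\<close>

text \<open>
  The vectors \<open>\<delta> x - r \<delta> x'\<close>, normalized, form an orthonormal family for the scalar product
  \<open>r ^ d(x, y)\<close>. Moving the origin from \<open>a\<close> to a neighbour \<open>b\<close> changes only two members of that
  family, by the following rotation.
\<close>

definition rot :: "real \<Rightarrow> 'v \<Rightarrow> 'v \<Rightarrow> ('v \<Rightarrow> complex) \<Rightarrow> 'v \<Rightarrow> complex" where
  "rot r a b f = (let s = complex_of_real (sqrt (1 - r\<^sup>2)) in
    f(a := s * f a + complex_of_real r * f b, b := s * f b - complex_of_real r * f a))"

text \<open>\<open>rot r a b\<close> turns coordinates in the basis adapted to origin
  \<open>b\<close> into coordinates in the basis adapted to \<open>a\<close>. Hence
  \<open>turn\<close> carries the origin back from the last vertex of the list to the first.\<close>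

fun turn :: "real \<Rightarrow> 'v list \<Rightarrow> ('v \<Rightarrow> complex) \<Rightarrow> 'v \<Rightarrow> complex" where
  "turn r (x # y # p) f = rot r x y (turn r (y # p) f)"
| "turn r [x] f = f"
| "turn r [] f = f"

lemma rot_apply:
  assumes "a \<noteq> b"
  shows "rot r a b f a = complex_of_real (sqrt (1 - r\<^sup>2)) * f a + complex_of_real r * f b"
    "rot r a b f b = complex_of_real (sqrt (1 - r\<^sup>2)) * f b - complex_of_real r * f a"
    "x \<noteq> a \<Longrightarrow> x \<noteq> b \<Longrightarrow> rot r a b f x = f x"
  using assms by (auto simp: rot_def Let_def)

lemma of_real_sqrt_sum_squares:
  assumes "\<bar>r\<bar> \<le> 1"
  shows "complex_of_real (sqrt (1 - r\<^sup>2)) * complex_of_real (sqrt (1 - r\<^sup>2)) +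
    complex_of_real r * complex_of_real r = 1"
proof -
  have "sqrt (1 - r\<^sup>2) * sqrt (1 - r\<^sup>2) + r * r = 1"
    using abs_square_le_1[of r] assms by (simp add: power2_eq_square)
  then show ?thesis by (metis of_real_1 of_real_add of_real_mult)
qed

text \<open>Exchanging the two vertices reverses the angle of the rotation, so stepping along an
  edge and back cancels.\<close>

lemma rot_rot:
  assumes "\<bar>r\<bar> \<le> 1" "a \<noteq> b"
  shows "rot r b a (rot r a b f) = f"
proof
  define s where "s = complex_of_real (sqrt (1 - r\<^sup>2))"
  define c where "c = complex_of_real r"
  have sc: "s * s + c * c = 1" unfolding s_def c_def by (rule of_real_sqrt_sum_squares[OF assms(1)])
  have "s * (s * u + c * v) - c * (s * v - c * u) = u" "s * (s * v - c * u) + c * (s * u + c * v) = v" for u v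
    using sc by algebra+
  then show "rot r b a (rot r a b f) x = f x" for x
    using assms(2) by (cases "x = a"; cases "x = b") (simp_all add: rot_apply flip: s_def c_def)
qed

lemma rot_0: "rot 0 a b f = f"
  by (auto simp: rot_def Let_def)

lemma rot_linear: "rot r a b (\<lambda>x. c * f x + g x) = (\<lambda>x. c * rot r a b f x + rot r a b g x)"
  by (auto simp: rot_def Let_def fun_eq_iff algebra_simps)

lemma ell2_fun_upd:
  assumes "ell2 f"
  shows "ell2 (f(a := c))"
proof -
  have "(\<lambda>i. (cmod ((f(a := c)) i))\<^sup>2) summable_on insert a (- {a})"
    unfolding summable_on_insert_iff
  proof (subst summable_on_cong)
    show "(\<lambda>i. (cmod (f i))\<^sup>2) summable_on - {a}"
      using assms unfolding ell2_def by (rule summable_on_subset_banach) simp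
  qed auto
  moreover have "insert a (- {a}) = UNIV" by auto
  ultimately show ?thesis by (simp add: ell2_def)
qed

lemma ell2_rot: "ell2 f \<Longrightarrow> ell2 (rot r a b f)"
  unfolding rot_def Let_def by (intro ell2_fun_upd)

lemma ip_rot:
  assumes "ell2 f" "ell2 g" "\<bar>r\<bar> \<le> 1" "a \<noteq> b"
  shows "ip (rot r a b f) (rot r a b g) = ip f g"
proof -
  have "(\<Sum>i\<in>{a, b}. cnj (rot r a b f i) * rot r a b g i) = (\<Sum>i\<in>{a, b}. cnj (f i) * g i)"
  proof -
    define s where "s = complex_of_real (sqrt (1 - r\<^sup>2))"
    define c where "c = complex_of_real r"
    have sc: "s * s + c * c = 1" unfolding s_def c_def by (rule of_real_sqrt_sum_squares[OF assms(3)])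
    have "(s * u + c * v) * (s * u' + c * v') + (s * v - c * u) * (s * v' - c * u') = u * u' + v * v'" for u v u' v'
      using sc by algebra
    moreover have "cnj s = s" "cnj c = c" by (simp_all add: s_def c_def)
    ultimately show ?thesis using assms(4) by (simp add: rot_apply flip: s_def c_def)
  qed
  moreover have "(\<Sum>\<^sub>\<infinity>i\<in>-{a, b}. cnj (rot r a b f i) * rot r a b g i) = (\<Sum>\<^sub>\<infinity>i\<in>-{a, b}. cnj (f i) * g i)"
    using assms(4) by (intro infsum_cong) (simp add: rot_apply)
  ultimately show ?thesis
    using assms ip_split_finite[of "rot r a b f" "rot r a b g" "{a, b}"] ip_split_finite[of f g "{a, b}"]
    by (simp add: ell2_rot)
qed

lemma turn_0: "turn 0 p f = f"
  by (induction "0::real" p f rule: turn.induct) (simp_all add: rot_0)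

lemma turn_linear: "turn r p (\<lambda>x. c * f x + g x) = (\<lambda>x. c * turn r p f x + turn r p g x)"
  by (induction r p f rule: turn.induct) (simp_all add: rot_linear)

lemma turn_outside: "x \<notin> set p \<Longrightarrow> turn r p f x = f x"
  by (induction r p f rule: turn.induct) (simp_all add: rot_def Let_def)

lemma turn_vanishing:
  assumes "\<And>x. x \<in> set p \<Longrightarrow> f x = 0"
  shows "turn r p f = f"
  using assms by (induction r p f rule: turn.induct) (auto simp: rot_def Let_def)

text \<open>The vertex \<open>y\<close> is shared because rotations belong to edges: the edges of
  the whole list are those up to \<open>y\<close> and those from \<open>y\<close> on.\<close>

lemma turn_append: "turn r (p @ y # q) f = turn r (p @ [y]) (turn r (y # q) f)"
  by (induction p rule: induct_list012) simp_all

lemma ell2_turn: "ell2 f \<Longrightarrow> ell2 (turn r p f)"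
  by (induction r p f rule: turn.induct) (simp_all add: ell2_rot)

lemma ip_turn:
  assumes "ell2 f" "ell2 g" "\<bar>r\<bar> \<le> 1" "distinct p"
  shows "ip (turn r p f) (turn r p g) = ip f g"
  using assms(4)
proof (induction p rule: induct_list012)
  case (3 x y p)
  then show ?case using assms by (simp add: ip_rot ell2_turn)
qed simp_all

text \<open>At \<open>r = 1\<close> each rotation is a quarter turn, \<open>f a := f b\<close> and
  \<open>f b := - f a\<close>, so the last entry is handed on until it reaches the head.\<close>

lemma turn_1_hd:
  assumes "p \<noteq> []" "distinct p"
  shows "turn 1 p f (hd p) = f (last p)"
  using assms
proof (induction p rule: induct_list012)
  case (3 x y p)
  then show ?case by (simp add: rot_apply)
qed simp_all

lemma turn_1_vanishing:
  assumes "p \<noteq> []" "distinct p" "\<And>x. x \<noteq> last p \<Longrightarrow> f x = 0" "x \<noteq> hd p"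
  shows "turn 1 p f x = 0"
  using assms
proof (induction p arbitrary: x rule: induct_list012)
  case (3 a b p)
  then have IH: "turn 1 (b # p) f x = 0" if "x \<noteq> b" for x using that by simp
  show ?case using IH[of x] IH[of a] 3(3-6) by (cases "x = b") (auto simp: rot_apply)
qed simp_all

lemma continuous_on_turn:
  assumes "\<And>x. continuous_on T (\<lambda>t. f t x)" "continuous_on T r"
  shows "continuous_on T (\<lambda>t. turn (r t) p (f t) x)"
proof (induction p arbitrary: x rule: induct_list012)
  case (3 a b p)
  have "continuous_on T (\<lambda>t. rot (r t) a b (turn (r t) (b # p) (f t)) x)"
    unfolding rot_def Let_def using 3(2) assms(2)
    by (cases "x = a"; cases "x = b") (auto intro!: continuous_intros simp del: turn.simps)
  then show ?case by simp
qed (use assms(1) in auto)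


section \<open>Trees\<close>

locale tree_graph =
  fixes X0 :: "'v set" and X1 :: "('v \<times> 'v) set"
  assumes tree: "tree X0 X1"
begin

abbreviation is_path where "is_path \<equiv> path_between X0 X1"
abbreviation par where "par \<equiv> toward X0 X1"

definition path where "path x y = (THE p. is_path x p y)"

lemma edge_in: "(x, y) \<in> X1 \<Longrightarrow> x \<in> X0 \<and> y \<in> X0"
  using tree by (auto simp: tree_def)

lemma edge_sym: "(x, y) \<in> X1 \<Longrightarrow> (y, x) \<in> X1"
  using tree by (auto simp: tree_def sym_def)

lemma edge_neq: "(x, y) \<in> X1 \<Longrightarrow> x \<noteq> y"
  using tree by (auto simp: tree_def irrefl_def)

lemma ex1_path:
  assumes "x \<in> X0" "y \<in> X0"
  shows "\<exists>!p. is_path x p y"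
proof -
  have "\<forall>x\<in>X0. \<forall>y\<in>X0. \<exists>!p. is_path x p y" using tree unfolding tree_def by (elim conjE)
  then show ?thesis using assms by blast
qed

lemma is_path_path: "x \<in> X0 \<Longrightarrow> y \<in> X0 \<Longrightarrow> is_path x (path x y) y"
  unfolding path_def by (rule theI'[OF ex1_path])

lemma path_unique: "x \<in> X0 \<Longrightarrow> y \<in> X0 \<Longrightarrow> is_path x p y \<Longrightarrow> path x y = p"
  unfolding path_def by (rule the1_equality[OF ex1_path])

lemma pathD:
  assumes "x \<in> X0" "y \<in> X0"
  shows "path x y \<noteq> []" "hd (path x y) = x" "last (path x y) = y" "set (path x y) \<subseteq> X0"
    "distinct (path x y)" "successively (\<lambda>u v. (u, v) \<in> X1) (path x y)"
    "x \<in> set (path x y)" "y \<in> set (path x y)"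
proof -
  have p: "path x y \<noteq> []" "hd (path x y) = x" "last (path x y) = y"
    using is_path_path[OF assms] by (auto simp: path_between_def)
  then show "path x y \<noteq> []" "hd (path x y) = x" "last (path x y) = y" by auto
  show "x \<in> set (path x y)" "y \<in> set (path x y)" using p hd_in_set last_in_set by metis+
qed (use is_path_path[OF assms] in \<open>auto simp: path_between_def\<close>)

lemma path_self: "x \<in> X0 \<Longrightarrow> path x x = [x]"
  by (rule path_unique) (simp_all add: path_between_def)

lemma path_rev:
  assumes "x \<in> X0" "y \<in> X0"
  shows "path y x = rev (path x y)"
proof (rule path_unique)
  show "is_path y (rev (path x y)) x"
    using pathD[OF assms] edge_sym
    by (auto simp: path_between_def hd_rev last_rev elim: successively_mono)
qed (fact assms)+

text \<open>The basic dichotomy of a tree: of the paths to two neighbours, one extends the other by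
  one vertex.\<close>

lemma path_edge_cases:
  assumes x: "x \<in> X0" and yz: "(y, z) \<in> X1"
  obtains "path x z = path x y @ [z]" "z \<notin> set (path x y)"
  | "path x y = path x z @ [y]" "y \<notin> set (path x z)"
proof -
  have y: "y \<in> X0" and z: "z \<in> X0" using edge_in yz by auto
  note p = pathD[OF x y]
  show thesis
  proof (cases "z \<in> set (path x y)")
    case False
    have "is_path x (path x y @ [z]) z"
      using False p yz z by (auto simp: path_between_def successively_append_iff)
    then show ?thesis using path_unique[OF x z] False that(1) by blast
  next
    case True
    \<comment> \<open>Cutting the path at \<open>z\<close> and stepping directly to \<open>y\<close>
      also gives a path from \<open>x\<close> to \<open>y\<close>; uniqueness leaves nothing else
      between \<open>z\<close> and \<open>y\<close>.\<close>
    then obtain q q' where q: "path x y = q @ z # q'" by (auto simp: in_set_conv_decomp)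
    have "q' \<noteq> []" using p(3) q edge_neq[OF yz] by auto
    then have y': "y \<in> set q'" using p(3) q by (auto intro: last_in_set)
    have hd: "hd (q @ [z]) = x" using p(2) q by (cases q) auto
    have 1: "is_path x (q @ [z]) z"
      unfolding path_between_def using p(4-6) q z hd by (auto simp: successively_append_iff)
    have "hd ((q @ [z]) @ [y]) = x" using hd by (cases q) auto
    then have "is_path x ((q @ [z]) @ [y]) y"
      using 1 p(5) q y' y edge_sym[OF yz] unfolding path_between_def
      by (auto simp: successively_append_iff)
    then have "path x y = path x z @ [y]" using path_unique[OF x y] path_unique[OF x z 1] by simp
    then show ?thesis using p(5) that(2) by simp
  qed
qed

text \<open>By the dichotomy, a neighbour of \<open>x\<close> on the path must be its last vertex
  before \<open>x\<close>, so there is just one candidate.\<close>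

lemma parI:
  assumes "z \<in> X0" "(x, y) \<in> X1" "y \<in> set (path z x)"
  shows "par z x = y"
proof -
  have x: "x \<in> X0" using assms edge_in by blast
  have unique: "path z x = path z y' @ [x]" if "(x, y') \<in> X1" "y' \<in> set (path z x)" for y'
    using path_edge_cases[OF assms(1) that(1)] that(2) by metis
  show ?thesis
    unfolding toward_def
  proof (rule the_equality)
    show "(x, y) \<in> X1 \<and> (\<exists>p. is_path z p x \<and> y \<in> set p)"
      using assms is_path_path[OF assms(1) x] by blast
    fix y' assume y': "(x, y') \<in> X1 \<and> (\<exists>p. is_path z p x \<and> y' \<in> set p)"
    then have "path z x = path z y' @ [x]" using unique path_unique[OF assms(1) x] by blast
    then have "path z y = path z y'" using unique[OF assms(2,3)] by simp
    then show "y' = y"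
      using pathD(3)[OF assms(1), of y] pathD(3)[OF assms(1), of y'] edge_in y' assms(2) by metis
  qed
qed

lemma par_props:
  assumes "z \<in> X0" "x \<in> X0" "x \<noteq> z"
  shows "(x, par z x) \<in> X1" "par z x \<in> set (path z x)"
proof -
  note p = pathD[OF assms(1,2)]
  define q where "q = butlast (path z x)"
  have q: "path z x = q @ [x]" using p(1,3) unfolding q_def by (metis append_butlast_last_id)
  have "q \<noteq> []" using p(2) q assms(3) by auto
  then have "(last q, x) \<in> X1" "last q \<in> set (path z x)"
    using p(6) q by (auto simp: successively_append_iff)
  then show "(x, par z x) \<in> X1" "par z x \<in> set (path z x)"
    using parI[OF assms(1), of x "last q"] edge_sym by auto
qed

lemma edge_par_cases:
  assumes "z \<in> X0" "(x, y) \<in> X1"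
  obtains "x \<noteq> z" "y = par z x" | "y \<noteq> z" "x = par z y"
proof (cases rule: path_edge_cases[OF assms])
  case 1
  have "x \<in> set (path z y)" using 1 pathD(8)[OF assms(1), of x] edge_in assms(2) by auto
  moreover have "y \<noteq> z" using 1(2) pathD(7)[OF assms(1), of x] edge_in assms(2) by auto
  ultimately show ?thesis using parI[OF assms(1) edge_sym[OF assms(2)]] that(2) by blast
next
  case 2
  have "y \<in> set (path z x)" using 2 pathD(8)[OF assms(1), of y] edge_in assms(2) by auto
  moreover have "x \<noteq> z" using 2(2) pathD(7)[OF assms(1), of y] edge_in assms(2) by auto
  ultimately show ?thesis using parI[OF assms(1) assms(2)] that(1) by blast
qed

text \<open>Otherwise each of two neighbours would lie on the path to the other. This is why an edge
  has only one direction towards \<open>z\<close>.\<close>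

lemma par_par_neq:
  assumes "z \<in> X0" "x \<in> X0" "x \<noteq> z" "par z x \<noteq> z"
  shows "par z (par z x) \<noteq> x"
proof
  assume eq: "par z (par z x) = x"
  note e = par_props[OF assms(1-3)]
  have y: "par z x \<in> X0" using e edge_in by blast
  have x: "x \<in> set (path z (par z x))" using par_props(2)[OF assms(1) y assms(4)] eq by simp
  show False
    using path_edge_cases[OF assms(1) e(1)] x e(2) by metis
qed

text \<open>Seen from \<open>x\<close>, the path to one end of the edge extends the path to the
  other, hence both start with the same step. This is why a change of origin across an edge is a
  rotation in a single plane.\<close>

lemma par_change_root:
  assumes "(a, b) \<in> X1" "x \<in> X0" "x \<noteq> a" "x \<noteq> b"
  shows "par a x = par b x"
proof -
  have aux: "par a x = par b x" if ab: "(a, b) \<in> X1" "x \<noteq> a" and eq: "path x b = path x a @ [b]" for a b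
  proof -
    have in_X0: "a \<in> X0" "b \<in> X0" using ab edge_in by auto
    have "set (path a x) \<subseteq> set (path b x)"
      using path_rev[OF assms(2) in_X0(1)] path_rev[OF assms(2) in_X0(2)] eq by auto
    then have "par b x = par a x" using par_props[OF in_X0(1) assms(2) ab(2)] by (intro parI in_X0) auto
    then show ?thesis by simp
  qed
  show ?thesis
    using path_edge_cases[OF assms(2,1)] aux[OF assms(1)] aux[OF edge_sym[OF assms(1)]] assms(3,4) by metis
qed

text \<open>The change of coordinates from origin \<open>y\<close> to origin
  \<open>x\<close>.\<close>

definition transport :: "real \<Rightarrow> 'v \<Rightarrow> 'v \<Rightarrow> ('v \<Rightarrow> complex) \<Rightarrow> 'v \<Rightarrow> complex" where
  "transport r x y = turn r (path x y)"

lemma transport_self: "x \<in> X0 \<Longrightarrow> transport r x x f = f"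
  by (simp add: transport_def path_self)

text \<open>If the path to \<open>z\<close> extends the path to \<open>y\<close>, the rotation is
  one more factor; otherwise it cancels the last factor by \<open>rot_rot\<close>.\<close>

lemma transport_rot:
  assumes "x \<in> X0" "(y, z) \<in> X1" "\<bar>r\<bar> \<le> 1"
  shows "transport r x y (rot r y z f) = transport r x z f"
proof -
  have snoc: "path x u = butlast (path x u) @ [u]" if "u \<in> X0" for u
    using pathD(1,3)[OF assms(1) that] by (metis append_butlast_last_id)
  have yz: "y \<in> X0" "z \<in> X0" using assms edge_in by auto
  show ?thesis
  proof (cases rule: path_edge_cases[OF assms(1,2)])
    case 1
    then have "path x z = butlast (path x y) @ [y, z]" using snoc[OF yz(1)] by simp
    then show ?thesis
      using turn_append[of r "butlast (path x y)" y "[z]" f] snoc[OF yz(1)]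
      unfolding transport_def by simp
  next
    case 2
    then have "path x y = butlast (path x z) @ [z, y]" using snoc[OF yz(2)] by simp
    then show ?thesis
      using turn_append[of r "butlast (path x z)" z "[y]" "rot r y z f"] snoc[OF yz(2)]
        rot_rot[OF assms(3) edge_neq[OF assms(2)]]
      unfolding transport_def by simp
  qed
qed

text \<open>A walk in a tree reduces to the path between its ends by cancelling backtracks, and
  \<open>transport_rot\<close> performs these cancellations one edge at a time.\<close>

lemma transport_trans:
  assumes "x \<in> X0" "y \<in> X0" "z \<in> X0" "\<bar>r\<bar> \<le> 1"
  shows "transport r x y (transport r y z f) = transport r x z f"
proof -
  have "transport r x (hd p) (turn r p f) = transport r x (last p) f"
    if "p \<noteq> []" "successively (\<lambda>u v. (u, v) \<in> X1) p" for p
    using that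
  proof (induction p rule: induct_list012)
    case (3 u v p)
    then show ?case using transport_rot[OF assms(1) _ assms(4), of u v] by simp
  qed simp_all
  from this[of "path y z"] show ?thesis
    using pathD[OF assms(2,3)] by (simp add: transport_def)
qed

lemma transport_0: "transport 0 x y f = f"
  by (simp add: transport_def turn_0)

lemma transport_linear:
  "transport r x y (\<lambda>v. c * f v + g v) = (\<lambda>v. c * transport r x y f v + transport r x y g v)"
  by (simp add: transport_def turn_linear)

lemma transport_1_apply: "x \<in> X0 \<Longrightarrow> y \<in> X0 \<Longrightarrow> transport 1 x y f x = f y"
  using turn_1_hd[of "path x y" f] pathD[of x y] by (simp add: transport_def)

lemma transport_1_vanishing:
  "x \<in> X0 \<Longrightarrow> y \<in> X0 \<Longrightarrow> (\<And>v. v \<noteq> y \<Longrightarrow> f v = 0) \<Longrightarrow> v \<noteq> x \<Longrightarrow> transport 1 x y f v = 0"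
  using turn_1_vanishing[of "path x y" f v] pathD[of x y] by (simp add: transport_def)

lemma transport_support: "x \<in> X0 \<Longrightarrow> y \<in> X0 \<Longrightarrow> v \<notin> X0 \<Longrightarrow> transport r x y f v = f v"
  using pathD(4)[of x y] by (auto simp: transport_def intro!: turn_outside)

text \<open>An antisymmetric function on the edges, in the basis of the edges oriented towards \<open>z\<close>.\<close>

definition edge_coords :: "'v \<Rightarrow> ('v \<times> 'v \<Rightarrow> complex) \<Rightarrow> 'v \<Rightarrow> complex" where
  "edge_coords z k = (\<lambda>x. if x \<in> X0 \<and> x \<noteq> z then k (x, par z x) else 0)"

text \<open>The edge joining \<open>a\<close> and \<open>b\<close> is indexed by \<open>a\<close>
  for root \<open>b\<close> and by \<open>b\<close>, with opposite direction, for root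
  \<open>a\<close>. The sign of the quarter turn is the sign of antisymmetry; all other edges keep
  index and direction.\<close>

lemma rot_1_edge_coords:
  assumes "(a, b) \<in> X1" "\<And>x y. k (y, x) = - k (x, y)"
  shows "rot 1 a b (edge_coords b k) = edge_coords a k"
proof
  fix x
  have ab: "a \<in> X0" "b \<in> X0" "a \<noteq> b" using assms(1) edge_in edge_neq by auto
  have par: "par b a = b" "par a b = a"
    using parI[of b a b] parI[of a b a] pathD(7)[of b a] pathD(7)[of a b] ab edge_sym assms(1) by auto
  show "rot 1 a b (edge_coords b k) x = edge_coords a k x"
    using par_change_root[OF assms(1), of x] ab par assms(2)[of b a]
    by (cases "x = a"; cases "x = b") (auto simp: rot_apply edge_coords_def)
qed

lemma transport_edge_coords:
  assumes "x \<in> X0" "z \<in> X0" "\<And>x y. k (y, x) = - k (x, y)"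
  shows "transport 1 x z (edge_coords z k) = edge_coords x k"
proof -
  have "turn 1 p (edge_coords (last p) k) = edge_coords (hd p) k"
    if "p \<noteq> []" "successively (\<lambda>u v. (u, v) \<in> X1) p" for p
    using that
  proof (induction p rule: induct_list012)
    case (3 u v p)
    then show ?case using rot_1_edge_coords[where k = k, OF _ assms(3), of u v] by simp
  qed simp_all
  from this[of "path x z"] show ?thesis
    using pathD[OF assms(1,2)] by (simp add: transport_def)
qed

text \<open>Spheres about a vertex are finite by the degree bound. Countability gives countable
  generation and allows vectors to be coded in \<open>univ\<close>.\<close>

lemma countable_vertices:
  assumes "bounded_degree X0 X1"
  shows "countable X0"
proof (cases "X0 = {}")
  case False
  then obtain z where z: "z \<in> X0" by blast
  \<comment> \<open>Paths list their vertices, so length \<open>Suc n\<close> describes the sphere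
    of radius \<open>n\<close>.\<close>
  define N where "N = (\<lambda>n. {x \<in> X0. length (path z x) = Suc n})"
  have "finite (N n)" for n
  proof (induction n)
    case 0
    have "N 0 \<subseteq> {z}"
    proof
      fix x assume "x \<in> N 0"
      then have x: "x \<in> X0" "length (path z x) = 1" by (auto simp: N_def)
      then show "x \<in> {z}" using pathD(2,3)[OF z x(1)] by (cases "path z x") auto
    qed
    then show ?case using finite_subset by blast
  next
    case (Suc n)
    have "N (Suc n) \<subseteq> (\<Union>y\<in>N n. {x. (y, x) \<in> X1})"
    proof
      fix x assume "x \<in> N (Suc n)"
      then have x: "x \<in> X0" "length (path z x) = Suc (Suc n)" by (auto simp: N_def)
      then have "x \<noteq> z" using path_self[OF z] by auto
      note e = par_props[OF z x(1) this]
      have "path z x = path z (par z x) @ [x]" using path_edge_cases[OF z e(1)] e(2) by metis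
      then have "par z x \<in> N n" using x edge_in[OF e(1)] by (simp add: N_def)
      then show "x \<in> (\<Union>y\<in>N n. {x. (y, x) \<in> X1})" using edge_sym[OF e(1)] by blast
    qed
    moreover have "finite (\<Union>y\<in>N n. {x. (y, x) \<in> X1})"
      using Suc assms unfolding bounded_degree_def N_def by blast
    ultimately show ?case using finite_subset by blast
  qed
  moreover have "X0 = (\<Union>n. N n)"
  proof (intro equalityI subsetI)
    fix x assume "x \<in> X0"
    then have "x \<in> N (length (path z x) - 1)" using pathD(1)[OF z] by (simp add: N_def)
    then show "x \<in> (\<Union>n. N n)" by blast
  qed (auto simp: N_def)
  ultimately show ?thesis using countable_UN[of UNIV N] by (simp add: countable_finite)
qed simp

end


section \<open>The family of representations\<close>

locale tree_action = tree_graph X0 X1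
  for X0 :: "'v set" and X1 :: "('v \<times> 'v) set" +
  fixes act :: "'g::topological_group_add \<Rightarrow> 'v \<Rightarrow> 'v" and x0 :: 'v
  assumes action: "continuous_action X0 X1 act" and origin: "x0 \<in> X0"
begin

lemma act_in: "x \<in> X0 \<Longrightarrow> act g x \<in> X0"
  and act_zero: "x \<in> X0 \<Longrightarrow> act 0 x = x"
  and act_add: "x \<in> X0 \<Longrightarrow> act (g + h) x = act g (act h x)"
  and act_edge: "(x, y) \<in> X1 \<Longrightarrow> (act g x, act g y) \<in> X1"
  and act_open: "x \<in> X0 \<Longrightarrow> open {g. act g x = x}"
  using action by (auto simp: continuous_action_def)

lemma act_inverse: "x \<in> X0 \<Longrightarrow> act (- g) (act g x) = x" "x \<in> X0 \<Longrightarrow> act g (act (- g) x) = x"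
  using act_add[of x "- g" g] act_add[of x g "- g"] act_zero[of x] by simp_all

lemma act_eq_iff: "x \<in> X0 \<Longrightarrow> y \<in> X0 \<Longrightarrow> act (- g) x = y \<longleftrightarrow> x = act g y"
  using act_inverse by metis

lemma act_inj: "inj_on (act g) X0"
  by (metis act_inverse(1) inj_onI)

lemma act_path:
  assumes "x \<in> X0" "y \<in> X0"
  shows "path (act g x) (act g y) = map (act g) (path x y)"
proof (rule path_unique)
  note p = pathD[OF assms]
  show "is_path (act g x) (map (act g) (path x y)) (act g y)"
    using p act_in act_edge inj_on_subset[OF act_inj p(4)]
    by (auto simp: path_between_def hd_map last_map distinct_map successively_map elim: successively_mono)
qed (use assms act_in in auto)

lemma act_par:
  assumes "z \<in> X0" "x \<in> X0" "x \<noteq> z"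
  shows "par (act g z) (act g x) = act g (par z x)"
  using par_props[OF assms] act_path[OF assms(1,2)] by (intro parI act_in assms act_edge) auto

definition perm :: "'g \<Rightarrow> ('v \<Rightarrow> complex) \<Rightarrow> 'v \<Rightarrow> complex" where
  "perm g f = (\<lambda>x. if x \<in> X0 then f (act (- g) x) else 0)"

lemma perm_zero: "(\<And>x. x \<notin> X0 \<Longrightarrow> f x = 0) \<Longrightarrow> perm 0 f = f"
  by (auto simp: perm_def fun_eq_iff act_zero)

lemma perm_add: "perm (g + h) f = perm g (perm h f)"
proof -
  have "act (- (g + h)) x = act (- h) (act (- g) x)" if "x \<in> X0" for x
    using act_add[OF that, of "- h" "- g"] by (simp only: minus_add)
  then show ?thesis by (auto simp: perm_def fun_eq_iff act_in)
qed

lemma perm_linear: "perm g (\<lambda>v. c * f v + h v) = (\<lambda>v. c * perm g f v + perm g h v)"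
  by (auto simp: perm_def)

lemma perm_rot: "a \<in> X0 \<Longrightarrow> b \<in> X0 \<Longrightarrow> a \<noteq> b \<Longrightarrow> perm g (rot r a b f) = rot r (act g a) (act g b) (perm g f)"
  using inj_onD[OF act_inj, of g a b]
  by (auto simp: perm_def rot_def Let_def fun_eq_iff act_in act_inverse act_eq_iff)

lemma perm_transport:
  assumes "x \<in> X0" "y \<in> X0"
  shows "perm g (transport r x y f) = transport r (act g x) (act g y) (perm g f)"
proof -
  have "perm g (turn r p f) = turn r (map (act g) p) (perm g f)" if "set p \<subseteq> X0" "distinct p" for p
    using that
  proof (induction p rule: induct_list012)
    case (3 u v p)
    then show ?case by (simp add: perm_rot)
  qed simp_all
  then show ?thesis unfolding transport_def act_path[OF assms] using pathD[OF assms] by blast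
qed

lemma bij_betw_act: "bij_betw (act g) X0 X0"
  by (rule bij_betw_byWitness[where f' = "act (- g)"]) (auto simp: act_in act_inverse)

lemma ip_on_vertices:
  assumes "\<And>x. x \<notin> X0 \<Longrightarrow> f x = 0"
  shows "ip f h = (\<Sum>\<^sub>\<infinity>x\<in>X0. cnj (f x) * h x)"
  unfolding ip_def using assms by (intro infsum_cong_neutral) auto

lemma ip_perm:
  assumes "\<And>x. x \<notin> X0 \<Longrightarrow> f x = 0"
  shows "ip (perm g f) (perm g h) = ip f h"
proof -
  have "ip (perm g f) (perm g h) = (\<Sum>\<^sub>\<infinity>x\<in>X0. cnj (perm g f x) * perm g h x)"
    by (rule ip_on_vertices) (simp add: perm_def)
  also have "\<dots> = (\<Sum>\<^sub>\<infinity>x\<in>X0. cnj (f (act (- g) x)) * h (act (- g) x))"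
    by (intro infsum_cong) (simp add: perm_def)
  also have "\<dots> = (\<Sum>\<^sub>\<infinity>x\<in>X0. cnj (f x) * h x)"
    by (rule infsum_reindex_bij_betw[OF bij_betw_act])
  also have "\<dots> = ip f h" by (rule ip_on_vertices[symmetric]) (fact assms)
  finally show ?thesis .
qed

lemma ell2_perm:
  assumes "ell2 f"
  shows "ell2 (perm g f)"
proof -
  have "(\<lambda>x. (cmod (f x))\<^sup>2) summable_on X0"
    using assms unfolding ell2_def by (rule summable_on_subset_banach) simp
  then have "(\<lambda>x. (cmod (f (act (- g) x)))\<^sup>2) summable_on X0"
    using summable_on_reindex_bij_betw[OF bij_betw_act[of "- g"], of "\<lambda>x. (cmod (f x))\<^sup>2"] by simp
  also have "?this \<longleftrightarrow> ell2 (perm g f)"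
    unfolding ell2_def by (intro summable_on_cong_neutral) (auto simp: perm_def)
  finally show ?thesis .
qed

text \<open>\<open>perm g\<close> carries coordinates for origin \<open>x0\<close> to coordinates
  for origin \<open>g x0\<close>; the transport rewrites the result for origin
  \<open>x0\<close>.\<close>

definition pi_r :: "real \<Rightarrow> 'g \<Rightarrow> ('v \<Rightarrow> complex) \<Rightarrow> 'v \<Rightarrow> complex" where
  "pi_r r g f = transport r x0 (act g x0) (perm g f)"

lemma pi_r_zero: "(\<And>x. x \<notin> X0 \<Longrightarrow> f x = 0) \<Longrightarrow> pi_r r 0 f = f"
  by (simp add: pi_r_def act_zero origin transport_self perm_zero)

text \<open>Equivariance moves the permutation past the inner transport; the two transports then
  compose along \<open>x0\<close>, \<open>g x0\<close>, \<open>(g + h) x0\<close>.\<close>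

lemma pi_r_add: "\<bar>r\<bar> \<le> 1 \<Longrightarrow> pi_r r (g + h) f = pi_r r g (pi_r r h f)"
  by (simp add: pi_r_def perm_transport perm_add act_add origin act_in transport_trans)

lemma pi_r_stabilizer: "act g x0 = x0 \<Longrightarrow> pi_r r g f = perm g f"
  by (simp add: pi_r_def transport_self origin)

lemma pi_r_linear: "pi_r r g (\<lambda>v. c * f v + h v) = (\<lambda>v. c * pi_r r g f v + pi_r r g h v)"
  by (simp add: pi_r_def perm_linear transport_linear)

lemma pi_r_support: "x \<notin> X0 \<Longrightarrow> pi_r r g f x = 0"
  by (simp add: pi_r_def transport_support origin act_in perm_def)

lemma pi_r_outside: "x \<notin> set (path x0 (act g x0)) \<Longrightarrow> pi_r r g f x = perm g f x"
  by (simp add: pi_r_def transport_def turn_outside)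

lemma ip_pi_r:
  assumes "ell2 f" "ell2 h" "\<bar>r\<bar> \<le> 1" "\<And>x. x \<notin> X0 \<Longrightarrow> f x = 0"
  shows "ip (pi_r r g f) (pi_r r g h) = ip f h"
  using assms by (simp add: pi_r_def transport_def ip_turn ell2_perm ip_perm pathD origin act_in)

lemma pi_1_origin: "pi_r 1 g f x0 = f x0"
  by (simp add: pi_r_def transport_1_apply origin act_in perm_def act_inverse)

text \<open>Together with \<open>pi_1_origin\<close>: at \<open>r = 1\<close> the line of
  \<open>\<delta> x0\<close> is a trivial subrepresentation, and the functions vanishing at
  \<open>x0\<close> form an invariant complement.\<close>

lemma pi_1_vanishing:
  assumes "\<And>x. x \<noteq> x0 \<Longrightarrow> f x = 0" "x \<noteq> x0"
  shows "pi_r 1 g f x = 0"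
  unfolding pi_r_def using assms
  by (intro transport_1_vanishing origin act_in) (auto simp: perm_def act_eq_iff origin act_in)

lemma pi_0: "pi_r 0 g f = perm g f"
  by (simp add: pi_r_def transport_0)

lemma perm_edge_coords:
  assumes "z \<in> X0"
  shows "perm g (edge_coords z k) = edge_coords (act g z) (pi1 X1 act g k)"
proof
  fix x
  show "perm g (edge_coords z k) x = edge_coords (act g z) (pi1 X1 act g k) x"
  proof (cases "x \<in> X0 \<and> x \<noteq> act g z")
    case True
    then have "act (- g) x \<noteq> z" using act_eq_iff assms by blast
    then have "act (- g) (par (act g z) x) = par z (act (- g) x)"
      using act_par[of "act g z" x "- g"] True assms by (simp add: act_in act_inverse)
    then show ?thesis
      using True \<open>act (- g) x \<noteq> z\<close> par_props(1)[of "act g z" x] assms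
      by (simp add: perm_def edge_coords_def pi1_def act_in)
  next
    case False
    then show ?thesis using assms by (auto simp: perm_def edge_coords_def act_inverse)
  qed
qed

text \<open>The permutation turns edge coordinates rooted at \<open>x0\<close> into those of the
  translated function rooted at \<open>g x0\<close>; transport at \<open>r = 1\<close> brings the
  root back.\<close>

lemma pi_1_edge_coords:
  assumes "\<And>x y. k (y, x) = - k (x, y)"
  shows "pi_r 1 g (edge_coords x0 k) = edge_coords x0 (pi1 X1 act g k)"
proof -
  have "pi1 X1 act g k (y, x) = - pi1 X1 act g k (x, y)" for x y
    using assms[of "act (- g) y" "act (- g) x"] edge_sym[of x y] edge_sym[of y x] by (auto simp: pi1_def)
  then show ?thesis
    unfolding pi_r_def perm_edge_coords[OF origin] by (rule transport_edge_coords[OF origin act_in[OF origin]])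
qed

text \<open>The conjugate by \<open>g\<close> of the projection onto the complement of \<open>\<delta> x0\<close>, which is what both
  components of the Julg-Valette operator amount to, minus that projection itself. It lives on
  the path from \<open>x0\<close> to \<open>g x0\<close>.\<close>

definition defect :: "real \<Rightarrow> real \<Rightarrow> 'g \<Rightarrow> ('v \<Rightarrow> complex) \<Rightarrow> 'v \<Rightarrow> complex" where
  "defect r' r g f = (\<lambda>x. pi_r r' g ((pi_r r (- g) f)(x0 := 0)) x - (f(x0 := 0)) x)"

lemma defect_eq:
  assumes "\<bar>r\<bar> \<le> 1" "\<And>x. x \<notin> X0 \<Longrightarrow> f x = 0"
  shows "pi_r r' g ((pi_r r (- g) f)(x0 := 0)) =
    transport r' x0 (act g x0) ((transport r (act g x0) x0 f)(act g x0 := 0))"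
proof -
  have 1: "pi_r r (- g) f = perm (- g) (transport r (act g x0) x0 f)"
    by (simp add: pi_r_def perm_transport act_in origin act_inverse)
  have "transport r (act g x0) x0 f x = 0" if "x \<notin> X0" for x
    using transport_support[OF act_in[OF origin] origin that] assms(2)[OF that] by simp
  then have "perm g ((perm (- g) (transport r (act g x0) x0 f))(x0 := 0)) =
      (transport r (act g x0) x0 f)(act g x0 := 0)"
    by (auto simp: perm_def fun_eq_iff act_in act_inverse origin act_eq_iff)
  then show ?thesis unfolding 1 by (simp add: pi_r_def)
qed

lemma defect_linear: "defect r' r g (\<lambda>v. c * f v + h v) = (\<lambda>v. c * defect r' r g f v + defect r' r g h v)"
proof -
  have upd: "(\<lambda>v. c * f v + h v)(x0 := 0) = (\<lambda>v. c * (f(x0 := 0)) v + (h(x0 := 0)) v)"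
    for f h :: "'v \<Rightarrow> complex" by auto
  show ?thesis unfolding defect_def by (simp only: pi_r_linear upd) (simp add: algebra_simps)
qed

text \<open>The rotations and the two erased coordinates, at \<open>x0\<close> and
  \<open>g x0\<close>, all belong to the path, so a function vanishing on the path is left
  untouched.\<close>

lemma defect_vanishing:
  assumes "\<bar>r\<bar> \<le> 1" "\<And>x. x \<notin> X0 \<Longrightarrow> f x = 0" "\<And>x. x \<in> set (path x0 (act g x0)) \<Longrightarrow> f x = 0"
  shows "defect r' r g f = (\<lambda>x. 0)"
proof -
  have p: "set (path (act g x0) x0) = set (path x0 (act g x0))"
    using path_rev[OF origin act_in[OF origin]] by simp
  have f: "f x0 = 0" "f (act g x0) = 0"
    using assms(3) pathD(7,8)[OF origin act_in[OF origin]] by auto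
  have "transport r (act g x0) x0 f = f" "transport r' x0 (act g x0) f = f"
    unfolding transport_def using assms(3) p by (auto intro!: turn_vanishing)
  then have "pi_r r' g ((pi_r r (- g) f)(x0 := 0)) = f"
    using defect_eq[of r f r' g] assms(1,2) f by (simp add: fun_upd_idem)
  then show ?thesis unfolding defect_def using f(1) by (simp add: fun_upd_idem)
qed

text \<open>At \<open>r = 1\<close> the line of \<open>\<delta> x0\<close> and its complement are
  both invariant, so the projection commutes with the action.\<close>

lemma defect_1:
  assumes "\<And>x. x \<notin> X0 \<Longrightarrow> f x = 0"
  shows "defect 1 1 g f = (\<lambda>x. 0)"
proof -
  define z where "z = act g x0"
  have z: "z \<in> X0" by (simp add: z_def act_in origin)
  define h where "h = transport 1 z x0 f"
  have hz: "h z = f x0" unfolding h_def by (rule transport_1_apply[OF z origin])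
  \<comment> \<open>Erasing a coordinate subtracts a multiple of \<open>\<delta> z\<close>, and
    transport at parameter 1 sends \<open>\<delta> z\<close> to \<open>\<delta> x0\<close>.\<close>
  have "h(z := 0) = (\<lambda>v. - f x0 * (if v = z then 1 else 0) + h v)" using hz by auto
  then have "transport 1 x0 z (h(z := 0)) =
      (\<lambda>v. - f x0 * transport 1 x0 z (\<lambda>v. if v = z then 1 else 0) v + f v)"
    using transport_trans[OF origin z origin, of 1 f] transport_self[OF origin]
    by (simp only: transport_linear h_def)
  also have "transport 1 x0 z (\<lambda>v. if v = z then 1 else 0) = (\<lambda>v. if v = x0 then 1 else 0)"
    using transport_1_apply[OF origin z, of "\<lambda>v. if v = z then 1 else 0"]
      transport_1_vanishing[OF origin z, of "\<lambda>v. if v = z then 1 else 0"] by (auto simp: fun_eq_iff)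
  also have "transport 1 x0 z (h(z := 0)) = pi_r 1 g ((pi_r 1 (- g) f)(x0 := 0))"
    using defect_eq[of 1 f 1 g] assms by (simp add: h_def z_def)
  finally show ?thesis by (auto simp: defect_def)
qed

text \<open>By linearity and \<open>defect_vanishing\<close> only the coordinates on the path
  matter: this is the finite rank of the commutator. Two parameters occur because the odd operator
  exchanges parts whose representations have different parameters.\<close>

lemma defect_expansion:
  assumes "\<bar>r\<bar> \<le> 1" "\<And>x. x \<notin> X0 \<Longrightarrow> f x = 0"
  shows "defect r' r g f x =
    (\<Sum>p\<in>set (path x0 (act g x0)). f p * defect r' r g (\<lambda>v. if v = p then 1 else 0) x)"
proof -
  let ?P = "set (path x0 (act g x0))"
  have P: "?P \<subseteq> X0" using pathD(4)[OF origin act_in[OF origin]] .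
  have zero: "defect r' r g (\<lambda>v. 0) = (\<lambda>v. 0)" by (rule defect_vanishing[OF assms(1)]) auto
  have sum: "defect r' r g (\<lambda>v. \<Sum>p\<in>A. f p * (if v = p then 1 else 0)) x =
      (\<Sum>p\<in>A. f p * defect r' r g (\<lambda>v. if v = p then 1 else 0) x)" if "finite A" for A
    using that by (induction A rule: finite_induct) (simp_all add: zero defect_linear)
  have "f = (\<lambda>v. 1 * (if v \<in> ?P then 0 else f v) + (\<Sum>p\<in>?P. f p * (if v = p then 1 else 0)))"
    by (auto simp: fun_eq_iff if_distrib[of "\<lambda>c. _ * c"] cong: if_cong)
  then have "defect r' r g f x =
      defect r' r g (\<lambda>v. 1 * (if v \<in> ?P then 0 else f v) + (\<Sum>p\<in>?P. f p * (if v = p then 1 else 0))) x"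
    by (rule arg_cong)
  also have "\<dots> = 1 * defect r' r g (\<lambda>v. if v \<in> ?P then 0 else f v) x +
      defect r' r g (\<lambda>v. \<Sum>p\<in>?P. f p * (if v = p then 1 else 0)) x"
    by (simp only: defect_linear)
  also have "defect r' r g (\<lambda>v. if v \<in> ?P then 0 else f v) = (\<lambda>x. 0)"
    by (rule defect_vanishing[OF assms(1)]) (use assms(2) in auto)
  finally show ?thesis by (simp add: sum)
qed

end


lemma ell2_slice:
  assumes "ell2 (f :: 'v \<times> bool \<Rightarrow> complex)"
  shows "ell2 (\<lambda>y. f (y, b))"
proof -
  have "(\<lambda>i. (cmod (f i))\<^sup>2) summable_on range (\<lambda>y. (y, b))"
    using assms unfolding ell2_def by (rule summable_on_subset_banach) simp
  then show ?thesis
    unfolding ell2_def by (subst (asm) summable_on_reindex) (auto simp: o_def inj_on_def)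
qed

lemma ip_slices:
  fixes f h :: "'v \<times> bool \<Rightarrow> complex"
  assumes "ell2 f" "ell2 h"
  shows "ip f h = ip (\<lambda>y. f (y, True)) (\<lambda>y. h (y, True)) + ip (\<lambda>y. f (y, False)) (\<lambda>y. h (y, False))"
proof -
  have "(UNIV :: ('v \<times> bool) set) = range (\<lambda>y. (y, True)) \<union> range (\<lambda>y. (y, False))"
    by (auto simp: image_iff)
  then have "ip f h = (\<Sum>\<^sub>\<infinity>i\<in>range (\<lambda>y. (y, True)) \<union> range (\<lambda>y. (y, False)). cnj (f i) * h i)"
    by (simp add: ip_def)
  also have "\<dots> = (\<Sum>\<^sub>\<infinity>i\<in>range (\<lambda>y. (y, True)). cnj (f i) * h i) +
      (\<Sum>\<^sub>\<infinity>i\<in>range (\<lambda>y. (y, False)). cnj (f i) * h i)"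
    using assms by (intro infsum_Un_disjoint ell2_summable_ip) auto
  finally show ?thesis by (simp add: infsum_reindex inj_on_def o_def ip_def)
qed


section \<open>The deformed cycles\<close>

text \<open>
  Index \<open>(x, True)\<close> stands for the vertex \<open>x\<close>, index \<open>(x, False)\<close> with \<open>x \<noteq> x0\<close> for the edge from
  \<open>x\<close> towards \<open>x0\<close>. The even part carries the representation with parameter \<open>r t\<close>, the odd part the one
  with parameter \<open>1\<close>. Where the cutoff \<open>cf\<close> vanishes, the fibre is reduced to the line of \<open>\<delta> x0\<close>, which
  is invariant because \<open>r t = 1\<close> there.
\<close>

context tree_action
begin

definition model_support :: "real set \<Rightarrow> (real \<Rightarrow> real) \<Rightarrow> (real \<times> 'v \<times> bool) set" where
  "model_support T cf = {(t, x, b). t \<in> T \<and> x \<in> X0 \<and> (if x = x0 then b else cf t \<noteq> 0)}"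

definition level :: "(real \<Rightarrow> real) \<Rightarrow> bool \<Rightarrow> real \<Rightarrow> real" where
  "level r b t = (if b then r t else 1)"

text \<open>The operator only exchanges the two copies: \<open>F\<close> sends
  \<open>\<delta> x\<close> to the edge from \<open>x\<close> towards \<open>x0\<close>, which
  carries the same index \<open>x\<close>.\<close>

definition model :: "real set \<Rightarrow> (real \<Rightarrow> real) \<Rightarrow> (real \<Rightarrow> real)
    \<Rightarrow> ('g, real \<Rightarrow> 'v \<times> bool \<Rightarrow> complex) kcycle" where
  "model T r cf = \<lparr>
    carr = {\<xi>. (\<forall>t i. (t, i) \<notin> model_support T cf \<longrightarrow> \<xi> t i = 0) \<and>
      (\<forall>i. continuous_on T (\<lambda>t. \<xi> t i)) \<and> small_tails T \<xi>},
    smul = (\<lambda>f \<xi> t i. f t * \<xi> t i),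
    inn = (\<lambda>\<xi> \<eta> t. ip (\<xi> t) (\<eta> t)),
    grad = (\<lambda>\<xi> t i. if snd i then \<xi> t i else - \<xi> t i),
    rep = (\<lambda>g \<xi> t i. pi_r (level r (snd i) t) g (\<lambda>y. \<xi> t (y, snd i)) (fst i)),
    phi = (\<lambda>a \<xi> t i. a * \<xi> t i),
    oper = (\<lambda>\<xi> t i. if fst i = x0 then 0 else \<xi> t (fst i, \<not> snd i))\<rparr>"

end

text \<open>The alternative \<open>cutoff\<close> serves twice. Where \<open>cf\<close> vanishes,
  \<open>r = 1\<close> keeps the remaining line invariant. Where \<open>cf\<close> differs from 1,
  \<open>r = 1\<close> makes the defect vanish, so that finite rank is at stake only where all
  admissible weights are 1.\<close>

locale deformation = tree_action X0 X1 act x0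
  for X0 :: "'v set" and X1 and act :: "'g::topological_group_add \<Rightarrow> 'v \<Rightarrow> 'v" and x0 +
  fixes T :: "real set" and r cf :: "real \<Rightarrow> real"
  assumes vertices_countable: "countable X0"
    and base_compact: "compact T" and base_inhabited: "T \<noteq> {}"
    and r_continuous: "continuous_on T r" and r_le: "\<bar>r t\<bar> \<le> 1"
    and cutoff_continuous: "continuous_on T cf" and cutoff: "t \<in> T \<Longrightarrow> cf t = 1 \<or> r t = 1"
begin

abbreviation M where "M \<equiv> model T r cf"

sublocale l2_module T "model_support T cf" M
  by standard (auto simp: base_compact base_inhabited model_support_def model_def)

lemma level_le: "\<bar>level r b t\<bar> \<le> 1"
  using r_le by (simp add: level_def)

lemma level_continuous: "continuous_on T (level r b)"
  using r_continuous by (cases b) (simp_all add: level_def cong: continuous_on_cong)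

lemma rep_slice: "(\<lambda>y. rep M g \<xi> t (y, b)) = pi_r (level r b t) g (\<lambda>y. \<xi> t (y, b))"
  by (simp add: model_def)

lemma rep_apply: "rep M g \<xi> t (x, b) = pi_r (level r b t) g (\<lambda>y. \<xi> t (y, b)) x"
  by (simp add: model_def)

lemma oper_slice: "(\<lambda>y. oper M \<xi> t (y, b)) = (\<lambda>y. \<xi> t (y, \<not> b))(x0 := 0)"
  by (auto simp: model_def)

lemma oper_apply: "oper M \<xi> t (x, b) = (if x = x0 then 0 else \<xi> t (x, \<not> b))"
  by (simp add: model_def)

lemma phi_smul: "phi M a = smul M (\<lambda>t. a)"
  by (simp add: model_def)

lemma carr_vertices: "\<xi> \<in> carr M \<Longrightarrow> x \<notin> X0 \<Longrightarrow> \<xi> t (x, b) = 0"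
  by (rule carrD(1)) (auto simp: model_support_def)

lemma carr_origin: "\<xi> \<in> carr M \<Longrightarrow> \<xi> t (x0, False) = 0"
  by (rule carrD(1)) (auto simp: model_support_def)

lemma carr_outside_base: "\<xi> \<in> carr M \<Longrightarrow> t \<notin> T \<Longrightarrow> \<xi> t i = 0"
  by (rule carrD(1)) (auto simp: model_support_def)

lemma phi_closed: "\<xi> \<in> carr M \<Longrightarrow> phi M a \<xi> \<in> carr M"
  unfolding phi_smul by (intro smul_closed) auto

lemma grad_closed:
  assumes "\<xi> \<in> carr M"
  shows "grad M \<xi> \<in> carr M"
proof (rule carrI)
  show "(t, i) \<notin> model_support T cf \<Longrightarrow> grad M \<xi> t i = 0" for t i
    using carrD(1)[OF assms, of t i] by (simp add: model_def)
  show "continuous_on T (\<lambda>t. grad M \<xi> t i)" for i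
    using carrD(2)[OF assms, of i] by (cases "snd i") (auto simp: model_def intro: continuous_on_minus)
  show "small_tails T (grad M \<xi>)"
    by (rule small_tails_le[OF carrD(3)[OF assms], of _ 1]) (simp add: model_def)
qed

lemma oper_closed:
  assumes "\<xi> \<in> carr M"
  shows "oper M \<xi> \<in> carr M"
proof (rule carrI)
  show "oper M \<xi> t i = 0" if "(t, i) \<notin> model_support T cf" for t i
    using carrD(1)[OF assms, of t "(fst i, \<not> snd i)"] that
    by (cases i) (auto simp: model_def model_support_def)
  show "continuous_on T (\<lambda>t. oper M \<xi> t i)" for i
    using carrD(2)[OF assms, of "(fst i, \<not> snd i)"] by (cases "fst i = x0") (auto simp: model_def)
  show "small_tails T (oper M \<xi>)"
  proof (rule small_tails_dominated[OF carrD(3)[OF assms], of "{}" "\<lambda>i. (fst i, \<not> snd i)" UNIV _ 1])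
    show "inj (\<lambda>i :: 'v \<times> bool. (fst i, \<not> snd i))" by (auto simp: inj_on_def prod_eq_iff)
  qed (simp_all add: model_def)
qed

lemma rep_closed:
  assumes "\<xi> \<in> carr M"
  shows "rep M g \<xi> \<in> carr M"
proof (rule carrI)
  fix t and i :: "'v \<times> bool"
  obtain x b where i: "i = (x, b)" by (cases i)
  show "rep M g \<xi> t i = 0" if D: "(t, i) \<notin> model_support T cf"
  proof (cases "t \<in> T \<and> x \<in> X0")
    case False
    \<comment> \<open>Linearity with coefficient -1, applied to zero functions, says that 0 is sent
      to 0.\<close>
    have "pi_r (level r b t) g (\<lambda>y. 0) x = 0"
      using pi_r_linear[of "level r b t" g "-1" "\<lambda>y. 0" "\<lambda>y. 0"] by (simp add: fun_eq_iff)
    then show ?thesis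
      using False pi_r_support carr_outside_base[OF assms, of t] by (auto simp: i rep_apply)
  next
    case True
    show ?thesis
    proof (cases "x = x0")
      case True
      then have "\<not> b" using D \<open>t \<in> T \<and> x \<in> X0\<close> by (auto simp: i model_support_def)
      then show ?thesis using True carr_origin[OF assms] by (simp add: i rep_apply level_def pi_1_origin)
    next
      case False
      \<comment> \<open>Here the fibre is the line of \<open>\<delta> x0\<close> and both parts have
        parameter 1, so the action stays on that line.\<close>
      then have "cf t = 0" using D True by (auto simp: i model_support_def)
      then have "level r b t = 1" using cutoff[of t] True by (auto simp: level_def)
      moreover have "\<xi> t (y, b) = 0" if "y \<noteq> x0" for y
        using that \<open>cf t = 0\<close> by (intro carrD(1)[OF assms]) (simp add: model_support_def)
      ultimately show ?thesis using False by (simp add: i rep_apply pi_1_vanishing)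
    qed
  qed
  have "continuous_on T (\<lambda>t. perm g (\<lambda>y. \<xi> t (y, b)) y)" for y
    using carrD(2)[OF assms, of "(act (- g) y, b)"] by (cases "y \<in> X0") (auto simp: perm_def)
  then show "continuous_on T (\<lambda>t. rep M g \<xi> t i)"
    unfolding i rep_apply pi_r_def transport_def by (intro continuous_on_turn level_continuous)
next
  \<comment> \<open>Off the finite path the action merely permutes coordinates.\<close>
  let ?P = "set (path x0 (act g x0)) \<times> (UNIV :: bool set)"
  show "small_tails T (rep M g \<xi>)"
  proof (rule small_tails_dominated[OF carrD(3)[OF assms], of ?P "\<lambda>i. (act (- g) (fst i), snd i)" "X0 \<times> UNIV" _ 1])
    show "inj_on (\<lambda>i :: 'v \<times> bool. (act (- g) (fst i), snd i)) (X0 \<times> UNIV)"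
      using inj_onD[OF act_inj[of "- g"]] by (auto simp: inj_on_def)
    fix t and i :: "'v \<times> bool" assume "i \<notin> ?P" "rep M g \<xi> t i \<noteq> 0"
    moreover obtain x b where i: "i = (x, b)" by (cases i)
    ultimately show "i \<in> X0 \<times> UNIV \<and> cmod (rep M g \<xi> t i) \<le> 1 * cmod (\<xi> t (act (- g) (fst i), snd i))"
      by (auto simp: i rep_apply pi_r_outside perm_def split: if_splits)
  qed simp
qed

lemma rep_add: "rep M (g + h) \<xi> = rep M g (rep M h \<xi>)"
  by (simp add: fun_eq_iff rep_apply rep_slice pi_r_add level_le)

lemma rep_zero:
  assumes "\<xi> \<in> carr M"
  shows "rep M 0 \<xi> = \<xi>"
  using carr_vertices[OF assms] by (simp add: fun_eq_iff rep_apply pi_r_zero)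

lemma rep_inverse: "\<xi> \<in> carr M \<Longrightarrow> rep M g (rep M (- g) \<xi>) = \<xi>"
  using rep_add[of g "- g" \<xi>] rep_zero[of \<xi>] by simp

lemma rep_diff: "rep M g (\<xi> - \<eta>) = rep M g \<xi> - rep M g \<eta>"
proof -
  have "pi_r s g (\<lambda>y. \<xi> t (y, b) - \<eta> t (y, b)) x = pi_r s g (\<lambda>y. \<xi> t (y, b)) x - pi_r s g (\<lambda>y. \<eta> t (y, b)) x"
    for s t b x
    using pi_r_linear[of s g "-1" "\<lambda>y. \<eta> t (y, b)" "\<lambda>y. \<xi> t (y, b)"] by (simp add: fun_eq_iff)
  then show ?thesis by (simp add: fun_eq_iff rep_apply)
qed

lemma rep_smul: "rep M g (smul M f \<xi>) = smul M f (rep M g \<xi>)"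
proof -
  have "pi_r s g (\<lambda>y. a * h y) x = a * pi_r s g h x" for s a h x
    using pi_r_linear[of s g a h "\<lambda>y. 0"] pi_r_linear[of s g "-1" "\<lambda>y. 0" "\<lambda>y. 0"]
    by (simp add: fun_eq_iff)
  then show ?thesis by (simp add: fun_eq_iff rep_apply smul_eq)
qed

lemma inn_rep:
  assumes "\<xi> \<in> carr M" "\<eta> \<in> carr M" "t \<in> T"
  shows "inn M (rep M g \<xi>) (rep M g \<eta>) t = inn M \<xi> \<eta> t"
  using assms carr_vertices[OF assms(1)]
  by (simp add: inn_eq ip_slices rep_closed carr_ell2 rep_slice ip_pi_r level_le ell2_slice)

lemma rep_adjoint: "is_adjoint T M (rep M g) (rep M (- g))"
  unfolding is_adjoint_def
proof (intro conjI ballI)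
  fix \<xi> \<eta> t assume "\<xi> \<in> carr M" "\<eta> \<in> carr M" "t \<in> T"
  then show "inn M (rep M g \<xi>) \<eta> t = inn M \<xi> (rep M (- g) \<eta>) t"
    using inn_rep[of \<xi> "rep M (- g) \<eta>" t g] by (simp add: rep_closed rep_inverse)
qed (use rep_closed in auto)

lemma hnorm_rep: "\<xi> \<in> carr M \<Longrightarrow> hnorm T M (rep M g \<xi>) = hnorm T M \<xi>"
  unfolding hnorm_def by (intro SUP_cong refl) (simp add: inn_rep)

lemma bij_flip: "bij (\<lambda>i :: 'v \<times> bool. (fst i, \<not> snd i))"
  by (rule o_bij[of "\<lambda>i. (fst i, \<not> snd i)"]) (auto simp: fun_eq_iff)

lemma oper_adjoint: "is_adjoint T M (oper M) (oper M)"
  unfolding is_adjoint_def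
proof (intro conjI ballI)
  fix \<xi> \<eta> t assume "\<xi> \<in> carr M" "\<eta> \<in> carr M" "t \<in> T"
  have "ip (oper M \<xi> t) (\<eta> t) =
      (\<Sum>\<^sub>\<infinity>i. cnj (oper M \<xi> t (fst i, \<not> snd i)) * \<eta> t (fst i, \<not> snd i))"
    unfolding ip_def by (rule infsum_reindex_bij_betw[OF bij_flip, symmetric])
  also have "\<dots> = ip (\<xi> t) (oper M \<eta> t)"
    unfolding ip_def by (intro infsum_cong) (auto simp: model_def)
  finally show "inn M (oper M \<xi>) \<eta> t = inn M \<xi> (oper M \<eta>) t" by (simp add: inn_eq)
qed (use oper_closed in auto)

lemma oper_smul: "oper M (smul M f \<xi>) = smul M f (oper M \<xi>)"
  by (simp add: model_def fun_eq_iff)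

text \<open>A constant non-zero section at a vertex other than \<open>x0\<close> lies in the module
  only if \<open>cf\<close> has no zero on \<open>T\<close>; multiplied by \<open>cf\<close> it
  always does.\<close>

definition weight :: "'v \<times> bool \<Rightarrow> real \<Rightarrow> complex" where
  "weight i t = (if fst i \<notin> X0 then 0 else if fst i = x0 then of_bool (snd i) else complex_of_real (cf t))"

lemma weight_continuous: "continuous_on T (weight i)"
  unfolding weight_def using cutoff_continuous
  by (cases "fst i \<in> X0"; cases "fst i = x0") (auto intro!: continuous_intros)

lemma weight_support: "(t, i) \<in> model_support T cf \<longleftrightarrow> t \<in> T \<and> weight i t \<noteq> 0"
  using origin by (cases i) (auto simp: model_support_def weight_def)

definition basis :: "'v \<times> bool \<Rightarrow> real \<Rightarrow> 'v \<times> bool \<Rightarrow> complex" where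
  "basis i = single i (weight i)"

lemma basis_closed: "basis i \<in> carr M"
  unfolding basis_def by (rule single_closed[OF weight_continuous]) (simp add: weight_support)

lemma inn_basis: "t \<in> T \<Longrightarrow> inn M (basis i) \<xi> t = cnj (weight i t) * \<xi> t i"
  unfolding basis_def by (rule inn_single)

lemma model_countably_generated: "countably_generated T M"
proof (rule weights_countably_generated[OF weight_continuous weight_support])
  show "countable (X0 \<times> (UNIV :: bool set))" using vertices_countable by simp
qed (auto simp: model_support_def)

text \<open>Write \<open>h = g + k\<close>; unitarity reduces the claim to \<open>k\<close> near 0.
  If \<open>k\<close> fixes \<open>x0\<close>, its action is a plain permutation at every
  \<open>t\<close>, and if it also fixes the vertices below \<open>S\<close>, only tails
  move.\<close>

lemma rep_continuous:
  assumes x: "\<xi> \<in> carr M"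
  shows "((\<lambda>h. hnorm T M (rep M h \<xi> - rep M g \<xi>)) \<longlongrightarrow> 0) (at g)"
proof (rule tendstoI)
  fix e :: real assume "e > 0"
  then obtain S where S: "finite S"
    "\<And>t F. t \<in> T \<Longrightarrow> finite F \<Longrightarrow> F \<inter> S = {} \<Longrightarrow> (\<Sum>i\<in>F. (cmod (\<xi> t i))\<^sup>2) \<le> (e / 4)\<^sup>2"
    using small_tailsE[OF carrD(3)[OF x], of "(e / 4)\<^sup>2"] by auto
  \<comment> \<open>\<open>x0\<close> is included so that no rotation occurs; the other vertices
    carry all but a tail of \<open>\<xi>\<close>. Their common stabilizer is open because
    \<open>V\<close> is finite.\<close>
  define V where "V = insert x0 (fst ` S \<inter> X0)"
  have V: "finite V" "V \<subseteq> X0" using S(1) origin by (auto simp: V_def)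
  define U where "U = (\<Inter>v\<in>V. {k. act k v = v})"
  have "open U" unfolding U_def using V act_open by (intro open_INT) auto
  then have "open ((\<lambda>h. - g + h) -` U)"
    by (intro open_vimage continuous_intros)
  moreover have "g \<in> (\<lambda>h. - g + h) -` U" using V(2) act_zero by (auto simp: U_def)
  moreover have "dist (hnorm T M (rep M h \<xi> - rep M g \<xi>)) 0 < e" if "- g + h \<in> U" for h
  proof -
    define k where "k = - g + h"
    have k: "act k v = v" if "v \<in> V" for v
      using \<open>- g + h \<in> U\<close> that by (auto simp: U_def k_def)
    have k': "act (- k) v = v" if "v \<in> V" for v
      using k[OF that] act_inverse(1)[of v k] that V(2) by auto
    have "h = g + k" by (simp add: k_def add.assoc[symmetric])
    then have "rep M h \<xi> - rep M g \<xi> = rep M g (rep M k \<xi> - \<xi>)" by (simp add: rep_add rep_diff)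
    then have "hnorm T M (rep M h \<xi> - rep M g \<xi>) = hnorm T M (rep M k \<xi> - \<xi>)"
      using x by (simp add: hnorm_rep diff_closed rep_closed)
    also have "\<dots> \<le> e / 2"
    proof (rule hnorm_leI_sums)
      fix t and F :: "('v \<times> bool) set" assume t: "t \<in> T" and F: "finite F"
      define \<sigma> where "\<sigma> = (\<lambda>i :: 'v \<times> bool. (act (- k) (fst i), snd i))"
      have rep_k: "rep M k \<xi> t i = (if fst i \<in> X0 then \<xi> t (\<sigma> i) else 0)" for i
        using k[of x0] by (cases i) (simp add: rep_apply pi_r_stabilizer perm_def V_def \<sigma>_def)
      define F' where "F' = {i \<in> F. fst i \<in> X0 \<and> fst i \<notin> V}"
      have F': "finite F'" "F' \<inter> S = {}" using F by (auto simp: F'_def V_def)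
      \<comment> \<open>If \<open>k\<close> carried a vertex outside \<open>V\<close> to or from one
        in \<open>V\<close>, it would not fix the latter.\<close>
      have \<sigma>S: "\<sigma> ` F' \<inter> S = {}"
      proof -
        have "fst i \<in> V" if "i \<in> F'" "\<sigma> i \<in> S" for i
        proof -
          have i: "fst i \<in> X0" using that by (simp add: F'_def)
          have "act (- k) (fst i) \<in> V"
            using that act_in[OF i, of "- k"] by (force simp: V_def \<sigma>_def)
          then have "act k (act (- k) (fst i)) = act (- k) (fst i)" by (rule k)
          then show ?thesis using act_inverse(2)[OF i, of k] \<open>act (- k) (fst i) \<in> V\<close> by simp
        qed
        then show ?thesis unfolding F'_def by blast
      qed
      have inj: "inj_on \<sigma> F'"
        using inj_onD[OF act_inj[of "- k"]] by (auto simp: inj_on_def \<sigma>_def F'_def prod_eq_iff)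
      have "(\<Sum>i\<in>F. (cmod ((rep M k \<xi> - \<xi>) t i))\<^sup>2) = (\<Sum>i\<in>F'. (cmod (\<xi> t (\<sigma> i) + - \<xi> t i))\<^sup>2)"
      proof (rule sum.mono_neutral_cong_right)
        show "\<forall>i\<in>F - F'. (cmod ((rep M k \<xi> - \<xi>) t i))\<^sup>2 = 0"
          using carr_vertices[OF x] k' by (auto simp: F'_def rep_k \<sigma>_def)
      qed (use F in \<open>auto simp: F'_def rep_k\<close>)
      also have "\<dots> \<le> (\<Sum>i\<in>F'. 2 * (cmod (\<xi> t (\<sigma> i)))\<^sup>2 + 2 * (cmod (- \<xi> t i))\<^sup>2)"
        by (intro sum_mono cmod_add_power2_le)
      also have "\<dots> = 2 * (\<Sum>i\<in>\<sigma> ` F'. (cmod (\<xi> t i))\<^sup>2) + 2 * (\<Sum>i\<in>F'. (cmod (\<xi> t i))\<^sup>2)"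
        using inj by (simp add: sum.distrib sum_distrib_left sum.reindex)
      also have "\<dots> \<le> 2 * (e / 4)\<^sup>2 + 2 * (e / 4)\<^sup>2"
        using S(2)[OF t _ \<sigma>S] S(2)[OF t F'] F'(1) by (intro add_mono mult_left_mono) auto
      also have "\<dots> = (e / 2)\<^sup>2" by (simp add: power_divide)
      finally show "(\<Sum>i\<in>F. (cmod ((rep M k \<xi> - \<xi>) t i))\<^sup>2) \<le> (e / 2)\<^sup>2" .
    qed (use x \<open>e > 0\<close> in \<open>auto intro: diff_closed rep_closed\<close>)
    finally show ?thesis
      using \<open>e > 0\<close> hnorm_nonneg[of "rep M h \<xi> - rep M g \<xi>"] x by (simp add: diff_closed rep_closed)
  qed
  ultimately show "\<forall>\<^sub>F h in at g. dist (hnorm T M (rep M h \<xi> - rep M g \<xi>)) 0 < e"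
    unfolding eventually_at_topological by (metis vimageE)
qed

lemma oper_rep_stabilizer:
  assumes "act k x0 = x0" "\<xi> \<in> carr M"
  shows "rep M k (oper M \<xi>) = oper M (rep M k \<xi>)"
proof -
  have "act (- k) x = x0 \<longleftrightarrow> x = x0" if "x \<in> X0" for x
    using act_eq_iff[OF that origin, of k] assms(1) by simp
  then show ?thesis
    using assms(1) by (auto simp: fun_eq_iff rep_apply oper_apply oper_slice pi_r_stabilizer perm_def)
qed

text \<open>The operator depends on the origin alone and so commutes with the open stabilizer of
  \<open>x0\<close>. Its conjugates are therefore constant on cosets of that stabilizer, and norm
  continuity follows.\<close>

lemma oper_conjugate_locally_constant:
  assumes "act (- g + h) x0 = x0" "\<xi> \<in> carr M"
  shows "rep M h (oper M (rep M (- h) \<xi>)) = rep M g (oper M (rep M (- g) \<xi>))"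
proof -
  define k where "k = - g + h"
  have h: "h = g + k" by (simp add: k_def add.assoc[symmetric])
  have "rep M h (oper M (rep M (- h) \<xi>)) = rep M g (rep M k (oper M (rep M (- k) (rep M (- g) \<xi>))))"
    unfolding h minus_add rep_add by simp
  also have "rep M k (oper M (rep M (- k) (rep M (- g) \<xi>))) = oper M (rep M (- g) \<xi>)"
    using assms oper_rep_stabilizer[of k "rep M (- k) (rep M (- g) \<xi>)"]
    by (simp add: rep_closed rep_inverse flip: k_def)
  finally show ?thesis .
qed

lemma norm_continuous_oper_conjugates:
  assumes "\<And>g \<xi>. \<xi> \<in> carr M \<Longrightarrow> A g \<xi> = smul M (\<lambda>t. a) (rep M g (oper M (rep M (- g) \<xi>)))"
  shows "norm_continuous T M A"
  unfolding norm_continuous_def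
proof (intro allI impI)
  fix g and e :: real assume "e > 0"
  define U where "U = (\<lambda>h. - g + h) -` {k. act k x0 = x0}"
  have "open U" unfolding U_def by (intro open_vimage continuous_intros act_open origin)
  moreover have "g \<in> U" using act_zero origin by (simp add: U_def)
  moreover have "op_close T M (A h) (A g) e" if "h \<in> U" for h
    unfolding op_close_def using that \<open>e > 0\<close>
    by (auto simp: U_def assms oper_conjugate_locally_constant[of g h] hnorm_zero hnorm_nonneg)
  ultimately show "\<forall>\<^sub>F h in nhds g. op_close T M (A h) (A g) e"
    unfolding eventually_nhds by blast
qed

definition oper_defect :: "'g \<Rightarrow> (real \<Rightarrow> 'v \<times> bool \<Rightarrow> complex) \<Rightarrow> real \<Rightarrow> 'v \<times> bool \<Rightarrow> complex" where
  "oper_defect g \<xi> = rep M g (oper M (rep M (- g) \<xi>)) - oper M \<xi>"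

lemma oper_defect_closed: "\<xi> \<in> carr M \<Longrightarrow> oper_defect g \<xi> \<in> carr M"
  unfolding oper_defect_def by (intro diff_closed rep_closed oper_closed)

lemma oper_defect_apply:
  "oper_defect g \<xi> t (x, b) = defect (level r b t) (level r (\<not> b) t) g (\<lambda>y. \<xi> t (y, \<not> b)) x"
  by (simp add: oper_defect_def defect_def rep_apply oper_slice rep_slice) (simp add: oper_apply)

lemma oper_defect_basis:
  assumes "t \<in> T"
  shows "oper_defect g (basis (p, c)) t (x, b) = (if c = b then 0 else
    weight (p, c) t * defect (level r b t) (level r (\<not> b) t) g (\<lambda>v. if v = p then 1 else 0) x)"
proof -
  have zero: "defect s' s g (\<lambda>v. 0) x = 0" for s' s
    using defect_linear[of s' s g "-1" "\<lambda>v. 0" "\<lambda>v. 0"] by (simp add: fun_eq_iff)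
  have "(\<lambda>y. basis (p, c) t (y, \<not> b)) =
      (if c = b then (\<lambda>y. 0) else (\<lambda>y. weight (p, c) t * (if y = p then 1 else 0) + 0))"
    using assms by (auto simp: basis_def single_def fun_eq_iff)
  then show ?thesis
    unfolding oper_defect_apply using zero by (auto simp only: defect_linear split: if_splits) simp_all
qed

text \<open>One rank-one operator for each index over the path, with the same vectors for all
  \<open>t\<close>. Both factors carry a weight, so the identity must not depend on dividing by
  it.\<close>

lemma oper_defect_finite_rank:
  assumes "\<xi> \<in> carr M"
  shows "oper_defect g \<xi> = (\<Sum>i\<in>set (path x0 (act g x0)) \<times> UNIV.
    rank_one M (oper_defect g (basis i)) (basis i) \<xi>)"
proof (intro ext)
  fix t and i :: "'v \<times> bool"
  obtain x b where i: "i = (x, b)" by (cases i)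
  let ?P = "set (path x0 (act g x0))"
  let ?d = "\<lambda>p. defect (level r b t) (level r (\<not> b) t) g (\<lambda>v. if v = p then 1 else 0) x"
  have P: "?P \<subseteq> X0" using pathD(4)[OF origin act_in[OF origin]] .
  have rhs: "(\<Sum>i\<in>?P \<times> UNIV. rank_one M (oper_defect g (basis i)) (basis i) \<xi>) t (x, b) =
      (\<Sum>i\<in>?P \<times> UNIV. inn M (basis i) \<xi> t * oper_defect g (basis i) t (x, b))"
    unfolding rank_one_def by (rule sum_smul_apply)
  show "oper_defect g \<xi> t i = (\<Sum>i\<in>?P \<times> UNIV. rank_one M (oper_defect g (basis i)) (basis i) \<xi>) t i"
  proof (cases "t \<in> T")
    case False
    then show ?thesis
      unfolding i rhs using oper_defect_closed basis_closed assms by (simp add: carr_outside_base)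
  next
    case True
    \<comment> \<open>For \<open>r t = 1\<close> both sides are 0. Otherwise
      \<open>cf t = 1\<close>, and the only index over the path without weight 1 is
      \<open>(x0, False)\<close>, where \<open>\<xi>\<close> vanishes.\<close>
    have coeff: "\<xi> t (p, \<not> b) * ?d p = inn M (basis (p, \<not> b)) \<xi> t * oper_defect g (basis (p, \<not> b)) t (x, b)"
      if p: "p \<in> ?P" for p
    proof (cases "r t = 1")
      case True
      have "?d p = 0"
      proof -
        have "defect 1 1 g (\<lambda>v. if v = p then 1 else 0) = (\<lambda>x. 0)"
          by (rule defect_1) (use P p in auto)
        then show ?thesis using True by (simp add: level_def)
      qed
      then show ?thesis using \<open>t \<in> T\<close> by (simp add: oper_defect_basis)
    next
      case False
      then have "cf t = 1" using cutoff True by blast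
      then have "weight (p, \<not> b) t = 1 \<or> \<xi> t (p, \<not> b) = 0"
        using p P carr_origin[OF assms, of t] by (auto simp: weight_def)
      then show ?thesis
        using True by (auto simp: oper_defect_basis inn_basis)
    qed
    have "(\<Sum>i\<in>?P \<times> UNIV. inn M (basis i) \<xi> t * oper_defect g (basis i) t (x, b)) =
        (\<Sum>p\<in>?P. \<Sum>c\<in>UNIV. inn M (basis (p, c)) \<xi> t * oper_defect g (basis (p, c)) t (x, b))"
      by (simp add: sum.cartesian_product)
    also have "\<dots> = (\<Sum>p\<in>?P. inn M (basis (p, \<not> b)) \<xi> t * oper_defect g (basis (p, \<not> b)) t (x, b))"
      using True by (cases b) (simp_all add: UNIV_bool oper_defect_basis)
    also have "\<dots> = (\<Sum>p\<in>?P. \<xi> t (p, \<not> b) * ?d p)" by (intro sum.cong refl coeff[symmetric])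
    also have "\<dots> = oper_defect g \<xi> t (x, b)"
      unfolding oper_defect_apply
      using carr_vertices[OF assms] by (intro defect_expansion[symmetric] level_le) auto
    finally show ?thesis unfolding i rhs by simp
  qed
qed

lemma phi_adjoint: "is_adjoint T M (phi M a) (phi M (cnj a))"
  unfolding is_adjoint_def phi_smul by (auto simp: smul_closed inn_smul inn_smul_left)

lemma oper_equivariant:
  "compact_op T M (\<lambda>\<xi>. rep M g (oper M (rep M (- g) (phi M a \<xi>))) - oper M (phi M a \<xi>))"
proof (rule compact_op_finite_rank)
  show "adjointable T M (\<lambda>\<xi>. rep M g (oper M (rep M (- g) (phi M a \<xi>))) - oper M (phi M a \<xi>))"
    unfolding adjointable_def
    by (rule exI, rule is_adjoint_diff[OF is_adjoint_compose[OF rep_adjoint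
          is_adjoint_compose[OF oper_adjoint is_adjoint_compose[OF rep_adjoint phi_adjoint]]]
          is_adjoint_compose[OF oper_adjoint phi_adjoint]])
  show "finite (set (path x0 (act g x0)) \<times> (UNIV :: bool set))" by simp
  show "oper_defect g (basis i) \<in> carr M \<and> phi M (cnj a) (basis i) \<in> carr M" for i
    using oper_defect_closed basis_closed phi_closed by blast
  fix \<xi> assume x: "\<xi> \<in> carr M"
  \<comment> \<open>The scalar \<open>a\<close> is absorbed, conjugated, into the second
    vector.\<close>
  have "rank_one M (oper_defect g (basis i)) (basis i) (phi M a \<xi>) =
      rank_one M (oper_defect g (basis i)) (phi M (cnj a) (basis i)) \<xi>" for i
    unfolding rank_one_def phi_smul using x basis_closed[of i]
    by (intro smul_cong inn_continuous oper_defect_closed) (auto simp: inn_smul inn_smul_left smul_closed)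
  then show "rep M g (oper M (rep M (- g) (phi M a \<xi>))) - oper M (phi M a \<xi>) =
      (\<Sum>i\<in>set (path x0 (act g x0)) \<times> UNIV.
        rank_one M (oper_defect g (basis i)) (phi M (cnj a) (basis i)) \<xi>)"
    using oper_defect_finite_rank[OF phi_closed[OF x], of g a] by (simp add: oper_defect_def)
qed

text \<open>Exchanging the copies twice restores everything except the even coordinate at
  \<open>x0\<close>, which the operator kills; the difference is \<open>- a\<close> times a rank-one
  projection.\<close>

lemma oper_square: "compact_op T M (\<lambda>\<xi>. oper M (oper M (phi M a \<xi>)) - phi M a \<xi>)"
proof (rule compact_op_finite_rank)
  let ?b = "basis (x0, True)"
  show "adjointable T M (\<lambda>\<xi>. oper M (oper M (phi M a \<xi>)) - phi M a \<xi>)"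
    unfolding adjointable_def
    by (rule exI, rule is_adjoint_diff[OF is_adjoint_compose[OF oper_adjoint
          is_adjoint_compose[OF oper_adjoint phi_adjoint]] phi_adjoint])
  show "finite {()}" by simp
  show "phi M (- a) ?b \<in> carr M \<and> ?b \<in> carr M" using basis_closed phi_closed by blast
  fix \<xi> assume x: "\<xi> \<in> carr M"
  show "oper M (oper M (phi M a \<xi>)) - phi M a \<xi> = (\<Sum>i\<in>{()}. rank_one M (phi M (- a) ?b) ?b \<xi>)"
  proof (intro ext)
    fix t and i :: "'v \<times> bool"
    obtain y b where i: "i = (y, b)" by (cases i)
    show "(oper M (oper M (phi M a \<xi>)) - phi M a \<xi>) t i = (\<Sum>i\<in>{()}. rank_one M (phi M (- a) ?b) ?b \<xi>) t i"
      using x carr_outside_base[OF x, of t] carr_origin[OF x, of t] origin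
      by (cases "t \<in> T"; cases b)
        (auto simp: i oper_apply phi_smul smul_eq rank_one_def basis_def inn_single, auto simp: single_def weight_def)
  qed
qed

lemma model_kasparov_cycle: "kasparov_cycle T M"
proof
  show "countably_generated T M" by (fact model_countably_generated)
  show "is_adjoint T M (grad M) (grad M)"
    unfolding is_adjoint_def
  proof (intro conjI ballI)
    fix \<xi> \<eta> t
    show "inn M (grad M \<xi>) \<eta> t = inn M \<xi> (grad M \<eta>) t"
      unfolding inn_eq ip_def by (intro infsum_cong) (auto simp: model_def)
  qed (use grad_closed in auto)
  show "is_adjoint T M (rep M g) (rep M (- g))" for g by (fact rep_adjoint)
  show "is_adjoint T M (phi M a) (phi M (cnj a))" for a by (fact phi_adjoint)
  show "adjointable T M (oper M)" using oper_adjoint by (auto simp: adjointable_def)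
  show "compact_op T M (\<lambda>\<xi>. rep M g (oper M (rep M (- g) (phi M a \<xi>))) - oper M (phi M a \<xi>))" for g a
    by (fact oper_equivariant)
  show "compact_op T M (\<lambda>\<xi>. oper M (oper M (phi M a \<xi>)) - phi M a \<xi>)" for a by (fact oper_square)
  show "compact_op T M (\<lambda>\<xi>. phi M a (oper M \<xi>) - oper M (phi M a \<xi>))" for a
    by (rule compact_op_vanishing) (simp add: phi_smul oper_smul)
  show "compact_op T M (\<lambda>\<xi>. oper M (phi M a \<xi>) - B (phi M a \<xi>))" if "is_adjoint T M (oper M) B" for a B
    by (rule compact_op_vanishing) (simp add: is_adjoint_unique[OF oper_adjoint that] phi_closed)
  show "norm_continuous T M (\<lambda>g \<xi>. rep M g (phi M a (oper M (rep M (- g) \<xi>))))"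
    "norm_continuous T M (\<lambda>g \<xi>. rep M g (oper M (phi M a (rep M (- g) \<xi>))))" for a
    by (rule norm_continuous_oper_conjugates[of _ a], simp add: phi_smul oper_smul rep_smul)+
  fix \<xi> g assume x: "\<xi> \<in> carr M"
  show "((\<lambda>h. hnorm T M (rep M h \<xi> - rep M g \<xi>)) \<longlongrightarrow> 0) (at g)" using x by (rule rep_continuous)
  show "rep M 0 \<xi> = \<xi>" using x by (rule rep_zero)
  show "rep M (g + h) \<xi> = rep M g (rep M h \<xi>)" for h by (rule rep_add)
  show "rep M g (phi M a \<xi>) = phi M a (rep M g \<xi>)" for a by (simp add: phi_smul rep_smul)
  have "pi_r s g (\<lambda>y. - f y) = (\<lambda>x. - pi_r s g f x)" for s f
    using pi_r_linear[of s g "-1" f "\<lambda>y. 0"] pi_r_linear[of s g "-1" "\<lambda>y. 0" "\<lambda>y. 0"]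
    by (simp add: fun_eq_iff)
  then show "rep M g (grad M \<xi>) = grad M (rep M g \<xi>)" by (simp add: model_def fun_eq_iff)
qed (auto simp: model_def fun_eq_iff algebra_simps)

end


lemma isomorphic_CC_trans:
  assumes "isomorphic_CC c d" "isomorphic_CC d e"
  shows "isomorphic_CC c e"
proof -
  obtain v where "specializes 0 c d v" using assms(1) by (auto simp: isomorphic_CC_def)
  then show ?thesis
    using specializes_isomorphic[OF _ assms(2)] assms by (auto simp: isomorphic_CC_def)
qed

lemma ell2_slices:
  fixes f :: "'v \<times> bool \<Rightarrow> complex"
  assumes "\<And>b. ell2 (\<lambda>y. f (y, b))"
  shows "ell2 f"
proof -
  have "(\<lambda>i. (cmod (f i))\<^sup>2) summable_on range (\<lambda>y. (y, b))" for b
    using assms[of b] unfolding ell2_def by (subst summable_on_reindex) (auto simp: o_def inj_on_def)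
  then have "(\<lambda>i. (cmod (f i))\<^sup>2) summable_on range (\<lambda>y. (y, True)) \<union> range (\<lambda>y. (y, False))"
    by (intro summable_on_Un_disjoint) auto
  moreover have "range (\<lambda>y. (y, True)) \<union> range (\<lambda>y. (y, False)) = (UNIV :: ('v \<times> bool) set)"
    by (auto simp: image_iff)
  ultimately show ?thesis by (simp add: ell2_def)
qed

lemma small_tails_at_0: "small_tails {0} \<xi> \<longleftrightarrow> ell2 (\<xi> 0)"
proof
  assume "ell2 (\<xi> 0)"
  then have "small_tails {0} (\<lambda>_. \<xi> 0)" by (rule small_tails_singleton)
  then show "small_tails {0} \<xi>" by (rule small_tails_le[of _ _ _ 1]) simp
qed (rule ell2_if_small_tails, assumption, simp)


section \<open>The Julg-Valette cycle as a member of the family\<close>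

context tree_action
begin

text \<open>Inverse to \<open>edge_coords x0\<close>. On an edge the last alternative means that
  \<open>(x, y)\<close> points away from \<open>x0\<close>, hence the sign and the index
  \<open>y\<close>.\<close>

definition edge_fun :: "('v \<Rightarrow> complex) \<Rightarrow> 'v \<times> 'v \<Rightarrow> complex" where
  "edge_fun \<kappa> = (\<lambda>(x, y). if (x, y) \<in> X1 then (if x \<noteq> x0 \<and> y = par x0 x then \<kappa> x else - \<kappa> y) else 0)"

lemma par_edge: "x \<in> X0 \<Longrightarrow> x \<noteq> x0 \<Longrightarrow> (x, par x0 x) \<in> X1"
  using par_props(1)[OF origin] .

lemma par_antisym: "x \<in> X0 \<Longrightarrow> x \<noteq> x0 \<Longrightarrow> par x0 x \<noteq> x0 \<Longrightarrow> par x0 (par x0 x) \<noteq> x"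
  using par_par_neq[OF origin] .

lemma edge_fun_par: "x \<in> X0 \<Longrightarrow> x \<noteq> x0 \<Longrightarrow> edge_fun \<kappa> (x, par x0 x) = \<kappa> x"
  by (simp add: edge_fun_def par_edge)

lemma edge_fun_antisym: "edge_fun \<kappa> (y, x) = - edge_fun \<kappa> (x, y)"
proof (cases "(x, y) \<in> X1")
  case True
  have X0: "x \<in> X0" "y \<in> X0" using edge_in[OF True] by auto
  show ?thesis
  proof (cases rule: edge_par_cases[OF origin True])
    case 1
    then show ?thesis using True edge_sym[OF True] par_antisym[OF X0(1)] by (auto simp: edge_fun_def)
  next
    case 2
    then show ?thesis using True edge_sym[OF True] par_antisym[OF X0(2)] by (auto simp: edge_fun_def)
  qed
next
  case False
  then show ?thesis using edge_sym[of y x] by (auto simp: edge_fun_def)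
qed

lemma edge_coords_edge_fun:
  assumes "\<And>x. x \<notin> X0 \<Longrightarrow> \<kappa> x = 0" "\<kappa> x0 = 0"
  shows "edge_coords x0 (edge_fun \<kappa>) = \<kappa>"
  using assms by (auto simp: edge_coords_def edge_fun_par fun_eq_iff)

lemma edge_fun_edge_coords:
  assumes "\<And>e. e \<notin> X1 \<Longrightarrow> k e = 0" "\<And>x y. k (y, x) = - k (x, y)"
  shows "edge_fun (edge_coords x0 k) = k"
proof
  fix e :: "'v \<times> 'v"
  obtain x y where e: "e = (x, y)" by (cases e)
  show "edge_fun (edge_coords x0 k) e = k e"
  proof (cases "(x, y) \<in> X1")
    case True
    have X0: "x \<in> X0" "y \<in> X0" using edge_in[OF True] by auto
    show ?thesis
    proof (cases rule: edge_par_cases[OF origin True])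
      case 1
      then show ?thesis using True X0 by (auto simp: e edge_fun_def edge_coords_def)
    next
      case 2
      then show ?thesis
        using True X0 par_antisym[OF X0(2)] assms(2)[of x y] by (auto simp: e edge_fun_def edge_coords_def)
    qed
  qed (simp add: e edge_fun_def assms(1))
qed

definition down_edges :: "('v \<times> 'v) set" where
  "down_edges = (\<lambda>x. (x, par x0 x)) ` (X0 - {x0})"

definition up_edges :: "('v \<times> 'v) set" where
  "up_edges = (\<lambda>x. (par x0 x, x)) ` (X0 - {x0})"

lemma edges_eq: "down_edges \<union> up_edges = X1"
proof (rule sym, intro equalityI subsetI)
  fix e assume e: "e \<in> X1"
  obtain x y where [simp]: "e = (x, y)" by (cases e)
  have X0: "x \<in> X0" "y \<in> X0" using edge_in e by auto
  from e have "(x, y) \<in> X1" by simp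
  then show "e \<in> down_edges \<union> up_edges"
    by (rule edge_par_cases[OF origin]) (use X0 in \<open>auto simp: down_edges_def up_edges_def\<close>)
next
  fix e assume "e \<in> down_edges \<union> up_edges"
  then show "e \<in> X1" using par_edge edge_sym[OF par_edge] by (auto simp: down_edges_def up_edges_def)
qed

lemma edges_disjoint: "down_edges \<inter> up_edges = {}"
  using par_antisym by (auto simp: down_edges_def up_edges_def)

lemma inj_down: "inj_on (\<lambda>x. (x, par x0 x)) A" and inj_up: "inj_on (\<lambda>x. (par x0 x, x)) A"
  by (auto simp: inj_on_def)

lemma summable_edge_fun:
  assumes "ell2 \<kappa>"
  shows "(\<lambda>e. (cmod (edge_fun \<kappa> e))\<^sup>2) summable_on X1"
proof -
  have \<kappa>: "(\<lambda>x. (cmod (\<kappa> x))\<^sup>2) summable_on X0 - {x0}"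
    using assms unfolding ell2_def by (rule summable_on_subset_banach) simp
  have "(\<lambda>e. (cmod (edge_fun \<kappa> e))\<^sup>2) summable_on down_edges"
    unfolding down_edges_def summable_on_reindex[OF inj_down] o_def
    using \<kappa> by (rule summable_on_cong[THEN iffD1, rotated]) (simp add: edge_fun_par)
  moreover have "(\<lambda>e. (cmod (edge_fun \<kappa> e))\<^sup>2) summable_on up_edges"
    unfolding up_edges_def summable_on_reindex[OF inj_up] o_def
    using \<kappa> by (rule summable_on_cong[THEN iffD1, rotated])
      (simp add: edge_fun_antisym[of _ "par x0 _"] edge_fun_par)
  ultimately show ?thesis
    using summable_on_Un_disjoint[OF _ _ edges_disjoint] by (simp add: edges_eq)
qed

lemma ell2_edge_coords:
  assumes "(\<lambda>e. (cmod (k e))\<^sup>2) summable_on X1"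
  shows "ell2 (edge_coords x0 k)"
proof -
  have "(\<lambda>e. (cmod (k e))\<^sup>2) summable_on down_edges"
    using assms by (rule summable_on_subset_banach) (use edges_eq in blast)
  then have "(\<lambda>x. (cmod (k (x, par x0 x)))\<^sup>2) summable_on X0 - {x0}"
    unfolding down_edges_def summable_on_reindex[OF inj_down] o_def .
  also have "?this \<longleftrightarrow> ell2 (edge_coords x0 k)"
    unfolding ell2_def by (intro summable_on_cong_neutral) (auto simp: edge_coords_def)
  finally show ?thesis .
qed

text \<open>The two directions of the edges contribute equally, the signs cancelling in the product,
  and the normalization by \<open>1/2\<close> undoes this doubling.\<close>

lemma inner_edges_edge_fun:
  assumes "ell2 \<kappa>" "ell2 \<mu>" "\<kappa> x0 = 0" "\<And>x. x \<notin> X0 \<Longrightarrow> \<kappa> x = 0"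
  shows "inner_edges X1 (edge_fun \<kappa>) (edge_fun \<mu>) = ip \<kappa> \<mu>"
proof -
  let ?s = "\<lambda>e. cnj (edge_fun \<kappa> e) * edge_fun \<mu> e"
  have ip: "ip \<kappa> \<mu> = (\<Sum>\<^sub>\<infinity>x\<in>X0 - {x0}. cnj (\<kappa> x) * \<mu> x)"
    unfolding ip_def using assms by (intro infsum_cong_neutral) auto
  have summable: "(\<lambda>x. cnj (\<kappa> x) * \<mu> x) summable_on X0 - {x0}" using assms by (intro ell2_summable_ip)
  have down: "?s summable_on down_edges"
    unfolding down_edges_def summable_on_reindex[OF inj_down] o_def
    using summable by (rule summable_on_cong[THEN iffD1, rotated]) (simp add: edge_fun_par)
  have up: "?s summable_on up_edges"
    unfolding up_edges_def summable_on_reindex[OF inj_up] o_def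
    using summable by (rule summable_on_cong[THEN iffD1, rotated])
      (simp add: edge_fun_antisym[of _ "par x0 _"] edge_fun_par)
  have "infsum ?s X1 = infsum ?s down_edges + infsum ?s up_edges"
    using infsum_Un_disjoint[OF down up edges_disjoint] by (simp add: edges_eq)
  also have "infsum ?s down_edges = ip \<kappa> \<mu>"
    unfolding down_edges_def infsum_reindex[OF inj_down] o_def ip
    by (intro infsum_cong) (simp add: edge_fun_par)
  also have "infsum ?s up_edges = ip \<kappa> \<mu>"
    unfolding up_edges_def infsum_reindex[OF inj_up] o_def ip
    by (intro infsum_cong) (simp add: edge_fun_antisym[of _ "par x0 _"] edge_fun_par)
  finally show ?thesis by (simp add: inner_edges_def)
qed

lemma l2_edgesD:
  assumes "k \<in> l2_edges X1"
  shows "edge_fun (edge_coords x0 k) = k" "ell2 (edge_coords x0 k)"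
  using assms unfolding l2_edges_def mem_Collect_eq by (blast intro: edge_fun_edge_coords ell2_edge_coords)+

lemma edge_fun_in_l2_edges: "ell2 \<kappa> \<Longrightarrow> edge_fun \<kappa> \<in> l2_edges X1"
  unfolding l2_edges_def mem_Collect_eq
  by (intro conjI allI impI edge_fun_antisym summable_edge_fun) (auto simp: edge_fun_def)

lemma l2_vertices_iff: "f \<in> l2_vertices X0 \<longleftrightarrow> (\<forall>x. x \<notin> X0 \<longrightarrow> f x = 0) \<and> ell2 f"
proof -
  have "(\<lambda>x. (cmod (f x))\<^sup>2) summable_on X0 \<longleftrightarrow> ell2 f" if "\<forall>x. x \<notin> X0 \<longrightarrow> f x = 0"
    unfolding ell2_def using that by (intro summable_on_cong_neutral) auto
  then show ?thesis by (auto simp: l2_vertices_def)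
qed

text \<open>On each edge only the end farther from \<open>x0\<close> contributes to the sum. The
  value at \<open>x0\<close> is erased because \<open>F\<close> kills
  \<open>\<delta> x0\<close>.\<close>

lemma JV_eq: "JV X0 X1 x0 f = edge_fun (f(x0 := 0))"
proof
  fix e :: "'v \<times> 'v"
  obtain a b where e: "e = (a, b)" by (cases e)
  show "JV X0 X1 x0 f e = edge_fun (f(x0 := 0)) e"
  proof (cases "(a, b) \<in> X1")
    case True
    have X0: "a \<in> X0" "b \<in> X0" using edge_in[OF True] by auto
    show ?thesis
    proof (cases rule: edge_par_cases[OF origin True])
      case 1
      have "JV X0 X1 x0 f e = (\<Sum>\<^sub>\<infinity>x\<in>{a}. f x * delta_edge x (par x0 x) e)"
        unfolding JV_def using 1 X0 par_antisym[OF X0(1)]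
        by (intro infsum_cong_neutral) (auto simp: e delta_edge_def)
      then show ?thesis using 1 True edge_neq[OF True] by (auto simp: e delta_edge_def edge_fun_def)
    next
      case 2
      have "JV X0 X1 x0 f e = (\<Sum>\<^sub>\<infinity>x\<in>{b}. f x * delta_edge x (par x0 x) e)"
        unfolding JV_def using 2 X0 par_antisym[OF X0(2)]
        by (intro infsum_cong_neutral) (auto simp: e delta_edge_def)
      then show ?thesis
        using 2 True edge_neq[OF True] par_antisym[OF X0(2)] by (auto simp: e delta_edge_def edge_fun_def)
    qed
  next
    case False
    have "JV X0 X1 x0 f e = (\<Sum>\<^sub>\<infinity>x\<in>{}. f x * delta_edge x (par x0 x) e)"
      unfolding JV_def using False par_edge edge_sym[OF par_edge]
      by (intro infsum_cong_neutral) (auto simp: e delta_edge_def)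
    then show ?thesis using False by (simp add: e edge_fun_def)
  qed
qed

lemma ell2_delta: "ell2 (delta_vertex x)"
  by (rule ell2_if_bounded_sums[of _ 1])
    (simp add: delta_vertex_def if_distrib[of cmod] if_distrib[of "\<lambda>c. c\<^sup>2"] cong: if_cong)

lemma ip_delta: "ip (delta_vertex x) f = f x"
proof -
  have "ip (delta_vertex x) f = (\<Sum>\<^sub>\<infinity>y\<in>{x}. f y)"
    unfolding ip_def by (intro infsum_cong_neutral) (auto simp: delta_vertex_def)
  then show ?thesis by simp
qed

text \<open>\<open>F\<close> sends \<open>\<delta> x\<close> to the basis edge of index
  \<open>x\<close>, so the scalar product defining the adjoint reads off one coordinate.\<close>

lemma JV_adj_eq:
  assumes "k \<in> l2_edges X1"
  shows "JV_adj X0 X1 x0 k = edge_coords x0 k"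
proof
  fix x
  show "JV_adj X0 X1 x0 k x = edge_coords x0 k x"
  proof (cases "x \<in> X0 \<and> x \<noteq> x0")
    case True
    then have "(delta_vertex x)(x0 := 0) = delta_vertex x" by (auto simp: delta_vertex_def)
    then have "JV_adj X0 X1 x0 k x = inner_edges X1 (edge_fun (delta_vertex x)) (edge_fun (edge_coords x0 k))"
      using True by (simp add: JV_adj_def JV_eq l2_edgesD(1)[OF assms])
    also have "\<dots> = ip (delta_vertex x) (edge_coords x0 k)"
      using True by (intro inner_edges_edge_fun ell2_delta l2_edgesD(2)[OF assms]) (auto simp: delta_vertex_def)
    finally show ?thesis by (simp add: ip_delta)
  next
    case False
    have "edge_fun ((delta_vertex x0)(x0 := 0)) = (\<lambda>e. 0)" by (auto simp: edge_fun_def delta_vertex_def)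
    then show ?thesis using False by (auto simp: JV_adj_def JV_eq inner_edges_def edge_coords_def)
  qed
qed

lemma pi1_in:
  assumes "k \<in> l2_edges X1"
  shows "edge_fun (edge_coords x0 (pi1 X1 act g k)) = pi1 X1 act g k"
proof (rule edge_fun_edge_coords)
  have k: "k (y, x) = - k (x, y)" for x y using assms unfolding l2_edges_def by blast
  show "pi1 X1 act g k (y, x) = - pi1 X1 act g k (x, y)" for x y
    using k[of "act (- g) y" "act (- g) x"] edge_sym[of x y] edge_sym[of y x] by (auto simp: pi1_def)
qed (auto simp: pi1_def)

definition to_JV :: "(real \<Rightarrow> 'v \<times> bool \<Rightarrow> complex) \<Rightarrow> ('v \<Rightarrow> complex) \<times> ('v \<times> 'v \<Rightarrow> complex)" where
  "to_JV \<xi> = ((\<lambda>x. \<xi> 0 (x, True)), edge_fun (\<lambda>x. \<xi> 0 (x, False)))"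

definition from_JV :: "('v \<Rightarrow> complex) \<times> ('v \<times> 'v \<Rightarrow> complex) \<Rightarrow> real \<Rightarrow> 'v \<times> bool \<Rightarrow> complex" where
  "from_JV p = (\<lambda>t i. if t = 0 then (if snd i then fst p (fst i) else edge_coords x0 (snd p) (fst i)) else 0)"

lemma deformation_constant:
  assumes "countable X0" "\<bar>s\<bar> \<le> 1" "c = 1 \<or> s = 1"
  shows "deformation X0 X1 act x0 {0} (\<lambda>_. s) (\<lambda>_. c)"
  using assms by unfold_locales auto

text \<open>Parameter 0 gives the permutation representation on the vertices. On the edges
  \<open>pi_1_edge_coords\<close> is an exact intertwining relation, so the whole cycle matches and
  not merely up to compact operators.\<close>

lemma cycle_iso_JV:
  assumes "countable X0"
  shows "cycle_iso {0} (model {0} (\<lambda>_. 0) (\<lambda>_. 1)) (JV_cycle X0 X1 act x0) to_JV"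
proof -
  interpret deformation X0 X1 act x0 "{0}" "\<lambda>_. 0" "\<lambda>_. 1"
    using assms by (intro deformation_constant) auto
  have odd: "ell2 (\<lambda>x. \<xi> 0 (x, False))" "\<And>x. x \<notin> X0 \<Longrightarrow> \<xi> 0 (x, False) = 0" "\<xi> 0 (x0, False) = 0"
    if "\<xi> \<in> carr M" for \<xi>
    using that carr_ell2[OF that, of 0] carr_vertices carr_origin by (auto intro!: ell2_slice)
  have even: "ell2 (\<lambda>x. \<xi> 0 (x, True))" "\<And>x. x \<notin> X0 \<Longrightarrow> \<xi> 0 (x, True) = 0"
    if "\<xi> \<in> carr M" for \<xi>
    using that carr_ell2[OF that, of 0] carr_vertices by (auto intro!: ell2_slice)
  have coords: "edge_coords x0 (edge_fun (\<lambda>x. \<xi> 0 (x, False))) = (\<lambda>x. \<xi> 0 (x, False))"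
    if "\<xi> \<in> carr M" for \<xi>
    using odd[OF that] by (intro edge_coords_edge_fun) auto
  have closed: "to_JV \<xi> \<in> carr (JV_cycle X0 X1 act x0)" if "\<xi> \<in> carr M" for \<xi>
    using odd[OF that] even[OF that]
    by (auto simp: to_JV_def JV_cycle_def l2_vertices_iff edge_fun_in_l2_edges)
  have from_closed: "from_JV p \<in> carr M" if "p \<in> carr (JV_cycle X0 X1 act x0)" for p
  proof (rule carrI)
    have p: "fst p \<in> l2_vertices X0" "snd p \<in> l2_edges X1" using that by (auto simp: JV_cycle_def)
    show "from_JV p t i = 0" if "(t, i) \<notin> model_support {0} (\<lambda>_. 1)" for t i
      using that p(1) by (cases i) (auto simp: from_JV_def model_support_def l2_vertices_iff edge_coords_def split: if_splits)
    have "ell2 (from_JV p 0)"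
    proof (rule ell2_slices)
      show "ell2 (\<lambda>y. from_JV p 0 (y, b))" for b
        using p l2_edgesD(2)[OF p(2)] by (cases b) (auto simp: from_JV_def l2_vertices_iff)
    qed
    then show "small_tails {0} (from_JV p)" by (simp add: small_tails_at_0)
  qed simp
  show ?thesis
    unfolding cycle_iso_def
  proof (intro conjI ballI allI impI)
    show "bij_betw to_JV (carr M) (carr (JV_cycle X0 X1 act x0))"
    proof (rule bij_betw_byWitness[where f' = from_JV])
      show "\<forall>\<xi>\<in>carr M. from_JV (to_JV \<xi>) = \<xi>"
        using coords carr_outside_base by (auto simp: from_JV_def to_JV_def fun_eq_iff)
      show "\<forall>p\<in>carr (JV_cycle X0 X1 act x0). to_JV (from_JV p) = p"
        using l2_edgesD(1) by (auto simp: from_JV_def to_JV_def JV_cycle_def)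
    qed (use closed from_closed in auto)
    fix \<xi> assume x: "\<xi> \<in> carr M"
    show "to_JV (\<xi> + \<eta>) = to_JV \<xi> + to_JV \<eta>" for \<eta>
      by (auto simp: to_JV_def edge_fun_def fun_eq_iff)
    show "to_JV (smul M f \<xi>) = smul (JV_cycle X0 X1 act x0) f (to_JV \<xi>)" for f
      by (auto simp: to_JV_def edge_fun_def fun_eq_iff JV_cycle_def smul_eq)
    show "to_JV (grad M \<xi>) = grad (JV_cycle X0 X1 act x0) (to_JV \<xi>)"
      by (auto simp: to_JV_def edge_fun_def fun_eq_iff JV_cycle_def model_def)
    show "to_JV (phi M a \<xi>) = phi (JV_cycle X0 X1 act x0) a (to_JV \<xi>)" for a
      by (auto simp: to_JV_def edge_fun_def fun_eq_iff JV_cycle_def model_def)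
    show "inn (JV_cycle X0 X1 act x0) (to_JV \<xi>) (to_JV \<eta>) t = inn M \<xi> \<eta> t"
      if y: "\<eta> \<in> carr M" and "t \<in> {0}" for \<eta> t
    proof -
      have "inner_vertices X0 (\<lambda>x. \<xi> 0 (x, True)) (\<lambda>x. \<eta> 0 (x, True)) =
          ip (\<lambda>x. \<xi> 0 (x, True)) (\<lambda>x. \<eta> 0 (x, True))"
        using ip_on_vertices[of "\<lambda>x. \<xi> 0 (x, True)"] even(2)[OF x] by (simp add: inner_vertices_def)
      then show ?thesis
        using \<open>t \<in> {0}\<close> inner_edges_edge_fun[OF odd(1)[OF x] odd(1)[OF y] odd(3)[OF x] odd(2)[OF x]]
        by (simp add: JV_cycle_def to_JV_def inn_eq ip_slices carr_ell2 x y)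
    qed
    show "to_JV (rep M g \<xi>) = rep (JV_cycle X0 X1 act x0) g (to_JV \<xi>)" for g
    proof -
      define k where "k = edge_fun (\<lambda>x. \<xi> 0 (x, False))"
      have k: "k \<in> l2_edges X1" unfolding k_def using odd(1)[OF x] by (rule edge_fun_in_l2_edges)
      have "pi_r 1 g (edge_coords x0 k) = edge_coords x0 (pi1 X1 act g k)"
        unfolding k_def by (rule pi_1_edge_coords) (rule edge_fun_antisym)
      then have "edge_fun (pi_r 1 g (\<lambda>x. \<xi> 0 (x, False))) = pi1 X1 act g k"
        using pi1_in[OF k] coords[OF x] by (simp add: k_def)
      moreover have "pi_r 0 g (\<lambda>x. \<xi> 0 (x, True)) = pi0 X0 act g (\<lambda>x. \<xi> 0 (x, True))"
        by (simp add: pi_0 perm_def pi0_def)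
      ultimately show ?thesis
        by (simp add: to_JV_def JV_cycle_def rep_slice level_def k_def)
    qed
    show "to_JV (oper M \<xi>) = oper (JV_cycle X0 X1 act x0) (to_JV \<xi>)"
    proof -
      have "JV_adj X0 X1 x0 (edge_fun (\<lambda>x. \<xi> 0 (x, False))) = (\<lambda>x. \<xi> 0 (x, False))"
        using JV_adj_eq[OF edge_fun_in_l2_edges[OF odd(1)[OF x]]] coords[OF x] by simp
      moreover have "(\<lambda>x. \<xi> 0 (x, False))(x0 := 0) = (\<lambda>x. \<xi> 0 (x, False))"
        using odd(3)[OF x] by (simp add: fun_upd_idem)
      ultimately show ?thesis by (simp add: to_JV_def JV_cycle_def oper_slice JV_eq)
    qed
  qed
qed

text \<open>With cutoff 0 only the index \<open>(x0, True)\<close> survives, and there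
  \<open>pi_1_origin\<close> makes the action trivial.\<close>

lemma cycle_iso_trivial:
  assumes "countable X0"
  shows "cycle_iso {0} (model {0} (\<lambda>_. 1) (\<lambda>_. 0)) trivial_cycle (\<lambda>\<xi>. \<xi> 0 (x0, True))"
proof -
  interpret deformation X0 X1 act x0 "{0}" "\<lambda>_. 1" "\<lambda>_. 0"
    using assms by (intro deformation_constant) auto
  have zero: "\<xi> t i = 0" if "\<xi> \<in> carr M" "t \<noteq> 0 \<or> i \<noteq> (x0, True)" for \<xi> t i
    using that(2) by (intro carrD(1)[OF that(1)]) (cases i, auto simp: model_support_def split: if_splits)
  define u where "u = (\<lambda>z t i. if t = (0 :: real) \<and> i = (x0, True) then z else (0 :: complex))"
  have u: "u z \<in> carr M" for z
  proof (rule carrI)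
    show "small_tails {0} (u z)" by (rule small_tails_finite_support[of "{(x0, True)}"]) (auto simp: u_def)
  qed (use origin in \<open>auto simp: u_def model_support_def\<close>)
  show ?thesis
    unfolding cycle_iso_def
  proof (intro conjI ballI allI impI)
    show "bij_betw (\<lambda>\<xi>. \<xi> 0 (x0, True)) (carr M) (carr (trivial_cycle :: ('g, complex) kcycle))"
    proof (rule bij_betw_byWitness[where f' = u])
      show "\<forall>\<xi>\<in>carr M. u (\<xi> 0 (x0, True)) = \<xi>"
        using zero by (fastforce simp: u_def fun_eq_iff)
    qed (use u in \<open>auto simp: trivial_cycle_def u_def\<close>)
    fix \<xi> assume x: "\<xi> \<in> carr M"
    fix \<eta> and t :: real assume y: "\<eta> \<in> carr M" and t: "t \<in> {0}"
    have "ip (\<xi> 0) (\<eta> 0) = (\<Sum>\<^sub>\<infinity>i\<in>{(x0, True)}. cnj (\<xi> 0 i) * \<eta> 0 i)"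
      unfolding ip_def using zero[OF x] by (intro infsum_cong_neutral) auto
    then show "inn trivial_cycle (\<xi> 0 (x0, True)) (\<eta> 0 (x0, True)) t = inn M \<xi> \<eta> t"
      using t by (simp add: trivial_cycle_def inn_eq)
  qed (auto simp: trivial_cycle_def smul_eq model_def rep_apply oper_apply level_def pi_1_origin)
qed

end

section \<open>Evaluation of the homotopy and conclusion\<close>

lemma (in deformation) evaluation_specializes:
  assumes t: "t \<in> T" and cf: "\<And>s. \<bar>cf s\<bar> \<le> 1" "cf t = 0 \<or> cf t = 1"
  shows "specializes t M (model {0} (\<lambda>_. r t) (\<lambda>_. cf t)) (\<lambda>\<xi> s i. if s = 0 then \<xi> t i else 0)"
proof -
  interpret e: deformation X0 X1 act x0 "{0}" "\<lambda>_. r t" "\<lambda>_. cf t"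
    using cutoff[OF t] by (intro deformation_constant vertices_countable r_le) auto
  let ?v = "\<lambda>\<xi> s i. if s = (0 :: real) then \<xi> t i else (0 :: complex)"
  have level: "level (\<lambda>_. r t) b s = level r b t" for b s by (simp add: level_def)
  have supp: "(0, i) \<in> model_support {0} (\<lambda>_. cf t) \<longleftrightarrow> (t, i) \<in> model_support T cf" for i
    using t by (cases i) (auto simp: model_support_def)
  have closed: "?v \<xi> \<in> carr e.M" if x: "\<xi> \<in> carr M" for \<xi>
  proof (rule e.carrI)
    show "?v \<xi> s i = 0" if "(s, i) \<notin> model_support {0} (\<lambda>_. cf t)" for s i
      using that carrD(1)[OF x, of t i] supp[of i] by auto
    show "small_tails {0} (?v \<xi>)" using carr_ell2[OF x t] by (simp add: small_tails_at_0)
  qed simp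
  have onto: "\<exists>\<xi>\<in>carr M. ?v \<xi> = \<eta>" if y: "\<eta> \<in> carr e.M" for \<eta>
  proof
    \<comment> \<open>The weight makes the extended section admissible over all of \<open>T\<close>.
      At \<open>t\<close> it equals 1 on the support because \<open>cf t\<close> is 0 or 1, so
      evaluation is onto.\<close>
    define \<xi> where "\<xi> = (\<lambda>s i. if s \<in> T then weight i s * \<eta> 0 i else 0)"
    show "\<xi> \<in> carr M"
    proof (rule carrI)
      show "\<xi> s i = 0" if "(s, i) \<notin> model_support T cf" for s i
        using that by (auto simp: \<xi>_def weight_support)
      show "continuous_on T (\<lambda>s. \<xi> s i)" for i
        unfolding \<xi>_def using continuous_on_mult_right[OF weight_continuous, of i "\<eta> 0 i"]
        by (simp cong: continuous_on_cong)
      have "small_tails T (\<lambda>_. \<eta> 0)"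
        using small_tails_singleton[OF e.carr_ell2[OF y, of 0], of 0] by (auto simp: small_tails_def)
      then show "small_tails T \<xi>"
      proof (rule small_tails_le[of _ _ _ 1])
        show "cmod (\<xi> s i) \<le> 1 * cmod (\<eta> 0 i)" for s i
          using cf(1)[of s] by (auto simp: \<xi>_def weight_def norm_mult mult_left_le_one_le)
      qed
    qed
    have "weight i t * \<eta> 0 i = \<eta> 0 i" for i
    proof (cases "\<eta> 0 i = 0")
      case False
      then have "(0, i) \<in> model_support {0} (\<lambda>_. cf t)" using e.carrD(1)[OF y] by blast
      then have "weight i t = 1" using cf(2) by (cases i) (auto simp: model_support_def weight_def split: if_splits)
      then show ?thesis by simp
    qed simp
    then show "?v \<xi> = \<eta>" using t e.carr_outside_base[OF y] by (auto simp: \<xi>_def fun_eq_iff)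
  qed
  show ?thesis
    unfolding specializes_def
  proof (intro conjI ballI allI impI)
    show "?v \<in> carr M \<rightarrow> carr e.M" using closed by auto
    fix \<eta> and \<epsilon> :: real assume "\<eta> \<in> carr e.M" "\<epsilon> > 0"
    then obtain \<xi> where "\<xi> \<in> carr M" "?v \<xi> = \<eta>" using onto by blast
    then show "\<exists>\<xi>\<in>carr M. hnorm {0} e.M (\<eta> - ?v \<xi>) < \<epsilon>"
      using \<open>\<epsilon> > 0\<close> e.hnorm_zero by (intro bexI[of _ \<xi>]) auto
  next
    fix \<xi> g
    have zero: "pi_r s g (\<lambda>y. 0) = (\<lambda>x. 0)" for s
      using pi_r_linear[of s g "-1" "\<lambda>y. 0" "\<lambda>y. 0"] by simp
    show "?v (rep M g \<xi>) = rep e.M g (?v \<xi>)"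
      by (auto simp: fun_eq_iff rep_apply e.rep_apply level zero)
  qed (auto simp: fun_eq_iff model_def)
qed

text \<open>The coding simply enumerates coordinates; it is injective because module elements vanish
  off the vertices.\<close>

lemma (in deformation) isomorphic_in_univ:
  "\<exists>v :: _ \<Rightarrow> univ. cycle_iso T M (push_cycle v M) v"
proof -
  let ?A = "X0 \<times> (UNIV :: bool set)"
  define v :: "(real \<Rightarrow> 'v \<times> bool \<Rightarrow> complex) \<Rightarrow> univ" where "v = (\<lambda>\<xi> n s. \<xi> s (from_nat_into ?A n))"
  have A: "countable ?A" using vertices_countable by simp
  have "inj_on v (carr M)"
  proof (rule inj_onI)
    fix \<xi> \<eta> assume x: "\<xi> \<in> carr M" and y: "\<eta> \<in> carr M" and eq: "v \<xi> = v \<eta>"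
    have "\<xi> s i = \<eta> s i" for s i
    proof (cases "i \<in> ?A")
      case True
      then have "from_nat_into ?A (to_nat_on ?A i) = i" using A by simp
      then show ?thesis using fun_cong[OF fun_cong[OF eq, of "to_nat_on ?A i"], of s] by (simp add: v_def)
    next
      case False
      then show ?thesis using carr_vertices[OF x] carr_vertices[OF y] by (cases i) auto
    qed
    then show "\<xi> = \<eta>" by blast
  qed
  then have "cycle_iso T M (push_cycle v M) v"
    by (rule cycle_iso_push_cycle) (simp add: v_def fun_eq_iff)
  then show ?thesis by blast
qed

lemma cycle_iso_KK:
  assumes "kasparov_cycle {0} c" "cycle_iso {0} c d v"
  shows "isomorphic_CC c d" "isomorphic_CC d c"
  using cycle_iso_isomorphic[OF assms]
    cycle_iso_isomorphic[OF cycle_iso_kasparov_cycle[OF assms] cycle_iso_inverse[OF assms]] by auto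

theorem corollary3:
  fixes X0 :: "'v set" and X1 :: "('v \<times> 'v) set"
    and act :: "'g::{topological_group_add, t2_space} \<Rightarrow> 'v \<Rightarrow> 'v"
    and x0 :: 'v
  assumes "locally_compact_space (euclidean :: 'g topology)"
    and "tree X0 X1" and "bounded_degree X0 X1"
    and "continuous_action X0 X1 act"
    and "x0 \<in> X0"
  shows "gamma X0 X1 act x0 \<in> KK_CC \<and> gamma X0 X1 act x0 = KK_one"
proof -
  interpret tree_action X0 X1 act x0 by unfold_locales (fact assms)+
  have X0: "countable X0" by (rule countable_vertices[OF assms(3)])
  \<comment> \<open>On the first half \<open>r\<close> rises from 0 to 1 while
    \<open>cf = 1\<close>; on the second \<open>r = 1\<close> while \<open>cf\<close> falls to 0.
    Absolute value and truncations keep both in \<open>[0, 1]\<close> for all real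
    \<open>t\<close>.\<close>
  define r where "r = (\<lambda>t :: real. min 1 \<bar>2 * t\<bar>)"
  define cf where "cf = (\<lambda>t :: real. max 0 (min 1 (2 - 2 * t)))"
  interpret h: deformation X0 X1 act x0 "{0..1}" r cf
    by unfold_locales (auto simp: X0 r_def cf_def intro!: continuous_intros)
  interpret d0: deformation X0 X1 act x0 "{0}" "\<lambda>_. 0" "\<lambda>_. 1"
    using X0 by (intro deformation_constant) auto
  interpret d1: deformation X0 X1 act x0 "{0}" "\<lambda>_. 1" "\<lambda>_. 0"
    using X0 by (intro deformation_constant) auto
  obtain v :: "_ \<Rightarrow> univ" where v: "cycle_iso {0..1} h.M (push_cycle v h.M) v"
    using h.isomorphic_in_univ by blast
  obtain v0 :: "_ \<Rightarrow> univ" where v0: "cycle_iso {0} d0.M (push_cycle v0 d0.M) v0"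
    using d0.isomorphic_in_univ by blast
  obtain v1 :: "_ \<Rightarrow> univ" where v1: "cycle_iso {0} d1.M (push_cycle v1 d1.M) v1"
    using d1.isomorphic_in_univ by blast
  note JV = cycle_iso_KK[OF d0.model_kasparov_cycle cycle_iso_JV[OF X0]]
  note trivial = cycle_iso_KK[OF d1.model_kasparov_cycle cycle_iso_trivial[OF X0]]
  have at_0: "\<exists>w. specializes 0 h.M d0.M w" and at_1: "\<exists>w. specializes 1 h.M d1.M w"
    using h.evaluation_specializes[of 0] h.evaluation_specializes[of 1] by (auto simp: r_def cf_def)
  note h_cycle = cycle_iso_kasparov_cycle[OF h.model_kasparov_cycle v]
  note h_inverse = cycle_iso_inverse[OF h.model_kasparov_cycle v]
  have "KK_class (JV_cycle X0 X1 act x0) \<in> KK_CC \<and> KK_class (JV_cycle X0 X1 act x0) = KK_class trivial_cycle"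
  proof (rule KK_class_eqI)
    show "isomorphic_CC (JV_cycle X0 X1 act x0) (push_cycle v0 d0.M)"
      using JV(2) cycle_iso_KK(1)[OF d0.model_kasparov_cycle v0] by (rule isomorphic_CC_trans)
    show "isomorphic_CC trivial_cycle (push_cycle v1 d1.M)"
      using trivial(2) cycle_iso_KK(1)[OF d1.model_kasparov_cycle v1] by (rule isomorphic_CC_trans)
    fix c d :: "('g, univ) kcycle"
    assume c: "isomorphic_CC (JV_cycle X0 X1 act x0) c" and d: "isomorphic_CC trivial_cycle d"
    \<comment> \<open>The copy \<open>c\<close> is arbitrary: evaluation lands in the model and is
      then carried across isomorphisms. The inverse of \<open>v\<close> transfers it to the copy of
      the homotopy in \<open>univ\<close>.\<close>
    obtain w where "specializes 0 h.M c w"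
      using at_0 specializes_isomorphic isomorphic_CC_trans[OF JV(1) c] by blast
    then have "\<exists>w. specializes 0 (push_cycle v h.M) c w"
      using cycle_iso_specializes[OF h_cycle h_inverse] by fastforce
    moreover obtain w where "specializes 1 h.M d w"
      using at_1 specializes_isomorphic isomorphic_CC_trans[OF trivial(1) d] by blast
    then have "\<exists>w. specializes 1 (push_cycle v h.M) d w"
      using cycle_iso_specializes[OF h_cycle h_inverse] by fastforce
    ultimately show "homotopic_CC c d"
      using c d h_cycle by (auto simp: homotopic_CC_def isomorphic_CC_def)
  qed
  then show ?thesis unfolding gamma_def KK_one_def .
qed

end
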